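(* Let $\mathcal{V}$ be $\mathsf{Met}$ or $\mathsf{CMet}$ and let $F$ be an (enriched, i.e. locally nonexpanding) endofunctor of $\mathcal{V}$. Then $F$ is strongly finitary if and only if it preserves directed colimits and colimits of precongruences.
   Context: $\mathsf{Met}$ is the category of extended metric spaces (metrics may take the value $\infty$) and nonexpanding maps ($d(f(x),f(x'))\le d(x,x')$); $\mathsf{CMet}$ is its full subcategory on complete spaces. For $\mathcal V=\mathsf{Met}$ or $\mathsf{CMet}$, the hom-set $\mathcal{V}(X,Y)$ carries the supremum metric, denoted $[X,Y]$. A category enriched over $\mathcal V$ has hom-sets that are (complete) metric spaces with composition nonexpanding with respect to the addition metric on products; enriched functors $F$ are locally nonexpanding: $d(Ff,Fg)\le d(f,g)$. Natural transformations between two such functors carry the metric $\sup_X d(\tau_X,\tau'_X)$. Strong finitarity: let $K:\mathsf{Set}_{\mathrm{fin}}\to\mathcal{V}$ send a finite set to the discrete space on it (distinct points have distance $\infty$). $F$ is strongly finitary if $F=\mathrm{Lan}_K(F\cdot K)$ (enriched left Kan extension): for every enriched endofunctor $G$ of $\mathcal V$ and every natural transformation $\sigma:FK\to GK$ there is a unique natural transformation $\bar\sigma:F\to G$ with $\bar\sigma K=\sigma$. Weighted colimits: for an enriched functor $D:\mathcal{D}\to\mathcal{V}$ and a weight (enriched functor) $W:\mathcal{D}^{op}\to\mathcal{V}$, a weighted colimit is an object $C=\mathrm{colim}_W D$ with isomorphisms $\psi_X:\mathcal{V}(C,X)\to[\mathcal{D}^{op},\mathcal{V}](W,\mathcal{V}(D-,X))$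 in $\mathcal{V}$, natural in $X$; its unit is $\nu=\psi_C(\mathrm{id}_C):W\to\mathcal{V}(D-,C)$. $F$ preserves this colimit if $FC=\mathrm{colim}_W FD$ with unit $\bar\nu$ whose components are $\bar\nu_d=F\nu_d$ (i.e. $\bar\nu_d(w)=F(\nu_d(w))$). Directed colimits are the (conical) colimits of diagrams indexed by directed posets. Precongruences: the category $\mathcal{D}_0$ has an object $a$ and an object $\varepsilon$ for every rational $\varepsilon>0$; the only non-identity morphisms are two morphisms $\lambda_\varepsilon,\rho_\varepsilon:\varepsilon\to a$ for each $\varepsilon$, with hom-spaces discrete. The basic weight $W_0:\mathcal{D}_0^{op}\to\mathcal{V}$ has $W_0a=\{0\}$, $W_0\varepsilon=\{l,r\}$ with $d(l,r)=\varepsilon$, and $W_0\lambda_\varepsilon(0)=l$, $W_0\rho_\varepsilon(0)=r$. For a space $M$ in $\mathcal{V}$, its precongruence is the diagram $D_M:\mathcal{D}_0\to\mathcal{V}$ with weight $W_0$, where $D_Ma=|M|$ is the discrete space on the set underlying $M$, $D_M\varepsilon\subseteq|M|\times|M|$ is the (discrete) set of all pairs of points of distance at most $\varepsilon$ in $M$, and $D_M\lambda_\varepsilon,D_M\rho_\varepsilon:D_M\varepsilon\to|M|$ are the left and right projections. "Preserves colimits of precongruences" means that for every $M$ in $\mathcal V$, $F$ preserves the weighted colimit of $D_M$ (which is $M$). *)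

theory Defs
  imports
    "HOL-Library.Extended_Nonnegative_Real"
    "HOL-Library.FuncSet"
    "HOL-Library.Equipollence"
    "HOL-Library.Nat_Bijection"
begin

section \<open>Extended metric spaces\<close>

text \<open>
  The metric spaces of the library are real-valued, so spaces with distances in \<open>[0,\<infinity>]\<close> are
  introduced here. As usual for records with an explicit carrier, only the values of \<open>ed\<close> on
  the carrier matter.
\<close>

record 'a emet =
  pts :: "'a set"
  ed :: "'a \<Rightarrow> 'a \<Rightarrow> ennreal"

definition ext_metric :: "'a emet \<Rightarrow> bool" where
  "ext_metric X \<longleftrightarrow>
     (\<forall>x\<in>pts X. \<forall>y\<in>pts X. ed X x y = 0 \<longleftrightarrow> x = y) \<and>
     (\<forall>x\<in>pts X. \<forall>y\<in>pts X. ed X x y = ed X y x) \<and>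
     (\<forall>x\<in>pts X. \<forall>y\<in>pts X. \<forall>z\<in>pts X. ed X x z \<le> ed X x y + ed X y z)"

definition complete_emet :: "'a emet \<Rightarrow> bool" where
  "complete_emet X \<longleftrightarrow>
     (\<forall>s::nat \<Rightarrow> 'a. (\<forall>n. s n \<in> pts X) \<and>
          (\<forall>e>0. \<exists>N. \<forall>m\<ge>N. \<forall>n\<ge>N. ed X (s m) (s n) < e) \<longrightarrow>
        (\<exists>x\<in>pts X. \<forall>e>0. \<exists>N. \<forall>n\<ge>N. ed X (s n) x < e))"

definition discrete :: "'a set \<Rightarrow> 'a emet" where
  "discrete A = \<lparr>pts = A, ed = (\<lambda>x y. if x = y then 0 else \<infinity>)\<rparr>"

definition nonexpanding :: "'a emet \<Rightarrow> 'b emet \<Rightarrow> ('a \<Rightarrow> 'b) \<Rightarrow> bool" where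
  "nonexpanding X Y f \<longleftrightarrow>
     f \<in> pts X \<rightarrow> pts Y \<and> (\<forall>x\<in>pts X. \<forall>x'\<in>pts X. ed Y (f x) (f x') \<le> ed X x x')"

text \<open>
  The space \<open>[X,Y]\<close> of morphisms with the supremum metric. Its elements are extensional
  functions, so that equality of morphisms is equality in HOL.
\<close>

definition hom_space :: "'a emet \<Rightarrow> 'b emet \<Rightarrow> ('a \<Rightarrow> 'b) emet" where
  "hom_space X Y =
     \<lparr>pts = {f \<in> pts X \<rightarrow>\<^sub>E pts Y. nonexpanding X Y f},
      ed = (\<lambda>f g. SUP x\<in>pts X. ed Y (f x) (g x))\<rparr>"

definition met_iso :: "'a emet \<Rightarrow> 'b emet \<Rightarrow> ('a \<Rightarrow> 'b) \<Rightarrow> bool" where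
  "met_iso X Y f \<longleftrightarrow>
     nonexpanding X Y f \<and>
     (\<exists>g. nonexpanding Y X g \<and> (\<forall>x\<in>pts X. g (f x) = x) \<and> (\<forall>y\<in>pts Y. f (g y) = y))"


section \<open>Small spaces\<close>

text \<open>
  \<open>universe U pr\<close> says that the members of \<open>U\<close> serve as the small sets and that \<open>pr\<close> codes pairs
  of elements. Smallness is invariant under equipotence and inherited by subsets and images; it is
  closed under unions of small families and under countable powers (which makes completions and
  finite products of small spaces small). The sets of cardinality below an inaccessible cardinal,
  that is, the sets equipotent to a member of a Grothendieck universe, are an instance. Closure
  under power sets is not demanded, so that instances exist outright (\<open>universe_nat_fun\<close> below).
\<close>

definition universe :: "'u set set \<Rightarrow> ('u \<times> 'u \<Rightarrow> 'u) \<Rightarrow> bool" where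
  "universe U pr \<longleftrightarrow>
     (\<exists>A\<in>U. infinite A) \<and>
     (\<forall>A\<in>U. \<forall>B::'u set. B \<lesssim> A \<longrightarrow> B \<in> U) \<and>
     (\<forall>A\<in>U. \<forall>f. (\<forall>a\<in>A. f a \<in> U) \<longrightarrow> (\<Union>a\<in>A. f a) \<in> U) \<and>
     (\<forall>A\<in>U. \<exists>B\<in>U. ((UNIV::nat set) \<rightarrow>\<^sub>E A) \<lesssim> B) \<and>
     inj pr"

definition Met :: "'u set set \<Rightarrow> 'u emet set" where
  "Met U = {X. ext_metric X \<and> pts X \<in> U}"

definition CMet :: "'u set set \<Rightarrow> 'u emet set" where
  "CMet U = {X \<in> Met U. complete_emet X}"


section \<open>Enriched categories and functors\<close>

text \<open>\<open>Comp C x y z g f\<close> is the composite of \<open>f : x \<rightarrow> y\<close> and \<open>g : y \<rightarrow> z\<close>.\<close>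

record ('o, 'm) ecat =
  Obj :: "'o set"
  Hom :: "'o \<Rightarrow> 'o \<Rightarrow> 'm emet"
  Comp :: "'o \<Rightarrow> 'o \<Rightarrow> 'o \<Rightarrow> 'm \<Rightarrow> 'm \<Rightarrow> 'm"
  Ident :: "'o \<Rightarrow> 'm"

text \<open>
  Composition is nonexpanding for the addition metric on the product of hom-spaces. The notion
  is stated over extended metric spaces; the hom-spaces of the categories used below are
  complete as soon as the target spaces are.
\<close>

definition enriched_category :: "('o, 'm) ecat \<Rightarrow> bool" where
  "enriched_category C \<longleftrightarrow>
     (\<forall>x\<in>Obj C. \<forall>y\<in>Obj C. ext_metric (Hom C x y)) \<and>
     (\<forall>x\<in>Obj C. Ident C x \<in> pts (Hom C x x)) \<and>
     (\<forall>x\<in>Obj C. \<forall>y\<in>Obj C. \<forall>z\<in>Obj C. \<forall>f\<in>pts (Hom C x y). \<forall>g\<in>pts (Hom C y z).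
        Comp C x y z g f \<in> pts (Hom C x z)) \<and>
     (\<forall>x\<in>Obj C. \<forall>y\<in>Obj C. \<forall>z\<in>Obj C.
        \<forall>f\<in>pts (Hom C x y). \<forall>f'\<in>pts (Hom C x y). \<forall>g\<in>pts (Hom C y z). \<forall>g'\<in>pts (Hom C y z).
        ed (Hom C x z) (Comp C x y z g f) (Comp C x y z g' f')
          \<le> ed (Hom C y z) g g' + ed (Hom C x y) f f') \<and>
     (\<forall>x\<in>Obj C. \<forall>y\<in>Obj C. \<forall>f\<in>pts (Hom C x y).
        Comp C x x y f (Ident C x) = f \<and> Comp C x y y (Ident C y) f = f) \<and>
     (\<forall>w\<in>Obj C. \<forall>x\<in>Obj C. \<forall>y\<in>Obj C. \<forall>z\<in>Obj C.
        \<forall>f\<in>pts (Hom C w x). \<forall>g\<in>pts (Hom C x y). \<forall>h\<in>pts (Hom C y z).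
        Comp C w y z h (Comp C w x y g f) = Comp C w x z (Comp C x y z h g) f)"

definition op_cat :: "('o, 'm) ecat \<Rightarrow> ('o, 'm) ecat" where
  "op_cat C = \<lparr>Obj = Obj C, Hom = (\<lambda>x y. Hom C y x),
     Comp = (\<lambda>x y z g f. Comp C z y x f g), Ident = Ident C\<rparr>"

text \<open>The full subcategory of extended metric spaces on a set \<open>V\<close> of objects.\<close>

definition met_cat :: "'a emet set \<Rightarrow> ('a emet, 'a \<Rightarrow> 'a) ecat" where
  "met_cat V = \<lparr>Obj = V, Hom = hom_space,
     Comp = (\<lambda>X Y Z g f. compose (pts X) g f), Ident = (\<lambda>X. \<lambda>x\<in>pts X. x)\<rparr>"

record ('o, 'm, 'p, 'n) efun =
  fobj :: "'o \<Rightarrow> 'p"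
  farr :: "'o \<Rightarrow> 'o \<Rightarrow> 'm \<Rightarrow> 'n"

definition enriched_functor ::
  "('o, 'm) ecat \<Rightarrow> ('p, 'n) ecat \<Rightarrow> ('o, 'm, 'p, 'n) efun \<Rightarrow> bool" where
  "enriched_functor C D F \<longleftrightarrow>
     enriched_category C \<and> enriched_category D \<and>
     (\<forall>x\<in>Obj C. fobj F x \<in> Obj D) \<and>
     (\<forall>x\<in>Obj C. \<forall>y\<in>Obj C.
        nonexpanding (Hom C x y) (Hom D (fobj F x) (fobj F y)) (farr F x y)) \<and>
     (\<forall>x\<in>Obj C. farr F x x (Ident C x) = Ident D (fobj F x)) \<and>
     (\<forall>x\<in>Obj C. \<forall>y\<in>Obj C. \<forall>z\<in>Obj C. \<forall>f\<in>pts (Hom C x y). \<forall>g\<in>pts (Hom C y z).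
        farr F x z (Comp C x y z g f)
          = Comp D (fobj F x) (fobj F y) (fobj F z) (farr F y z g) (farr F x y f))"

definition comp_fun ::
  "('p, 'n, 'q, 'k) efun \<Rightarrow> ('o, 'm, 'p, 'n) efun \<Rightarrow> ('o, 'm, 'q, 'k) efun" where
  "comp_fun G F = \<lparr>fobj = (\<lambda>x. fobj G (fobj F x)),
     farr = (\<lambda>x y f. farr G (fobj F x) (fobj F y) (farr F x y f))\<rparr>"

text \<open>
  The space \<open>[C,V](S,T)\<close> of natural transformations between space-valued functors, with the
  supremum metric. \<open>S\<close> and \<open>T\<close> may take values in spaces over different types.
\<close>

definition nat_space ::
  "('o, 'm) ecat \<Rightarrow> ('o, 'm, 'a emet, 'a \<Rightarrow> 'a) efun \<Rightarrow> ('o, 'm, 'b emet, 'b \<Rightarrow> 'b) efun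
     \<Rightarrow> ('o \<Rightarrow> 'a \<Rightarrow> 'b) emet" where
  "nat_space C S T =
     \<lparr>pts = {\<tau> \<in> (\<Pi>\<^sub>E x\<in>Obj C. pts (hom_space (fobj S x) (fobj T x))).
        \<forall>x\<in>Obj C. \<forall>y\<in>Obj C. \<forall>f\<in>pts (Hom C x y).
          compose (pts (fobj S x)) (farr T x y f) (\<tau> x)
            = compose (pts (fobj S x)) (\<tau> y) (farr S x y f)},
      ed = (\<lambda>\<tau> \<tau>'. SUP x\<in>Obj C. ed (hom_space (fobj S x) (fobj T x)) (\<tau> x) (\<tau>' x))\<rparr>"


section \<open>Strongly finitary functors\<close>

definition fin_cat :: "('a set, 'a \<Rightarrow> 'a) ecat" where
  "fin_cat = \<lparr>Obj = {A. finite A}, Hom = (\<lambda>A B. discrete (A \<rightarrow>\<^sub>E B)),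
     Comp = (\<lambda>A B C g f. compose A g f), Ident = (\<lambda>A. \<lambda>x\<in>A. x)\<rparr>"

definition K_fun :: "('a set, 'a \<Rightarrow> 'a, 'a emet, 'a \<Rightarrow> 'a) efun" where
  "K_fun = \<lparr>fobj = discrete, farr = (\<lambda>A B f. f)\<rparr>"

definition strongly_finitary ::
  "'u emet set \<Rightarrow> ('u emet, 'u \<Rightarrow> 'u, 'u emet, 'u \<Rightarrow> 'u) efun \<Rightarrow> bool" where
  "strongly_finitary V F \<longleftrightarrow>
     (\<forall>G. enriched_functor (met_cat V) (met_cat V) G \<longrightarrow>
       (\<forall>\<sigma>\<in>pts (nat_space fin_cat (comp_fun F K_fun) (comp_fun G K_fun)).
          \<exists>!\<sigma>'. \<sigma>' \<in> pts (nat_space (met_cat V) F G) \<and>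
                (\<forall>A\<in>Obj fin_cat. \<sigma>' (fobj K_fun A) = \<sigma> A)))"


section \<open>Weighted colimits\<close>

text \<open>The contravariant functor \<open>V(D-,X)\<close>.\<close>

definition hom_into ::
  "('o, 'm, 'a emet, 'a \<Rightarrow> 'a) efun \<Rightarrow> 'a emet
     \<Rightarrow> ('o, 'm, ('a \<Rightarrow> 'a) emet, ('a \<Rightarrow> 'a) \<Rightarrow> 'a \<Rightarrow> 'a) efun" where
  "hom_into D X = \<lparr>fobj = (\<lambda>d. hom_space (fobj D d) X),
     farr = (\<lambda>d e f. \<lambda>h\<in>pts (hom_space (fobj D d) X). compose (pts (fobj D e)) h (farr D e d f))\<rparr>"

text \<open>
  \<open>wcolimit V C D W c \<psi>\<close>: the object \<open>c\<close> of \<open>V\<close> together with the isomorphisms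
  \<open>\<psi> X : V(c,X) \<rightarrow> [C\<^sup>o\<^sup>p,V](W, V(D-,X))\<close>, natural in \<open>X\<close>, is a colimit of \<open>D\<close> weighted by \<open>W\<close>.
  The type \<open>'w\<close> of points of the weight is independent of that of the spaces in \<open>V\<close>.
\<close>

definition wcolimit ::
  "'u emet set \<Rightarrow> ('o, 'm) ecat \<Rightarrow> ('o, 'm, 'u emet, 'u \<Rightarrow> 'u) efun
     \<Rightarrow> ('o, 'm, 'w emet, 'w \<Rightarrow> 'w) efun \<Rightarrow> 'u emet
     \<Rightarrow> ('u emet \<Rightarrow> ('u \<Rightarrow> 'u) \<Rightarrow> 'o \<Rightarrow> 'w \<Rightarrow> 'u \<Rightarrow> 'u) \<Rightarrow> bool" where
  "wcolimit V C D W c \<psi> \<longleftrightarrow>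
     c \<in> V \<and>
     (\<forall>X\<in>V. met_iso (hom_space c X) (nat_space (op_cat C) W (hom_into D X)) (\<psi> X)) \<and>
     (\<forall>X\<in>V. \<forall>Y\<in>V. \<forall>h\<in>pts (hom_space X Y). \<forall>f\<in>pts (hom_space c X).
        \<psi> Y (compose (pts c) h f)
          = (\<lambda>d\<in>Obj C. \<lambda>w\<in>pts (fobj W d). compose (pts (fobj D d)) h (\<psi> X f d w)))"

definition wcolimit_unit ::
  "'u emet \<Rightarrow> ('u emet \<Rightarrow> ('u \<Rightarrow> 'u) \<Rightarrow> 'o \<Rightarrow> 'w \<Rightarrow> 'u \<Rightarrow> 'u) \<Rightarrow> 'o \<Rightarrow> 'w \<Rightarrow> 'u \<Rightarrow> 'u" where
  "wcolimit_unit c \<psi> = \<psi> c (\<lambda>x\<in>pts c. x)"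

definition preserves_wcolimit ::
  "'u emet set \<Rightarrow> ('u emet, 'u \<Rightarrow> 'u, 'u emet, 'u \<Rightarrow> 'u) efun \<Rightarrow> ('o, 'm) ecat
     \<Rightarrow> ('o, 'm, 'u emet, 'u \<Rightarrow> 'u) efun \<Rightarrow> ('o, 'm, 'w emet, 'w \<Rightarrow> 'w) efun \<Rightarrow> 'u emet
     \<Rightarrow> ('u emet \<Rightarrow> ('u \<Rightarrow> 'u) \<Rightarrow> 'o \<Rightarrow> 'w \<Rightarrow> 'u \<Rightarrow> 'u) \<Rightarrow> bool" where
  "preserves_wcolimit V F C D W c \<psi> \<longleftrightarrow>
     (\<exists>\<psi>'. wcolimit V C (comp_fun F D) W (fobj F c) \<psi>' \<and>
        wcolimit_unit (fobj F c) \<psi>'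
          = (\<lambda>d\<in>Obj C. \<lambda>w\<in>pts (fobj W d). farr F (fobj D d) c (wcolimit_unit c \<psi> d w)))"


section \<open>Directed colimits\<close>

definition directed_poset :: "'i set \<Rightarrow> 'i rel \<Rightarrow> bool" where
  "directed_poset P r \<longleftrightarrow>
     partial_order_on P r \<and> P \<noteq> {} \<and> (\<forall>x\<in>P. \<forall>y\<in>P. \<exists>z\<in>P. (x, z) \<in> r \<and> (y, z) \<in> r)"

definition poset_cat :: "'i set \<Rightarrow> 'i rel \<Rightarrow> ('i, unit) ecat" where
  "poset_cat P r = \<lparr>Obj = P, Hom = (\<lambda>x y. discrete {u. (x, y) \<in> r}),
     Comp = (\<lambda>x y z g f. ()), Ident = (\<lambda>x. ())\<rparr>"

text \<open>The weight of conical colimits: constantly the one-point space.\<close>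

definition conical_weight :: "('o, 'm, unit emet, unit \<Rightarrow> unit) efun" where
  "conical_weight = \<lparr>fobj = (\<lambda>d. discrete UNIV), farr = (\<lambda>d e f u. u)\<rparr>"

text \<open>
  Every small poset is isomorphic to one whose underlying set is a member of \<open>U\<close>.
\<close>

definition preserves_directed_colimits ::
  "'u set set \<Rightarrow> 'u emet set \<Rightarrow> ('u emet, 'u \<Rightarrow> 'u, 'u emet, 'u \<Rightarrow> 'u) efun \<Rightarrow> bool" where
  "preserves_directed_colimits U V F \<longleftrightarrow>
     (\<forall>P r D c \<psi>. P \<in> U \<longrightarrow> directed_poset P r \<longrightarrow>
        enriched_functor (poset_cat P r) (met_cat V) D \<longrightarrow>
        wcolimit V (poset_cat P r) D conical_weight c \<psi> \<longrightarrow>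
        preserves_wcolimit V F (poset_cat P r) D conical_weight c \<psi>)"


section \<open>Precongruences\<close>

datatype pc_obj = Base | Level rat
datatype pc_arr = Idle | Lam | Rho
datatype pc_pt = Zero | Lft | Rgt

definition pc_cat :: "(pc_obj, pc_arr) ecat" where
  "pc_cat = \<lparr>Obj = insert Base (Level ` {\<epsilon>. 0 < \<epsilon>}),
     Hom = (\<lambda>x y. discrete (if x = y then {Idle} else if y = Base then {Lam, Rho} else {})),
     Comp = (\<lambda>x y z g f. if f = Idle then g else f), Ident = (\<lambda>x. Idle)\<rparr>"

fun pc_weight_obj :: "pc_obj \<Rightarrow> pc_pt emet" where
  "pc_weight_obj Base = discrete {Zero}"
| "pc_weight_obj (Level \<epsilon>) =
     \<lparr>pts = {Lft, Rgt}, ed = (\<lambda>x y. if x = y then 0 else ennreal (real_of_rat \<epsilon>))\<rparr>"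

text \<open>The weight is contravariant: an arrow \<open>x \<rightarrow> y\<close> acts as a map from the value at \<open>y\<close>.\<close>

definition pc_weight :: "(pc_obj, pc_arr, pc_pt emet, pc_pt \<Rightarrow> pc_pt) efun" where
  "pc_weight = \<lparr>fobj = pc_weight_obj,
     farr = (\<lambda>y x m. \<lambda>w\<in>pts (pc_weight_obj y).
       (case m of Idle \<Rightarrow> w | Lam \<Rightarrow> Lft | Rho \<Rightarrow> Rgt))\<rparr>"

text \<open>Pairs of points are coded by \<open>pr\<close>, so that the diagram lives over the same type as \<open>M\<close>.\<close>

fun precongruence_obj :: "('u \<times> 'u \<Rightarrow> 'u) \<Rightarrow> 'u emet \<Rightarrow> pc_obj \<Rightarrow> 'u emet" where
  "precongruence_obj pr M Base = discrete (pts M)"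
| "precongruence_obj pr M (Level \<epsilon>) =
     discrete (pr ` {(x, y). x \<in> pts M \<and> y \<in> pts M \<and> ed M x y \<le> ennreal (real_of_rat \<epsilon>)})"

definition precongruence ::
  "('u \<times> 'u \<Rightarrow> 'u) \<Rightarrow> 'u emet \<Rightarrow> (pc_obj, pc_arr, 'u emet, 'u \<Rightarrow> 'u) efun" where
  "precongruence pr M = \<lparr>fobj = precongruence_obj pr M,
     farr = (\<lambda>x y m. \<lambda>z\<in>pts (precongruence_obj pr M x).
       (case m of Idle \<Rightarrow> z | Lam \<Rightarrow> fst (inv pr z) | Rho \<Rightarrow> snd (inv pr z)))\<rparr>"

definition preserves_precongruence_colimits ::
  "('u \<times> 'u \<Rightarrow> 'u) \<Rightarrow> 'u emet set \<Rightarrow> ('u emet, 'u \<Rightarrow> 'u, 'u emet, 'u \<Rightarrow> 'u) efun \<Rightarrow> bool" where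
  "preserves_precongruence_colimits pr V F \<longleftrightarrow>
     (\<forall>M\<in>V. \<forall>c \<psi>. wcolimit V pc_cat (precongruence pr M) pc_weight c \<psi> \<longrightarrow>
        preserves_wcolimit V F pc_cat (precongruence pr M) pc_weight c \<psi>)"


section \<open>Basic facts\<close>

lemma ed_nonexp: "nonexpanding X Y f \<Longrightarrow> x \<in> pts X \<Longrightarrow> x' \<in> pts X \<Longrightarrow> ed Y (f x) (f x') \<le> ed X x x'"
  by (auto simp: nonexpanding_def)

lemma ext_metric_discrete: "ext_metric (discrete A)"
  by (auto simp: ext_metric_def discrete_def)

lemma complete_discrete: "complete_emet (discrete A)"
  unfolding complete_emet_def
proof (intro allI impI)
  fix s :: "nat \<Rightarrow> 'a"
  assume a: "(\<forall>n. s n \<in> pts (discrete A)) \<and>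
          (\<forall>e>0. \<exists>N. \<forall>m\<ge>N. \<forall>n\<ge>N. ed (discrete A) (s m) (s n) < e)"
  then obtain N where N: "\<forall>m\<ge>N. \<forall>n\<ge>N. ed (discrete A) (s m) (s n) < 1"
    using zero_less_one by blast
  have "ed (discrete A) (s n) (s N) = 0" if "n \<ge> N" for n
    using N that by (fastforce simp: discrete_def split: if_splits)
  then have "\<forall>e>0. \<exists>N'. \<forall>n\<ge>N'. ed (discrete A) (s n) (s N) < e"
    by metis
  then show "\<exists>x\<in>pts (discrete A). \<forall>e>0. \<exists>N. \<forall>n\<ge>N. ed (discrete A) (s n) x < e"
    using a by blast
qed

lemma ext_metric_hom_space:
  assumes "ext_metric X" "ext_metric Y"
  shows "ext_metric (hom_space X Y)"
  unfolding ext_metric_def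
proof (intro conjI ballI)
  fix f g assume fg: "f \<in> pts (hom_space X Y)" "g \<in> pts (hom_space X Y)"
  have m: "f x \<in> pts Y" "g x \<in> pts Y" if "x \<in> pts X" for x
    using fg that by (auto simp: hom_space_def)
  have "ed (hom_space X Y) f g = 0 \<longleftrightarrow> (\<forall>x\<in>pts X. ed Y (f x) (g x) = 0)"
    by (simp add: hom_space_def flip: bot_ennreal)
  also have "\<dots> \<longleftrightarrow> (\<forall>x\<in>pts X. f x = g x)"
    using assms(2) m by (auto simp: ext_metric_def)
  also have "\<dots> \<longleftrightarrow> f = g"
    using fg by (auto simp: hom_space_def intro: PiE_ext)
  finally show "ed (hom_space X Y) f g = 0 \<longleftrightarrow> f = g" .
  show "ed (hom_space X Y) f g = ed (hom_space X Y) g f"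
    using assms(2) m by (auto simp: hom_space_def ext_metric_def intro!: SUP_cong)
  fix h assume h: "h \<in> pts (hom_space X Y)"
  show "ed (hom_space X Y) f h \<le> ed (hom_space X Y) f g + ed (hom_space X Y) g h"
  proof -
    have "ed Y (f x) (h x) \<le> (SUP x\<in>pts X. ed Y (f x) (g x)) + (SUP x\<in>pts X. ed Y (g x) (h x))"
      if x: "x \<in> pts X" for x
    proof -
      have "h x \<in> pts Y" using h x by (auto simp: hom_space_def)
      then have "ed Y (f x) (h x) \<le> ed Y (f x) (g x) + ed Y (g x) (h x)"
        using assms(2) m[OF x] by (auto simp: ext_metric_def)
      also have "\<dots> \<le> (SUP x\<in>pts X. ed Y (f x) (g x)) + (SUP x\<in>pts X. ed Y (g x) (h x))"
        using x by (intro add_mono SUP_upper)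
      finally show ?thesis .
    qed
    then show ?thesis by (auto simp: hom_space_def intro!: SUP_least)
  qed
qed

lemma hom_space_compose:
  assumes "f \<in> pts (hom_space X Y)" "g \<in> pts (hom_space Y Z)"
  shows "compose (pts X) g f \<in> pts (hom_space X Z)"
proof -
  have f: "f x \<in> pts Y" if "x \<in> pts X" for x using assms that by (auto simp: hom_space_def)
  have g: "g x \<in> pts Z" if "x \<in> pts Y" for x using assms that by (auto simp: hom_space_def)
  have "ed Z (g (f x)) (g (f x')) \<le> ed X x x'" if "x \<in> pts X" "x' \<in> pts X" for x x'
  proof -
    have "ed Z (g (f x)) (g (f x')) \<le> ed Y (f x) (f x')"
      using assms(2) f that by (auto simp: hom_space_def nonexpanding_def)
    also have "\<dots> \<le> ed X x x'"
      using assms(1) that by (auto simp: hom_space_def nonexpanding_def)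
    finally show ?thesis .
  qed
  then show ?thesis
    using f g by (auto simp: hom_space_def nonexpanding_def compose_def)
qed

lemma enriched_category_met_cat:
  assumes "\<And>X. X \<in> V \<Longrightarrow> ext_metric X"
  shows "enriched_category (met_cat V)"
  unfolding enriched_category_def
proof (intro conjI ballI)
  fix X Y Z f f' g g'
  assume "X \<in> Obj (met_cat V)" "Y \<in> Obj (met_cat V)" "Z \<in> Obj (met_cat V)"
  then have o: "X \<in> V" "Y \<in> V" "Z \<in> V" by (auto simp: met_cat_def)
  assume "f \<in> pts (Hom (met_cat V) X Y)" "f' \<in> pts (Hom (met_cat V) X Y)"
    "g \<in> pts (Hom (met_cat V) Y Z)" "g' \<in> pts (Hom (met_cat V) Y Z)"
  then have h: "f \<in> pts (hom_space X Y)" "f' \<in> pts (hom_space X Y)"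
    "g \<in> pts (hom_space Y Z)" "g' \<in> pts (hom_space Y Z)" by (auto simp: met_cat_def)
  have "ed Z (g (f x)) (g' (f' x)) \<le> (SUP x\<in>pts Y. ed Z (g x) (g' x)) + (SUP x\<in>pts X. ed Y (f x) (f' x))"
    if x: "x \<in> pts X" for x
  proof -
    have p: "f x \<in> pts Y" "f' x \<in> pts Y" using h x by (auto simp: hom_space_def)
    then have q: "g (f x) \<in> pts Z" "g (f' x) \<in> pts Z" "g' (f' x) \<in> pts Z"
      using h by (auto simp: hom_space_def)
    then have "ed Z (g (f x)) (g' (f' x)) \<le> ed Z (g (f x)) (g (f' x)) + ed Z (g (f' x)) (g' (f' x))"
      using assms[OF o(3)] unfolding ext_metric_def by blast
    also have "\<dots> \<le> ed Y (f x) (f' x) + ed Z (g (f' x)) (g' (f' x))"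
      using h p by (intro add_mono order.refl) (auto simp: hom_space_def nonexpanding_def)
    also have "\<dots> \<le> (SUP x\<in>pts X. ed Y (f x) (f' x)) + (SUP x\<in>pts Y. ed Z (g x) (g' x))"
      using x p by (intro add_mono SUP_upper) auto
    finally show ?thesis by (simp add: add.commute)
  qed
  then show "ed (Hom (met_cat V) X Z) (Comp (met_cat V) X Y Z g f) (Comp (met_cat V) X Y Z g' f')
     \<le> ed (Hom (met_cat V) Y Z) g g' + ed (Hom (met_cat V) X Y) f f'"
    by (auto simp: met_cat_def hom_space_def compose_def intro!: SUP_least)
next
  fix X Y assume "X \<in> Obj (met_cat V)" "Y \<in> Obj (met_cat V)"
  then show "ext_metric (Hom (met_cat V) X Y)"
    by (simp add: met_cat_def assms ext_metric_hom_space)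
next
  fix X show "Ident (met_cat V) X \<in> pts (Hom (met_cat V) X X)"
    by (simp add: met_cat_def hom_space_def nonexpanding_def)
next
  fix X Y Z f g assume "f \<in> pts (Hom (met_cat V) X Y)" "g \<in> pts (Hom (met_cat V) Y Z)"
  then show "Comp (met_cat V) X Y Z g f \<in> pts (Hom (met_cat V) X Z)"
    by (simp add: met_cat_def hom_space_compose)
next
  fix X Y f assume "f \<in> pts (Hom (met_cat V) X Y)"
  then have f: "f \<in> pts X \<rightarrow>\<^sub>E pts Y" by (simp add: met_cat_def hom_space_def)
  have "compose (pts X) f (\<lambda>x\<in>pts X. x) x = f x" "compose (pts X) (\<lambda>x\<in>pts Y. x) f x = f x" for x
    using f by (cases "x \<in> pts X"; auto simp: compose_def)+
  then show "Comp (met_cat V) X X Y f (Ident (met_cat V) X) = f"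
    "Comp (met_cat V) X Y Y (Ident (met_cat V) Y) f = f"
    by (auto simp: met_cat_def)
next
  fix W X Y Z f g h assume "f \<in> pts (Hom (met_cat V) W X)"
  then have f: "f \<in> pts W \<rightarrow>\<^sub>E pts X" by (simp add: met_cat_def hom_space_def)
  show "Comp (met_cat V) W Y Z h (Comp (met_cat V) W X Y g f)
      = Comp (met_cat V) W X Z (Comp (met_cat V) X Y Z h g) f"
    using f by (auto simp: met_cat_def compose_def fun_eq_iff)
qed

lemma enriched_category_op:
  assumes "enriched_category C"
  shows "enriched_category (op_cat C)"
proof -
  have "ed (Hom C z x) (Comp C z y x f g) (Comp C z y x f' g') \<le> ed (Hom C z y) g g' + ed (Hom C y x) f f'"
    if "x \<in> Obj C" "y \<in> Obj C" "z \<in> Obj C" "f \<in> pts (Hom C y x)" "f' \<in> pts (Hom C y x)"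
      "g \<in> pts (Hom C z y)" "g' \<in> pts (Hom C z y)" for x y z f f' g g'
  proof -
    have "ed (Hom C z x) (Comp C z y x f g) (Comp C z y x f' g') \<le> ed (Hom C y x) f f' + ed (Hom C z y) g g'"
      using assms that unfolding enriched_category_def by blast
    then show ?thesis by (simp add: add.commute)
  qed
  then show ?thesis
    using assms unfolding enriched_category_def op_cat_def by simp
qed

text \<open>A category with discrete hom-spaces is enriched as soon as it is a category.\<close>

lemma enriched_category_discrete:
  assumes "\<And>x y. x \<in> Obj C \<Longrightarrow> y \<in> Obj C \<Longrightarrow> \<exists>A. Hom C x y = discrete A"
    and "\<And>x. x \<in> Obj C \<Longrightarrow> Ident C x \<in> pts (Hom C x x)"
    and comp: "\<And>x y z f g. x \<in> Obj C \<Longrightarrow> y \<in> Obj C \<Longrightarrow> z \<in> Obj C \<Longrightarrow> f \<in> pts (Hom C x y) \<Longrightarrow>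
      g \<in> pts (Hom C y z) \<Longrightarrow> Comp C x y z g f \<in> pts (Hom C x z)"
    and "\<And>x y f. x \<in> Obj C \<Longrightarrow> y \<in> Obj C \<Longrightarrow> f \<in> pts (Hom C x y) \<Longrightarrow>
      Comp C x x y f (Ident C x) = f \<and> Comp C x y y (Ident C y) f = f"
    and "\<And>w x y z f g h. w \<in> Obj C \<Longrightarrow> x \<in> Obj C \<Longrightarrow> y \<in> Obj C \<Longrightarrow> z \<in> Obj C \<Longrightarrow>
      f \<in> pts (Hom C w x) \<Longrightarrow> g \<in> pts (Hom C x y) \<Longrightarrow> h \<in> pts (Hom C y z) \<Longrightarrow>
      Comp C w y z h (Comp C w x y g f) = Comp C w x z (Comp C x y z h g) f"
  shows "enriched_category C"
proof -
  have m: "ext_metric (Hom C x y)" if "x \<in> Obj C" "y \<in> Obj C" for x y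
    using assms(1)[OF that] ext_metric_discrete by metis
  have "ed (Hom C x z) (Comp C x y z g f) (Comp C x y z g' f') \<le> ed (Hom C y z) g g' + ed (Hom C x y) f f'"
    if "x \<in> Obj C" "y \<in> Obj C" "z \<in> Obj C" "f \<in> pts (Hom C x y)" "f' \<in> pts (Hom C x y)"
      "g \<in> pts (Hom C y z)" "g' \<in> pts (Hom C y z)" for x y z f f' g g'
  proof -
    obtain A B where "Hom C x y = discrete A" "Hom C y z = discrete B"
      using assms(1) \<open>x \<in> _\<close> \<open>y \<in> _\<close> \<open>z \<in> _\<close> by meson
    moreover have "ed (Hom C x z) (Comp C x y z g f) (Comp C x y z g f) = 0"
      using m[of x z] comp[of x y z f g] that by (simp add: ext_metric_def)
    ultimately show ?thesis by (auto simp: discrete_def)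
  qed
  then show ?thesis
    unfolding enriched_category_def using m assms(2-5) by simp
qed

lemma enriched_category_fin: "enriched_category fin_cat"
proof (rule enriched_category_discrete)
  fix A B and f :: "'a \<Rightarrow> 'a"
  assume "f \<in> pts (Hom fin_cat A B)"
  then have f: "f \<in> A \<rightarrow>\<^sub>E B" by (simp add: fin_cat_def discrete_def)
  have "compose A f (\<lambda>x\<in>A. x) x = f x" "compose A (\<lambda>x\<in>B. x) f x = f x" for x
    using f by (cases "x \<in> A"; auto simp: compose_def)+
  then show "Comp fin_cat A A B f (Ident fin_cat A) = f \<and> Comp fin_cat A B B (Ident fin_cat B) f = f"
    by (auto simp: fin_cat_def)
next
  fix A B C D and f g h :: "'a \<Rightarrow> 'a"
  assume "f \<in> pts (Hom fin_cat A B)"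
  then have f: "f \<in> A \<rightarrow>\<^sub>E B" by (simp add: fin_cat_def discrete_def)
  show "Comp fin_cat A C D h (Comp fin_cat A B C g f) = Comp fin_cat A B D (Comp fin_cat B C D h g) f"
    using f by (auto simp: fin_cat_def compose_def fun_eq_iff)
qed (auto simp: fin_cat_def discrete_def compose_def)

lemma enriched_category_poset:
  assumes "partial_order_on P r"
  shows "enriched_category (poset_cat P r)"
proof (rule enriched_category_discrete)
  fix x y z f g
  assume "f \<in> pts (Hom (poset_cat P r) x y)" "g \<in> pts (Hom (poset_cat P r) y z)"
  then have "(x, y) \<in> r" "(y, z) \<in> r" by (simp_all add: poset_cat_def discrete_def split: if_splits)
  moreover have "trans r" using assms by (simp add: order_on_defs)
  ultimately have "(x, z) \<in> r" by (meson transD)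
  then show "Comp (poset_cat P r) x y z g f \<in> pts (Hom (poset_cat P r) x z)"
    by (simp add: poset_cat_def discrete_def)
next
  fix x assume "x \<in> Obj (poset_cat P r)"
  then have "(x, x) \<in> r" using assms by (simp add: poset_cat_def order_on_defs refl_on_def)
  then show "Ident (poset_cat P r) x \<in> pts (Hom (poset_cat P r) x x)"
    by (simp add: poset_cat_def discrete_def)
qed (auto simp: poset_cat_def)

lemma enriched_category_pc: "enriched_category pc_cat"
  by (rule enriched_category_discrete) (auto simp: pc_cat_def discrete_def split: if_splits)

lemma SUP_zero: "(SUP x\<in>A. 0) = (0::ennreal)"
  by (simp flip: bot_ennreal)

lemma ext_metric_pc_weight: "d \<in> Obj pc_cat \<Longrightarrow> ext_metric (pc_weight_obj d) \<and> complete_emet (pc_weight_obj d)"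
proof -
  assume "d \<in> Obj pc_cat"
  then consider "d = Base" | e where "d = Level e" "e > 0" by (auto simp: pc_cat_def)
  then show ?thesis
  proof cases
    case 1
    then show ?thesis by (simp add: ext_metric_discrete complete_discrete)
  next
    case 2
    then have e: "0 < ennreal (real_of_rat e)" by simp
    have "complete_emet (pc_weight_obj d)"
      unfolding complete_emet_def
    proof (intro allI impI)
      fix s :: "nat \<Rightarrow> pc_pt"
      assume a: "(\<forall>n. s n \<in> pts (pc_weight_obj d)) \<and>
        (\<forall>e>0. \<exists>N. \<forall>m\<ge>N. \<forall>n\<ge>N. ed (pc_weight_obj d) (s m) (s n) < e)"
      then obtain N where "\<forall>m\<ge>N. \<forall>n\<ge>N. ed (pc_weight_obj d) (s m) (s n) < ennreal (real_of_rat e)"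
        using e by blast
      then have "ed (pc_weight_obj d) (s n) (s N) = 0" if "n \<ge> N" for n
        using 2 that by (fastforce split: if_splits)
      then have "\<forall>e>0. \<exists>N'. \<forall>n\<ge>N'. ed (pc_weight_obj d) (s n) (s N) < e" by metis
      then show "\<exists>x\<in>pts (pc_weight_obj d). \<forall>e>0. \<exists>N. \<forall>n\<ge>N. ed (pc_weight_obj d) (s n) x < e"
        using a by blast
    qed
    moreover have "ext_metric (pc_weight_obj d)" using 2 by (auto simp: ext_metric_def)
    ultimately show ?thesis by simp
  qed
qed

lemma enriched_functor_pc_weight:
  "enriched_functor (op_cat pc_cat) (met_cat {X. ext_metric X \<and> complete_emet X}) pc_weight"
  unfolding enriched_functor_def
  apply (intro conjI enriched_category_op enriched_category_pc enriched_category_met_cat)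
  subgoal by simp
  subgoal using ext_metric_pc_weight by (auto simp: met_cat_def op_cat_def pc_weight_def)
  unfolding pc_cat_def op_cat_def met_cat_def pc_weight_def
  by (auto simp: discrete_def nonexpanding_def hom_space_def compose_def fun_eq_iff SUP_zero split: if_splits)

lemma enriched_functor_precongruence:
  assumes "\<And>X. X \<in> V \<Longrightarrow> ext_metric X" "\<And>d. precongruence_obj pr M d \<in> V" "inj pr"
  shows "enriched_functor pc_cat (met_cat V) (precongruence pr M)"
  unfolding enriched_functor_def
  apply (intro conjI enriched_category_pc enriched_category_met_cat)
  subgoal using assms by simp
  unfolding pc_cat_def met_cat_def precongruence_def
  using assms
  by (auto simp: discrete_def nonexpanding_def hom_space_def compose_def fun_eq_iff SUP_zero
     inj_eq split: if_splits)

text \<open>Every space \<open>M\<close> is the colimit of its precongruence, with the following isomorphisms.\<close>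

definition precongruence_unit ::
  "('u \<times> 'u \<Rightarrow> 'u) \<Rightarrow> 'u emet \<Rightarrow> pc_obj \<Rightarrow> pc_pt \<Rightarrow> 'u \<Rightarrow> 'u" where
  "precongruence_unit pr M = (\<lambda>d w. \<lambda>z\<in>pts (precongruence_obj pr M d).
     (case w of Zero \<Rightarrow> z | Lft \<Rightarrow> fst (inv pr z) | Rgt \<Rightarrow> snd (inv pr z)))"

definition precongruence_psi ::
  "('u \<times> 'u \<Rightarrow> 'u) \<Rightarrow> 'u emet \<Rightarrow> 'u emet \<Rightarrow> ('u \<Rightarrow> 'u) \<Rightarrow> pc_obj \<Rightarrow> pc_pt \<Rightarrow> 'u \<Rightarrow> 'u" where
  "precongruence_psi pr M = (\<lambda>X f. \<lambda>d\<in>Obj pc_cat. \<lambda>w\<in>pts (pc_weight_obj d).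
     compose (pts (precongruence_obj pr M d)) f (precongruence_unit pr M d w))"

lemma le_if_rat_le: "(a::ennreal) \<le> b" if "\<And>e::rat. 0 < e \<Longrightarrow> b \<le> ennreal (real_of_rat e) \<Longrightarrow> a \<le> ennreal (real_of_rat e)"
proof (rule dense_ge)
  fix z assume "b < z"
  show "a \<le> z"
  proof (cases z)
    case top then show ?thesis by simp
  next
    case (real r)
    with \<open>b < z\<close> obtain s where s: "b = ennreal s" "0 \<le> s" by (cases b) auto
    then have "s < r" using \<open>b < z\<close> real by (auto simp: ennreal_less_iff)
    then obtain q where q: "s < real_of_rat q" "real_of_rat q < r" using of_rat_dense by blast
    then have "0 < q" using s by (metis le_less_trans zero_less_of_rat_iff)
    then have "a \<le> ennreal (real_of_rat q)" using that s q by (auto intro: ennreal_leI)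
    also have "\<dots> \<le> z" using q real by (auto intro: ennreal_leI)
    finally show ?thesis .
  qed
qed

lemma wcolimit_precongruence:
  assumes V: "M \<in> V" "\<And>X. X \<in> V \<Longrightarrow> ext_metric X" and pr: "inj pr"
  shows "wcolimit V pc_cat (precongruence pr M) pc_weight M (precongruence_psi pr M)"
  unfolding wcolimit_def
proof (intro conjI ballI)
  show "M \<in> V" by fact
next
  fix X Y h f assume "X \<in> V" "Y \<in> V" "h \<in> pts (hom_space X Y)" "f \<in> pts (hom_space M X)"
  then show "precongruence_psi pr M Y (compose (pts M) h f)
          = (\<lambda>d\<in>Obj pc_cat. \<lambda>w\<in>pts (fobj pc_weight d). compose (pts (fobj (precongruence pr M) d)) h (precongruence_psi pr M X f d w))"
    using pr by (auto simp: precongruence_psi_def precongruence_unit_def pc_cat_def pc_weight_def precongruence_def compose_def fun_eq_iff discrete_def)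
next
  fix X assume X: "X \<in> V"
  let ?N = "nat_space (op_cat pc_cat) pc_weight (hom_into (precongruence pr M) X)"
  let ?g = "\<lambda>\<tau>. \<tau> Base Zero :: 'a \<Rightarrow> 'a"
  have p: "precongruence_psi pr M X f \<in> pts ?N" if "f \<in> pts (hom_space M X)" for f
  proof -
    have fE: "f \<in> pts M \<rightarrow>\<^sub>E pts X" and fn: "\<And>x y. x \<in> pts M \<Longrightarrow> y \<in> pts M \<Longrightarrow> ed X (f x) (f y) \<le> ed M x y"
      using that by (auto simp: hom_space_def nonexpanding_def)
    have z: "ed X a a = 0" if "a \<in> pts X" for a using V(2)[OF X] that by (auto simp: ext_metric_def)
    have sy: "ed X a b = ed X b a" if "a \<in> pts X" "b \<in> pts X" for a b using V(2)[OF X] that by (auto simp: ext_metric_def)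
    have nuM: "precongruence_unit pr M d w y \<in> pts M"
      if "d \<in> Obj pc_cat" "w \<in> pts (pc_weight_obj d)" "y \<in> pts (precongruence_obj pr M d)" for d w y
      using that pr by (auto simp: precongruence_unit_def pc_cat_def discrete_def)
    have 1: "compose (pts (precongruence_obj pr M d)) f (precongruence_unit pr M d w) \<in> pts (hom_space (precongruence_obj pr M d) X)"
      if "d \<in> Obj pc_cat" "w \<in> pts (pc_weight_obj d)" for d w
    proof -
      have "f (precongruence_unit pr M d w y) \<in> pts X" if "y \<in> pts (precongruence_obj pr M d)" for y
        using fE nuM \<open>d \<in> _\<close> \<open>w \<in> _\<close> that by blast
      moreover obtain A where "precongruence_obj pr M d = discrete A" by (cases d) auto
      ultimately show ?thesis using z
        by (auto simp: hom_space_def nonexpanding_def compose_def discrete_def)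
    qed
    have 2: "ed (hom_space (precongruence_obj pr M d) X) (compose (pts (precongruence_obj pr M d)) f (precongruence_unit pr M d w))
       (compose (pts (precongruence_obj pr M d)) f (precongruence_unit pr M d w')) \<le> ed (pc_weight_obj d) w w'"
      if d: "d \<in> Obj pc_cat" and w: "w \<in> pts (pc_weight_obj d)" "w' \<in> pts (pc_weight_obj d)" for d w w'
    proof -
      have "ed X (f (precongruence_unit pr M d w y)) (f (precongruence_unit pr M d w' y)) \<le> ed (pc_weight_obj d) w w'"
        if y: "y \<in> pts (precongruence_obj pr M d)" for y
      proof (cases "w = w'")
        case True
        then show ?thesis using z fE nuM[OF d w(1) y] by (auto simp: PiE_iff)
      next
        case False
        then obtain e where e: "d = Level e" "0 < e" "{w, w'} = {Lft, Rgt}"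
          using d w by (auto simp: pc_cat_def discrete_def insert_commute)
        obtain a b where ab: "a \<in> pts M" "b \<in> pts M" "y = pr (a, b)" "ed M a b \<le> ennreal (real_of_rat e)"
          using y e by (auto simp: discrete_def)
        have "ed X (f a) (f b) \<le> ennreal (real_of_rat e)" using fn[of a b] ab by (auto intro: order_trans)
        moreover have "ed X (f b) (f a) = ed X (f a) (f b)" using sy fE ab by (auto simp: PiE_iff)
        ultimately show ?thesis using e ab y pr False
          by (auto simp: precongruence_unit_def doubleton_eq_iff simp del: precongruence_obj.simps)
      qed
      then show ?thesis by (auto simp: hom_space_def compose_def intro!: SUP_least)
    qed
    have 3: "precongruence_psi pr M X f \<in> (\<Pi>\<^sub>E d\<in>Obj pc_cat. pts (hom_space (pc_weight_obj d) (hom_space (precongruence_obj pr M d) X)))"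
      using 1 2 by (auto simp: precongruence_psi_def hom_space_def[of "pc_weight_obj _"] nonexpanding_def[of "pc_weight_obj _"])
    have 4: "compose (pts (pc_weight_obj x)) (farr (hom_into (precongruence pr M) X) x y m) (precongruence_psi pr M X f x)
            = compose (pts (pc_weight_obj x)) (precongruence_psi pr M X f y) (farr pc_weight x y m)"
      if "x \<in> Obj pc_cat" "y \<in> Obj pc_cat" "m \<in> pts (Hom pc_cat y x)" for x y m
    proof (rule ext)
      fix w
      show "compose (pts (pc_weight_obj x)) (farr (hom_into (precongruence pr M) X) x y m) (precongruence_psi pr M X f x) w
            = compose (pts (pc_weight_obj x)) (precongruence_psi pr M X f y) (farr pc_weight x y m) w"
      proof (cases "w \<in> pts (pc_weight_obj x)")
        case True
        have "farr (hom_into (precongruence pr M) X) x y m (precongruence_psi pr M X f x w)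
          = compose (pts (precongruence_obj pr M y)) (precongruence_psi pr M X f x w) (farr (precongruence pr M) y x m)"
          using 1[OF that(1) True] True that(1) by (simp add: hom_into_def precongruence_def precongruence_psi_def)
        also have "\<dots> = precongruence_psi pr M X f y (farr pc_weight x y m w)"
          using that True pr
          by (auto simp: precongruence_psi_def precongruence_unit_def pc_cat_def pc_weight_def precongruence_def discrete_def compose_def fun_eq_iff split: if_splits)
        finally show ?thesis using True by (simp add: compose_def)
      qed (simp add: compose_def)
    qed
    from 3 4 show ?thesis
      by (auto simp: nat_space_def op_cat_def pc_weight_def hom_into_def precongruence_def)
  qed
  have q: "ed ?N (precongruence_psi pr M X f) (precongruence_psi pr M X f') \<le> ed (hom_space M X) f f'"
    if "f \<in> pts (hom_space M X)" "f' \<in> pts (hom_space M X)" for f f'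
    using that pr unfolding precongruence_psi_def precongruence_unit_def nat_space_def op_cat_def pc_cat_def pc_weight_def hom_into_def precongruence_def
    by (auto simp: discrete_def hom_space_def compose_def intro!: SUP_least SUP_upper)
  have r: "nonexpanding M X (\<tau> Base Zero) \<and> \<tau> Base Zero \<in> pts M \<rightarrow>\<^sub>E pts X \<and> precongruence_psi pr M X (\<tau> Base Zero) = \<tau>" if t: "\<tau> \<in> pts ?N" for \<tau>
  proof -
    have te: "\<tau> \<in> extensional (Obj pc_cat)"
      using t by (auto simp: nat_space_def op_cat_def PiE_iff)
    have b0: "\<tau> Base \<in> pts (hom_space (pc_weight_obj Base) (hom_space (precongruence_obj pr M Base) X))"
      using t by (auto simp: nat_space_def op_cat_def PiE_iff pc_cat_def pc_weight_def hom_into_def precongruence_def)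
    have b: "\<tau> Base Zero \<in> pts M \<rightarrow>\<^sub>E pts X" and be: "\<tau> Base \<in> extensional {Zero}"
      using b0 by (auto simp: hom_space_def discrete_def PiE_iff)
    have lv: "\<tau> (Level e) Lft = compose (pts (precongruence_obj pr M (Level e))) (\<tau> Base Zero) (precongruence_unit pr M (Level e) Lft)"
      "\<tau> (Level e) Rgt = compose (pts (precongruence_obj pr M (Level e))) (\<tau> Base Zero) (precongruence_unit pr M (Level e) Rgt)"
      "\<tau> (Level e) \<in> extensional {Lft, Rgt}"
      "ed (hom_space (precongruence_obj pr M (Level e)) X) (\<tau> (Level e) Lft) (\<tau> (Level e) Rgt) \<le> ennreal (real_of_rat e)"
      if e: "e > 0" for e
    proof -
      have *: "compose (pts (fobj pc_weight Base)) (farr (hom_into (precongruence pr M) X) Base (Level e) m) (\<tau> Base)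
            = compose (pts (fobj pc_weight Base)) (\<tau> (Level e)) (farr pc_weight Base (Level e) m)" if "m \<in> {Lam, Rho}" for m
        using t e that by (auto simp: nat_space_def op_cat_def pc_cat_def discrete_def)
      have hs: "\<tau> Base Zero \<in> pts (hom_space (discrete (pts M)) X)"
        using b0 by (auto simp: hom_space_def discrete_def PiE_iff)
      show "\<tau> (Level e) Lft = compose (pts (precongruence_obj pr M (Level e))) (\<tau> Base Zero) (precongruence_unit pr M (Level e) Lft)"
      proof -
        have "compose (pts (precongruence_obj pr M (Level e))) (\<tau> Base Zero) (farr (precongruence pr M) (Level e) Base Lam)
           = \<tau> (Level e) Lft"
          using fun_cong[OF *[of Lam], of Zero] hs
          by (simp add: compose_def[of "{Zero}"] pc_weight_def hom_into_def precongruence_def discrete_def)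
        moreover have "compose (pts (precongruence_obj pr M (Level e))) (\<tau> Base Zero) (farr (precongruence pr M) (Level e) Base Lam)
          = compose (pts (precongruence_obj pr M (Level e))) (\<tau> Base Zero) (precongruence_unit pr M (Level e) Lft)"
          by (auto simp: compose_def fun_eq_iff precongruence_unit_def precongruence_def simp del: precongruence_obj.simps)
        ultimately show ?thesis by simp
      qed
      show "\<tau> (Level e) Rgt = compose (pts (precongruence_obj pr M (Level e))) (\<tau> Base Zero) (precongruence_unit pr M (Level e) Rgt)"
      proof -
        have "compose (pts (precongruence_obj pr M (Level e))) (\<tau> Base Zero) (farr (precongruence pr M) (Level e) Base Rho)
           = \<tau> (Level e) Rgt"
          using fun_cong[OF *[of Rho], of Zero] hs
          by (simp add: compose_def[of "{Zero}"] pc_weight_def hom_into_def precongruence_def discrete_def)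
        moreover have "compose (pts (precongruence_obj pr M (Level e))) (\<tau> Base Zero) (farr (precongruence pr M) (Level e) Base Rho)
          = compose (pts (precongruence_obj pr M (Level e))) (\<tau> Base Zero) (precongruence_unit pr M (Level e) Rgt)"
          by (auto simp: compose_def fun_eq_iff precongruence_unit_def precongruence_def simp del: precongruence_obj.simps)
        ultimately show ?thesis by simp
      qed
      have "\<tau> (Level e) \<in> pts (hom_space (pc_weight_obj (Level e)) (hom_space (precongruence_obj pr M (Level e)) X))"
        using t e by (auto simp: nat_space_def op_cat_def PiE_iff pc_cat_def pc_weight_def hom_into_def precongruence_def)
      then have h: "\<tau> (Level e) \<in> pts (pc_weight_obj (Level e)) \<rightarrow>\<^sub>E pts (hom_space (precongruence_obj pr M (Level e)) X)"
        "nonexpanding (pc_weight_obj (Level e)) (hom_space (precongruence_obj pr M (Level e)) X) (\<tau> (Level e))"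
        by (auto simp: hom_space_def)
      show "\<tau> (Level e) \<in> extensional {Lft, Rgt}" using h by (simp add: PiE_iff)
      show "ed (hom_space (precongruence_obj pr M (Level e)) X) (\<tau> (Level e) Lft) (\<tau> (Level e) Rgt) \<le> ennreal (real_of_rat e)"
        using ed_nonexp[OF h(2), of Lft Rgt] by simp
    qed
    have "ed X (\<tau> Base Zero x) (\<tau> Base Zero y) \<le> ed M x y" if xy: "x \<in> pts M" "y \<in> pts M" for x y
    proof (rule le_if_rat_le)
      fix e :: rat assume e: "0 < e" "ed M x y \<le> ennreal (real_of_rat e)"
      let ?Q = "precongruence_obj pr M (Level e)"
      have z: "pr (x, y) \<in> pts ?Q" using xy e by (auto simp: discrete_def)
      have "ed X (\<tau> (Level e) Lft (pr (x, y))) (\<tau> (Level e) Rgt (pr (x, y))) \<le> ennreal (real_of_rat e)"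
        using lv(4)[OF e(1)] z unfolding hom_space_def
        by (metis (no_types, lifting) SUP_upper order_trans emet.select_convs(2))
      then show "ed X (\<tau> Base Zero x) (\<tau> Base Zero y) \<le> ennreal (real_of_rat e)"
        unfolding lv(1,2)[OF e(1)] using z pr by (simp add: compose_def precongruence_unit_def del: precongruence_obj.simps)
    qed
    then have ne: "nonexpanding M X (\<tau> Base Zero)" using b by (auto simp: nonexpanding_def)
    have "precongruence_psi pr M X (\<tau> Base Zero) d w = \<tau> d w" for d w
    proof (cases d)
      case Base
      then show ?thesis using b be
        by (cases w) (auto simp: precongruence_psi_def precongruence_unit_def pc_cat_def compose_def discrete_def fun_eq_iff extensional_def PiE_iff)
    next
      case (Level e)
      show ?thesis
      proof (cases "e > 0")
        case True
        then show ?thesis using Level lv(1,2,3)[OF True]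
          by (cases w) (auto simp: precongruence_psi_def pc_cat_def discrete_def extensional_def)
      next
        case False
        then show ?thesis using Level te by (auto simp: precongruence_psi_def pc_cat_def extensional_def)
      qed
    qed
    with ne b show ?thesis by (auto intro!: ext)
  qed
  have s: "precongruence_psi pr M X f Base Zero = f" if "f \<in> pts (hom_space M X)" for f
    using that by (auto simp: precongruence_psi_def precongruence_unit_def pc_cat_def compose_def discrete_def fun_eq_iff hom_space_def extensional_def PiE_iff)
  have u: "ed (hom_space M X) (\<tau> Base Zero) (\<tau>' Base Zero) \<le> ed ?N \<tau> \<tau>'" for \<tau> \<tau>'
  proof -
    have "ed (hom_space M X) (\<tau> Base Zero) (\<tau>' Base Zero)
       \<le> ed (hom_space (pc_weight_obj Base) (hom_space (precongruence_obj pr M Base) X)) (\<tau> Base) (\<tau>' Base)"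
      by (simp add: hom_space_def discrete_def)
    also have "\<dots> \<le> ed ?N \<tau> \<tau>'"
      unfolding nat_space_def op_cat_def pc_cat_def pc_weight_def hom_into_def precongruence_def emet.simps ecat.simps efun.simps
      by (rule SUP_upper[of Base]) auto
    finally show ?thesis .
  qed
  show "met_iso (hom_space M X) ?N (precongruence_psi pr M X)"
    unfolding met_iso_def
    apply (intro conjI exI[of _ ?g])
    subgoal using p q by (auto simp: nonexpanding_def)
    subgoal using r u by (subst nonexpanding_def) (auto simp: hom_space_def)
    subgoal using s by auto
    subgoal using r by auto
    done
qed

lemma universe_nat_fun:
  "universe (UNIV :: (nat \<Rightarrow> nat) set set)
     (\<lambda>(f, g) n. if even n then f (n div 2) else g (n div 2))"
  unfolding universe_def
proof (intro conjI ballI allI impI)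
  show "\<exists>A\<in>UNIV. infinite (A :: (nat \<Rightarrow> nat) set)"
    by (metis UNIV_I finite_fun_UNIVD1 infinite_UNIV_nat finite_fun_UNIVD2 zero_neq_one)
next
  fix A :: "(nat \<Rightarrow> nat) set"
  have "inj_on (\<lambda>f n. case prod_decode n of (i, j) \<Rightarrow> f i j) (UNIV \<rightarrow>\<^sub>E A)"
  proof (rule inj_onI)
    fix f g :: "nat \<Rightarrow> nat \<Rightarrow> nat"
    assume e: "(\<lambda>n. case prod_decode n of (i, j) \<Rightarrow> f i j) = (\<lambda>n. case prod_decode n of (i, j) \<Rightarrow> g i j)"
    have "f i j = g i j" for i j
      using fun_cong[OF e, of "prod_encode (i, j)"] by simp
    then show "f = g" by blast
  qed
  then have "((UNIV::nat set) \<rightarrow>\<^sub>E A) \<lesssim> (UNIV :: (nat \<Rightarrow> nat) set)"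
    unfolding lepoll_def by blast
  then show "\<exists>B\<in>UNIV. ((UNIV::nat set) \<rightarrow>\<^sub>E A) \<lesssim> (B :: (nat \<Rightarrow> nat) set)"
    by blast
next
  show "inj (\<lambda>(f, g) n. if even n then f (n div 2) else g (n div 2 :: nat) :: nat)"
  proof (rule injI, clarify)
    fix f g f' g' :: "nat \<Rightarrow> nat"
    assume e: "(\<lambda>n. if even n then f (n div 2) else g (n div 2))
      = (\<lambda>n. if even n then f' (n div 2) else g' (n div 2))"
    have "f n = f' n" "g n = g' n" for n
      using fun_cong[OF e, of "2 * n"] fun_cong[OF e, of "2 * n + 1"] by simp_all
    then show "f = f' \<and> g = g'" by blast
  qed
qed simp_all

end

(*
  Preservation implies strong finitarity: a small discrete space is the directed colimit of its
  finite subsets, and every space is the colimit of its precongruence, so a natural transformation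
  given on finite discrete spaces extends uniquely first to discrete and then to all spaces.

  Conversely, a morphism t : FC -> X amounts to a natural transformation from F to the functor
  Y |-> [[Y,C],X], via y |-> (phi |-> t (F phi y)). That functor need not have small values, so it
  is cut down to a small closed part containing the images of the transformations at hand.
  For strongly finitary F this shows that morphisms FC -> X correspond to nonexpanding families
  of morphisms FA -> X, indexed by the maps A -> C from finite discrete A and compatible with
  the maps between finite sets. Such a family extends along a precongruence colimit because maps
  A -> M at distance at most e are the projections of one map from A to the object of level e of the
  precongruence, and along a directed colimit because maps from a finite set to the colimit are
  approximated by maps to the stages, with distances that are also attained approximately there.
*)
theory Submission
  imports Defs
begin

section \<open>Small sets\<close>

text \<open>With \<open>C\<close> and \<open>X\<close> seen as functors on the unit category, the
  double dual Y |-> [[Y,C],X] is the right Kan extension of \<open>X\<close> along \<open>C\<close>;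
  hence transformations from \<open>F\<close> into it are morphisms FC -> X. It cannot be used
  directly: \<open>strongly_finitary\<close> tests \<open>F\<close> only against endofunctors on
  spaces over \<open>'u\<close>, whereas double duals consist of functions of functions. Smallness
  is therefore a property of sets of any type, small subspaces are generated there, and injective
  codes bring them back to \<open>'u\<close>. A second difficulty is that \<open>wcolimit\<close>
  asks for isometries, not just bijections. Unique factorization through spaces of pairs at bounded
  distance recovers the isometry, so all colimits can be handled as universal cocones.
  \<open>Met\<close> and \<open>CMet\<close> share one proof: a flag \<open>b\<close> makes closure
  either trivial or topological. In the complete case a point of a directed colimit is only a limit
  of points from the stages, so values at finite maps into it are themselves limits, and uniqueness
  of limits carries over the required laws.\<close>

definition small :: "'u set set \<Rightarrow> 'b set \<Rightarrow> bool" where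
  "small U S \<longleftrightarrow> (\<exists>A\<in>U. S \<lesssim> A)"

locale small_sets =
  fixes U :: "'u set set" and pr :: "'u \<times> 'u \<Rightarrow> 'u"
  assumes universe: "universe U pr"
begin

lemma inj_pr: "inj pr"
  using universe by (simp add: universe_def)

lemma small_iff_in: "small U (S :: 'u set) \<longleftrightarrow> S \<in> U"
  using universe unfolding universe_def small_def by (meson lepoll_refl)

lemma UN_in: "(\<Union>a\<in>A. f a) \<in> U" if "A \<in> U" "\<And>a. a \<in> A \<Longrightarrow> f a \<in> U"
  using universe that by (simp only: universe_def) blast

lemma small_lepoll: "small U S" if "small U T" "S \<lesssim> T"
  using that unfolding small_def by (meson lepoll_trans)

lemma small_subset: "small U S" if "small U T" "S \<subseteq> T"
  using that by (meson small_lepoll subset_imp_lepoll)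

lemma small_image: "small U (f ` S)" if "small U S"
  using that by (meson small_lepoll image_lepoll)

lemma small_inj_on: "\<exists>e :: 'b \<Rightarrow> 'u. inj_on e S \<and> e ` S \<in> U" if "small U S"
proof -
  from that obtain A e where "A \<in> U" "inj_on e S" "e ` S \<subseteq> A"
    unfolding small_def lepoll_def by blast
  moreover from this have "e ` S \<in> U"
    by (meson small_def small_iff_in subset_imp_lepoll)
  ultimately show ?thesis by blast
qed

lemma small_if_inj_on: "small U S" if "inj_on e S" "small U (e ` S)"
  using that by (meson small_lepoll inj_on_image_lepoll_2 lepoll_def order_refl)

text \<open>The universe axioms speak of sets over \<open>'u\<close> only. Index set and fibres are
  therefore coded by injections \<open>e\<close> and \<open>g a\<close>, and \<open>pr\<close> joins
  the two codes; the coded sum lies in a union of members of \<open>U\<close> indexed by the image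
  of \<open>A\<close> under \<open>e\<close>.\<close>

lemma small_Sigma: "small U (Sigma A f)" if A: "small U A" and f: "\<And>a. a \<in> A \<Longrightarrow> small U (f a)"
proof -
  obtain e :: "'a \<Rightarrow> 'u" where e: "inj_on e A" "e ` A \<in> U"
    using small_inj_on[OF A] by blast
  have "\<forall>a\<in>A. \<exists>g :: 'b \<Rightarrow> 'u. inj_on g (f a) \<and> g ` f a \<in> U"
    using small_inj_on f by blast
  then obtain g :: "'a \<Rightarrow> 'b \<Rightarrow> 'u" where g: "\<And>a. a \<in> A \<Longrightarrow> inj_on (g a) (f a) \<and> g a ` f a \<in> U"
    by metis
  let ?c = "\<lambda>(a, x). pr (e a, g a x)"
  have inj: "inj_on ?c (Sigma A f)"
  proof (rule inj_onI, clarify)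
    fix a x a' x'
    assume m: "a \<in> A" "a' \<in> A" "x \<in> f a" "x' \<in> f a'" and "pr (e a, g a x) = pr (e a', g a' x')"
    then have q: "e a = e a'" "g a x = g a' x'" using injD[OF inj_pr] by blast+
    have "a = a'" using inj_onD[OF e(1) q(1) m(1,2)] .
    moreover from this have "x = x'" using g[OF m(1)] q(2) m by (auto dest: inj_onD)
    ultimately show "a = a' \<and> x = x'" ..
  qed
  let ?h = "\<lambda>p. (\<lambda>x. pr (p, x)) ` g (inv_into A e p) ` f (inv_into A e p)"
  have "?h p \<in> U" if "p \<in> e ` A" for p
    unfolding small_iff_in[symmetric]
    using g[OF inv_into_into[OF that]] by (intro small_image[of "_ ` _"]) (simp only: small_iff_in)
  then have "(\<Union>p\<in>e ` A. ?h p) \<in> U"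
    by (rule UN_in[OF e(2)])
  moreover have "?c ` Sigma A f \<subseteq> (\<Union>p\<in>e ` A. ?h p)"
  proof
    fix z assume "z \<in> ?c ` Sigma A f"
    then obtain a x where ax: "a \<in> A" "x \<in> f a" "z = pr (e a, g a x)" by auto
    then have "z \<in> ?h (e a)" by (simp only: inv_into_f_f[OF e(1)] image_eqI)
    then show "z \<in> (\<Union>p\<in>e ` A. ?h p)" using ax(1) by blast
  qed
  ultimately have "small U (?c ` Sigma A f)"
    by (rule small_subset[OF iffD2[OF small_iff_in]])
  then show ?thesis by (rule small_if_inj_on[OF inj])
qed

lemma small_UN: "small U (\<Union>a\<in>A. f a)" if "small U A" "\<And>a. a \<in> A \<Longrightarrow> small U (f a)"
proof -
  have "small U (snd ` Sigma A f)" using that by (intro small_image small_Sigma)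
  moreover have "snd ` Sigma A f = (\<Union>a\<in>A. f a)" by force
  ultimately show ?thesis by simp
qed

text \<open>The infinite member of \<open>U\<close> receives an injection from the naturals.\<close>

lemma small_countable: "small U S" if "countable S"
proof -
  obtain A where A: "A \<in> U" "infinite A" using universe by (auto simp: universe_def)
  have "S \<lesssim> (UNIV :: nat set)" using that unfolding countable_def lepoll_def by blast
  also have "\<dots> \<lesssim> A" using A(2) by (simp add: infinite_le_lepoll)
  finally show ?thesis using A(1) unfolding small_def by blast
qed

lemma small_Un: "small U (S \<union> T)" if "small U S" "small U T"
proof -
  have "small U (\<Union>b\<in>(UNIV :: bool set). if b then S else T)"
    using that by (intro small_UN) (auto intro: small_countable)
  then show ?thesis by (rule small_subset) auto
qed

text \<open>Closure of \<open>U\<close> under countable powers enters here. It makes closures,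
  families of finite subsets and [0,\<infinity>] small.\<close>

lemma small_sequences: "small U {s :: nat \<Rightarrow> 'b. range s \<subseteq> S}" if S: "small U S"
proof -
  obtain e :: "'b \<Rightarrow> 'u" where e: "inj_on e S" "e ` S \<in> U"
    using small_inj_on[OF S] by blast
  obtain B where "B \<in> U" "((UNIV :: nat set) \<rightarrow>\<^sub>E e ` S) \<lesssim> B"
    using universe e(2) unfolding universe_def by blast
  then have "small U ((UNIV :: nat set) \<rightarrow>\<^sub>E e ` S)" by (auto simp: small_def)
  moreover have "inj_on ((\<circ>) e) {s :: nat \<Rightarrow> 'b. range s \<subseteq> S}"
  proof (rule inj_onI, rule ext)
    fix s t :: "nat \<Rightarrow> 'b" and n
    assume st: "s \<in> {s. range s \<subseteq> S}" "t \<in> {s. range s \<subseteq> S}" "e \<circ> s = e \<circ> t"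
    then have "e (s n) = e (t n)" "s n \<in> S" "t n \<in> S" by (auto dest: fun_cong)
    then show "s n = t n" by (rule inj_onD[OF e(1)])
  qed
  moreover have "(\<circ>) e ` {s :: nat \<Rightarrow> 'b. range s \<subseteq> S} \<subseteq> UNIV \<rightarrow>\<^sub>E e ` S" by auto
  ultimately show ?thesis by (blast intro: small_if_inj_on small_subset)
qed

text \<open>A nonempty finite set is the range of a sequence, so apart from the empty set the finite
  subsets form an image of a set of sequences.\<close>

lemma small_finite_subsets: "small U {B. finite B \<and> B \<subseteq> S}" if S: "small U (S :: 'b set)"
proof -
  have "{B. finite B \<and> B \<subseteq> S} \<subseteq> {{}} \<union> range ` {s :: nat \<Rightarrow> 'b. range s \<subseteq> S}"
  proof
    fix B assume B: "B \<in> {B. finite B \<and> B \<subseteq> S}"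
    show "B \<in> {{}} \<union> range ` {s :: nat \<Rightarrow> 'b. range s \<subseteq> S}"
    proof (cases "B = {}")
      case False
      then have "range (from_nat_into B) = B" using B by (simp add: countable_finite)
      moreover from this have "range (from_nat_into B) \<subseteq> S" using B by simp
      ultimately show ?thesis by blast
    qed simp
  qed
  moreover have "small U ({{}} \<union> range ` {s :: nat \<Rightarrow> 'b. range s \<subseteq> S})"
    by (intro small_Un small_image small_sequences S small_countable) simp
  ultimately show ?thesis by (rule small_subset[rotated])
qed

text \<open>A Dedekind cut: a point is coded by the Boolean sequence that records which enumerated
  rationals lie strictly below it (negative ones become 0). This makes [0,\<infinity>] available as
  a test object for colimits.\<close>

lemma small_ennreal: "small U (UNIV :: ennreal set)"
proof -
  have "inj (\<lambda>x :: ennreal. \<lambda>n. ennreal (real_of_rat (from_nat n)) < x)"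
  proof (rule injI, rule ccontr)
    fix x y :: ennreal
    assume e: "(\<lambda>n. ennreal (real_of_rat (from_nat n)) < x) = (\<lambda>n. ennreal (real_of_rat (from_nat n)) < y)"
    have "ennreal (real_of_rat q) < x \<longleftrightarrow> ennreal (real_of_rat q) < y" for q
      using fun_cong[OF e, of "to_nat q"] by simp
    moreover assume "x \<noteq> y"
    \<comment> \<open>With \<open>u < w < v\<close>, a rational that is at least \<open>u\<close> is
      at least \<open>v\<close> by the contrapositive of \<open>le\<close>, hence above
      \<open>w\<close>; density of the rationals then gives the absurd
      \<open>w \<le> u\<close>.\<close>
    moreover have False if le: "\<forall>q. ennreal (real_of_rat q) < v \<longrightarrow> ennreal (real_of_rat q) < u" and "u < v" for u v :: ennreal
    proof -
      obtain w where w: "u < w" "w < v" using dense[OF \<open>u < v\<close>] by blast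
      have "w \<le> u"
      proof (rule le_if_rat_le)
        fix q :: rat assume q: "0 < q" "u \<le> ennreal (real_of_rat q)"
        then have "\<not> ennreal (real_of_rat q) < v" using le by auto
        then show "w \<le> ennreal (real_of_rat q)" using w by auto
      qed
      then show False using w by auto
    qed
    ultimately show False by (meson linorder_cases)
  qed
  moreover have "small U (range (\<lambda>x :: ennreal. \<lambda>n. ennreal (real_of_rat (from_nat n)) < x))"
    by (rule small_subset[OF small_sequences[of "UNIV :: bool set"]]) (auto intro: small_countable)
  ultimately show ?thesis by (rule small_if_inj_on)
qed

end

section \<open>Spaces of a fixed kind\<close>

lemma ext_metric_refl: "ext_metric X \<Longrightarrow> x \<in> pts X \<Longrightarrow> ed X x x = 0"
  by (simp add: ext_metric_def)

lemma ext_metric_sym: "ext_metric X \<Longrightarrow> x \<in> pts X \<Longrightarrow> y \<in> pts X \<Longrightarrow> ed X x y = ed X y x"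
  by (simp add: ext_metric_def)

lemma ext_metric_tri:
  "ext_metric X \<Longrightarrow> x \<in> pts X \<Longrightarrow> y \<in> pts X \<Longrightarrow> z \<in> pts X \<Longrightarrow> ed X x z \<le> ed X x y + ed X y z"
  by (simp add: ext_metric_def)

lemma ext_metric_eqD: "ext_metric X \<Longrightarrow> x \<in> pts X \<Longrightarrow> y \<in> pts X \<Longrightarrow> ed X x y = 0 \<Longrightarrow> x = y"
  by (simp add: ext_metric_def)

lemma ennreal_half: "\<exists>d>0. d + d \<le> e" if "0 < (e :: ennreal)"
proof (cases e)
  case (real r)
  then have "0 < r" using that by simp
  then show ?thesis using real
    by (intro exI[of _ "ennreal (r / 2)"]) (simp flip: ennreal_plus)
qed (auto intro: exI[of _ top])

lemma ennreal_le_all_pos: "a \<le> c" if "\<And>e. 0 < e \<Longrightarrow> a \<le> c + e" for a c :: ennreal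
  by (rule ennreal_le_epsilon) (simp add: that)

lemma ennreal_eventually_less: "\<exists>N. \<forall>n\<ge>N. ennreal (1 / Suc n) < e" if "0 < e"
proof (cases e)
  case (real r)
  then have "0 < r" using that by simp
  then obtain N where N: "1 / Suc N < r" using nat_approx_posE by blast
  have "1 / Suc n < r" if "n \<ge> N" for n
    using N that by (smt (verit) frac_le of_nat_0_less_iff of_nat_mono zero_less_Suc Suc_le_mono)
  then show ?thesis using real \<open>0 < r\<close> by (auto simp: ennreal_less_iff)
next
  case top
  then show ?thesis by simp
qed

text \<open>Made for points known only through common approximants: closure points coded by the same
  sequence, and values of two morphisms at a limit.\<close>

lemma ext_metric_eqI:
  assumes X: "ext_metric X" "x \<in> pts X" "y \<in> pts X"
    and z: "\<And>e. 0 < e \<Longrightarrow> \<exists>z\<in>pts X. ed X x z \<le> e \<and> ed X y z \<le> e"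
  shows "x = y"
proof -
  have "ed X x y \<le> 0 + e" if e: "0 < e" for e
  proof -
    obtain d where d: "0 < d" "d + d \<le> e" using ennreal_half[OF e] by blast
    obtain z where z: "z \<in> pts X" "ed X x z \<le> d" "ed X y z \<le> d" using z[OF d(1)] by blast
    have "ed X x y \<le> ed X x z + ed X z y" using X z by (blast intro: ext_metric_tri)
    also have "\<dots> \<le> d + d" using z ext_metric_sym[OF X(1,3) z(1)] by (intro add_mono) simp_all
    finally show ?thesis using d by simp
  qed
  then have "ed X x y \<le> 0" by (rule ennreal_le_all_pos)
  then show ?thesis using X ext_metric_eqD by simp
qed

section \<open>Morphisms and the supremum metric\<close>

abbreviation homs :: "'a emet \<Rightarrow> 'b emet \<Rightarrow> ('a \<Rightarrow> 'b) set" where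
  "homs X Y \<equiv> pts (hom_space X Y)"

lemma homI:
  "f \<in> extensional (pts X) \<Longrightarrow> (\<And>x. x \<in> pts X \<Longrightarrow> f x \<in> pts Y) \<Longrightarrow>
    (\<And>x x'. x \<in> pts X \<Longrightarrow> x' \<in> pts X \<Longrightarrow> ed Y (f x) (f x') \<le> ed X x x') \<Longrightarrow> f \<in> homs X Y"
  by (auto simp: hom_space_def nonexpanding_def PiE_iff)

lemma restrict_homI:
  "(\<And>x. x \<in> pts X \<Longrightarrow> f x \<in> pts Y) \<Longrightarrow>
    (\<And>x x'. x \<in> pts X \<Longrightarrow> x' \<in> pts X \<Longrightarrow> ed Y (f x) (f x') \<le> ed X x x') \<Longrightarrow> restrict f (pts X) \<in> homs X Y"
  by (rule homI) auto

lemma hom_in: "f \<in> homs X Y \<Longrightarrow> x \<in> pts X \<Longrightarrow> f x \<in> pts Y"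
  by (auto simp: hom_space_def)

lemma hom_le: "f \<in> homs X Y \<Longrightarrow> x \<in> pts X \<Longrightarrow> x' \<in> pts X \<Longrightarrow> ed Y (f x) (f x') \<le> ed X x x'"
  by (auto simp: hom_space_def nonexpanding_def)

lemma hom_extensional: "f \<in> homs X Y \<Longrightarrow> f \<in> extensional (pts X)"
  by (auto simp: hom_space_def PiE_iff)

lemma hom_eqI: "f \<in> homs X Y \<Longrightarrow> g \<in> homs X Z \<Longrightarrow> (\<And>x. x \<in> pts X \<Longrightarrow> f x = g x) \<Longrightarrow> f = g"
  by (rule extensionalityI[of f "pts X" g]) (auto dest: hom_extensional)

lemma hom_ed_le_iff: "ed (hom_space X Y) f g \<le> d \<longleftrightarrow> (\<forall>x\<in>pts X. ed Y (f x) (g x) \<le> d)"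
  by (simp add: hom_space_def SUP_le_iff)

lemma hom_ed_ge: "x \<in> pts X \<Longrightarrow> ed Y (f x) (g x) \<le> ed (hom_space X Y) f g"
  unfolding hom_space_def emet.simps by (rule SUP_upper)

lemma ident_in_hom: "(\<lambda>x\<in>pts X. x) \<in> homs X X"
  by (rule restrict_homI) auto

text \<open>Between distinct points nonexpansion is vacuous, their distance being \<infinity>;
  \<open>ext_metric Y\<close> settles the case of equal points.\<close>

lemma homs_discrete: "homs (discrete A) Y = A \<rightarrow>\<^sub>E pts Y" if "ext_metric Y"
  using ext_metric_refl[OF that]
  by (auto simp: hom_space_def nonexpanding_def discrete_def PiE_iff extensional_def)

lemma pts_discrete [simp]: "pts (discrete A) = A"
  by (simp add: discrete_def)

lemma compose_id_left: "f \<in> homs X Y \<Longrightarrow> compose (pts X) (\<lambda>y\<in>pts Y. y) f = f"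
  by (rule extensionalityI[of _ "pts X"]) (auto simp: compose_def dest: hom_in hom_extensional)

lemma compose_id_right: "f \<in> homs X Y \<Longrightarrow> compose (pts X) f (\<lambda>x\<in>pts X. x) = f"
  by (rule extensionalityI[of _ "pts X"]) (auto simp: compose_def dest: hom_extensional)

lemma hom_compose_assoc:
  "f \<in> homs X Y \<Longrightarrow> compose (pts X) h (compose (pts X) g f) = compose (pts X) (compose (pts Y) h g) f"
  by (auto simp: compose_def fun_eq_iff dest: hom_in)

lemma compose_app: "x \<in> A \<Longrightarrow> compose A g f x = g (f x)"
  by (simp add: compose_def)

lemma hom_ed_compose_left:
  assumes "f \<in> homs X Y" "f' \<in> homs X Y" "g \<in> homs Y Z"
  shows "ed (hom_space X Z) (compose (pts X) g f) (compose (pts X) g f') \<le> ed (hom_space X Y) f f'"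
  unfolding hom_ed_le_iff
proof
  fix x assume x: "x \<in> pts X"
  have "ed Z (g (f x)) (g (f' x)) \<le> ed Y (f x) (f' x)"
    using assms x by (intro hom_le[of g]) (auto intro: hom_in)
  also have "\<dots> \<le> ed (hom_space X Y) f f'" using x by (rule hom_ed_ge)
  finally show "ed Z (compose (pts X) g f x) (compose (pts X) g f' x) \<le> ed (hom_space X Y) f f'"
    using x by (simp add: compose_app)
qed

lemma hom_ed_compose_right:
  assumes "f \<in> homs X Y"
  shows "ed (hom_space X Z) (compose (pts X) g f) (compose (pts X) g' f) \<le> ed (hom_space Y Z) g g'"
  unfolding hom_ed_le_iff
proof
  fix x assume x: "x \<in> pts X"
  then have "ed Z (g (f x)) (g' (f x)) \<le> ed (hom_space Y Z) g g'"
    using hom_in[OF assms] by (intro hom_ed_ge)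
  then show "ed Z (compose (pts X) g f x) (compose (pts X) g' f x) \<le> ed (hom_space Y Z) g g'"
    using x by (simp add: compose_app)
qed

text \<open>The limit is taken pointwise. The Cauchy bound is uniform in the point, so convergence
  is uniform, and nonexpansion passes to the limit.\<close>

lemma complete_hom_space:
  fixes X :: "'a emet" and Y :: "'b emet"
  assumes Y: "complete_emet Y" "ext_metric Y"
  shows "complete_emet (hom_space X Y)"
  unfolding complete_emet_def
proof (intro allI impI, elim conjE)
  fix s :: "nat \<Rightarrow> 'a \<Rightarrow> 'b"
  let ?d = "ed (hom_space X Y)"
  assume s: "\<forall>n. s n \<in> homs X Y" and C: "\<forall>e>0. \<exists>N. \<forall>m\<ge>N. \<forall>n\<ge>N. ?d (s m) (s n) < e"
  have "\<exists>y\<in>pts Y. \<forall>e>0. \<exists>N. \<forall>n\<ge>N. ed Y (s n x) y < e" if x: "x \<in> pts X" for x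
  proof -
    have "\<forall>e>0. \<exists>N. \<forall>m\<ge>N. \<forall>n\<ge>N. ed Y (s m x) (s n x) < e"
      using C hom_ed_ge[OF x] by (meson le_less_trans)
    moreover have "\<forall>n. s n x \<in> pts Y" using s x by (auto intro: hom_in)
    ultimately show ?thesis using Y(1)[unfolded complete_emet_def, rule_format, of "\<lambda>n. s n x"] by simp
  qed
  then obtain f where f: "\<And>x. x \<in> pts X \<Longrightarrow> f x \<in> pts Y"
    and lim: "\<And>x e. x \<in> pts X \<Longrightarrow> 0 < e \<Longrightarrow> \<exists>N. \<forall>n\<ge>N. ed Y (s n x) (f x) < e" by metis
  \<comment> \<open>The comparison index \<open>max M N\<close> depends on \<open>x\<close>, but the
    resulting bound does not.\<close>
  have unif: "ed Y (s n x) (f x) \<le> e" if x: "x \<in> pts X" and N: "\<forall>m\<ge>N. \<forall>n\<ge>N. ?d (s m) (s n) < e" and "n \<ge> N" for x n N e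
  proof (rule ennreal_le_all_pos)
    fix e' :: ennreal assume "0 < e'"
    then obtain M where M: "\<forall>n\<ge>M. ed Y (s n x) (f x) < e'" using lim[OF x] by blast
    let ?m = "max M N"
    have "ed Y (s n x) (f x) \<le> ed Y (s n x) (s ?m x) + ed Y (s ?m x) (f x)"
      using s x f by (intro ext_metric_tri[OF Y(2)]) (auto intro: hom_in)
    also have "ed Y (s n x) (s ?m x) \<le> ?d (s n) (s ?m)" by (rule hom_ed_ge[OF x])
    also have "\<dots> \<le> e" using N \<open>n \<ge> N\<close> by (simp add: less_imp_le)
    also have "ed Y (s ?m x) (f x) \<le> e'" using M by (simp add: less_imp_le)
    finally show "ed Y (s n x) (f x) \<le> e + e'" by (simp add: add_mono)
  qed
  have "restrict f (pts X) \<in> homs X Y"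
  proof (rule restrict_homI)
    fix x x' assume x: "x \<in> pts X" "x' \<in> pts X"
    show "ed Y (f x) (f x') \<le> ed X x x'"
    proof (rule ennreal_le_all_pos)
      fix e :: ennreal assume "0 < e"
      then obtain d where d: "0 < d" "d + d \<le> e" using ennreal_half by blast
      obtain N where N: "\<forall>m\<ge>N. \<forall>n\<ge>N. ?d (s m) (s n) < d" using C d(1) by blast
      have sY: "s N x \<in> pts Y" "s N x' \<in> pts Y" using s x by (auto intro: hom_in)
      have "ed Y (f x) (f x') \<le> ed Y (f x) (s N x) + ed Y (s N x) (f x')"
        using sY f x by (intro ext_metric_tri[OF Y(2)]) auto
      also have "ed Y (s N x) (f x') \<le> ed Y (s N x) (s N x') + ed Y (s N x') (f x')"
        using sY f x by (intro ext_metric_tri[OF Y(2)]) auto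
      also have "ed Y (s N x) (s N x') \<le> ed X x x'" using s x by (auto intro: hom_le)
      also have "ed Y (s N x') (f x') \<le> d" using unif[OF x(2) N] by simp
      also have "ed Y (f x) (s N x) \<le> d"
        using unif[OF x(1) N, of N] ext_metric_sym[OF Y(2) f[OF x(1)] sY(1)] by simp
      finally have "ed Y (f x) (f x') \<le> ed X x x' + (d + d)"
        by (simp add: ac_simps add_mono)
      also have "\<dots> \<le> ed X x x' + e" using d by (intro add_mono) auto
      finally show "ed Y (f x) (f x') \<le> ed X x x' + e" .
    qed
  qed (use f in auto)
  moreover have "\<exists>N. \<forall>n\<ge>N. ?d (s n) (restrict f (pts X)) < e" if "0 < e" for e
  proof -
    \<comment> \<open>\<open>unif\<close> and the supremum yield only a weak bound, hence a
      \<open>d\<close> strictly below \<open>e\<close>.\<close>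
    obtain d where d: "0 < d" "d < e" using dense[OF \<open>0 < e\<close>] by blast
    obtain N where N: "\<forall>m\<ge>N. \<forall>n\<ge>N. ?d (s m) (s n) < d" using C d(1) by blast
    have "?d (s n) (restrict f (pts X)) \<le> d" if "n \<ge> N" for n
      unfolding hom_ed_le_iff using unif[OF _ N that] by simp
    then show ?thesis using d by (meson le_less_trans)
  qed
  ultimately show "\<exists>x\<in>homs X Y. \<forall>e>0. \<exists>N. \<forall>n\<ge>N. ?d (s n) x < e" by blast
qed

text \<open>
  At the type of \<open>U\<close>, the flag distinguishes \<open>CMet U\<close> from \<open>Met U\<close>; the spaces may live over other
  types as well. The flag of \<open>closure_in\<close> makes it the least subset that is again such a space.
\<close>

definition spaces :: "'u set set \<Rightarrow> bool \<Rightarrow> 'b emet set" where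
  "spaces U b = {X. ext_metric X \<and> small U (pts X) \<and> (b \<longrightarrow> complete_emet X)}"

lemma spacesD:
  "X \<in> spaces U b \<Longrightarrow> ext_metric X" "X \<in> spaces U b \<Longrightarrow> small U (pts X)"
  "X \<in> spaces U b \<Longrightarrow> b \<Longrightarrow> complete_emet X"
  by (auto simp: spaces_def)

definition closure_in :: "bool \<Rightarrow> 'a emet \<Rightarrow> 'a set \<Rightarrow> 'a set" where
  "closure_in b X S = (if b then {p \<in> pts X. \<forall>e>0. \<exists>s\<in>S. ed X p s < e} else S)"

definition subspace :: "'a emet \<Rightarrow> 'a set \<Rightarrow> 'a emet" where
  "subspace X S = \<lparr>pts = S, ed = ed X\<rparr>"

lemma subspace_simps [simp]: "pts (subspace X S) = S" "ed (subspace X S) = ed X"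
  by (simp_all add: subspace_def)

lemma ext_metric_subspace: "ext_metric X \<Longrightarrow> S \<subseteq> pts X \<Longrightarrow> ext_metric (subspace X S)"
  unfolding ext_metric_def subspace_simps by (meson subsetD)

lemma subset_closure_in: "ext_metric X \<Longrightarrow> S \<subseteq> pts X \<Longrightarrow> S \<subseteq> closure_in b X S"
proof
  fix x assume *: "ext_metric X" "S \<subseteq> pts X" "x \<in> S"
  then have "ed X x x = 0" by (auto intro: ext_metric_refl)
  with * show "x \<in> closure_in b X S" by (auto simp: closure_in_def intro!: bexI[of _ x])
qed

lemma closure_in_subset: "S \<subseteq> pts X \<Longrightarrow> closure_in b X S \<subseteq> pts X"
  by (auto simp: closure_in_def)

text \<open>For the flag \<open>False\<close> the approximating point is \<open>p\<close> itself, so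
  arguments by approximation serve both values of the flag.\<close>

lemma closure_in_approx:
  assumes "ext_metric X" "S \<subseteq> pts X" "p \<in> closure_in b X S" "0 < e"
  shows "\<exists>s\<in>S. ed X p s < e"
proof (cases b)
  case False
  then have "p \<in> S" using assms by (simp add: closure_in_def)
  moreover from this have "ed X p p = 0" using assms by (auto intro: ext_metric_refl)
  ultimately show ?thesis using assms(4) by (metis)
qed (use assms in \<open>auto simp: closure_in_def\<close>)

lemma closure_in_hom:
  assumes f: "\<And>s. s \<in> S \<Longrightarrow> f s \<in> T" "\<And>x. x \<in> pts X \<Longrightarrow> f x \<in> pts Y"
    and le: "\<And>x x'. x \<in> pts X \<Longrightarrow> x' \<in> pts X \<Longrightarrow> ed Y (f x) (f x') \<le> ed X x x'"
    and S: "S \<subseteq> pts X" and p: "p \<in> closure_in b X S"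
  shows "f p \<in> closure_in b Y T"
proof (cases b)
  case True
  have "\<exists>t\<in>T. ed Y (f p) t < e" if "0 < e" for e
  proof -
    obtain s where "s \<in> S" "ed X p s < e" "p \<in> pts X"
      using p True \<open>0 < e\<close> by (auto simp: closure_in_def)
    then show ?thesis using f(1) S le[of p s] by (meson le_less_trans subsetD)
  qed
  then show ?thesis using p True f(2) by (auto simp: closure_in_def)
qed (use f(1) p in \<open>simp add: closure_in_def\<close>)

lemma complete_closure_in:
  assumes X: "ext_metric X" "complete_emet X" and S: "S \<subseteq> pts X"
  shows "complete_emet (subspace X (closure_in True X S))"
  unfolding complete_emet_def subspace_simps
proof (intro allI impI, elim conjE)
  fix s :: "nat \<Rightarrow> _" assume s: "\<forall>n. s n \<in> closure_in True X S"
    and C: "\<forall>e>0. \<exists>N. \<forall>m\<ge>N. \<forall>n\<ge>N. ed X (s m) (s n) < e"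
  have sX: "s n \<in> pts X" for n using s closure_in_subset[OF S] by blast
  then obtain x where x: "x \<in> pts X" "\<forall>e>0. \<exists>N. \<forall>n\<ge>N. ed X (s n) x < e"
    using X(2)[unfolded complete_emet_def, rule_format, of s] C by blast
  have "\<exists>t\<in>S. ed X x t < e" if "0 < e" for e
  proof -
    obtain e' where e': "0 < e'" "e' < e" using dense[OF \<open>0 < e\<close>] by blast
    obtain d where d: "0 < d" "d + d \<le> e'" using ennreal_half[OF e'(1)] by blast
    obtain n where n: "ed X (s n) x < d" using x(2) d(1) by blast
    obtain t where t: "t \<in> S" "ed X (s n) t < d"
      using closure_in_approx[OF X(1) S _ d(1)] s by blast
    have "ed X x t \<le> ed X x (s n) + ed X (s n) t"
      using x sX t S by (intro ext_metric_tri[OF X(1)]) auto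
    also have "\<dots> \<le> d + d" using n t ext_metric_sym[OF X(1) x(1) sX[of n]] by (intro add_mono) auto
    finally show ?thesis using d e' t(1) by (meson le_less_trans)
  qed
  then show "\<exists>x\<in>closure_in True X S. \<forall>e>0. \<exists>N. \<forall>n\<ge>N. ed X (s n) x < e"
    using x by (intro bexI[of _ x]) (auto simp: closure_in_def)
qed

text \<open>Existence half of extending a nonexpanding assignment of \<open>h i\<close> to
  \<open>a i\<close> to closure points. The indexed form allows several indices over one point
  \<open>a i\<close>; their values agree by \<open>le\<close>.\<close>

lemma extend_to_closure:
  assumes M: "ext_metric M" and X: "ext_metric X" "b \<Longrightarrow> complete_emet X"
    and a: "\<And>i. i \<in> I \<Longrightarrow> a i \<in> pts M" and h: "\<And>i. i \<in> I \<Longrightarrow> h i \<in> pts X"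
    and le: "\<And>i j. i \<in> I \<Longrightarrow> j \<in> I \<Longrightarrow> ed X (h i) (h j) \<le> ed M (a i) (a j)"
    and p: "p \<in> closure_in b M (a ` I)"
  shows "\<exists>q\<in>pts X. \<forall>e>0. \<exists>i\<in>I. ed M p (a i) < e \<and> ed X q (h i) < e"
proof (cases b)
  case False
  then obtain i where i: "i \<in> I" "p = a i" using p by (auto simp: closure_in_def)
  then have "ed M p (a i) = 0" "ed X (h i) (h i) = 0"
    using a h M X by (auto intro: ext_metric_refl)
  then show ?thesis using i h by metis
next
  case True
  then have pM: "p \<in> pts M" and "\<forall>e>0. \<exists>i\<in>I. ed M p (a i) < e" using p by (auto simp: closure_in_def)
  then have "\<forall>n. \<exists>i\<in>I. ed M p (a i) < ennreal (1 / Suc n)" by simp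
  then obtain i where i: "\<And>n. i n \<in> I" "\<And>n. ed M p (a (i n)) < ennreal (1 / Suc n)" by metis
  have small: "\<exists>N. \<forall>n\<ge>N. ed M p (a (i n)) < e" if "0 < e" for e
    using ennreal_eventually_less[OF that] i(2) by (meson less_trans)
  \<comment> \<open>Two points within \<open>d\<close> of \<open>p\<close> are at distance at most
    \<open>d + d\<close>, and \<open>le\<close> transfers this to the values, which thus form a
    Cauchy sequence.\<close>
  have "\<forall>e>0. \<exists>N. \<forall>m\<ge>N. \<forall>n\<ge>N. ed X (h (i m)) (h (i n)) < e"
  proof (intro allI impI)
    fix e :: ennreal assume "0 < e"
    then obtain e' where e': "0 < e'" "e' < e" using dense by blast
    obtain d where d: "0 < d" "d + d \<le> e'" using ennreal_half[OF e'(1)] by blast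
    obtain N where N: "\<forall>n\<ge>N. ed M p (a (i n)) < d" using small[OF d(1)] by blast
    have "ed X (h (i m)) (h (i n)) < e" if "m \<ge> N" "n \<ge> N" for m n
    proof -
      have "ed X (h (i m)) (h (i n)) \<le> ed M (a (i m)) (a (i n))" using i(1) le by blast
      also have "\<dots> \<le> ed M (a (i m)) p + ed M p (a (i n))"
        using a i(1) pM by (intro ext_metric_tri[OF M]) auto
      also have "\<dots> \<le> d + d"
        using N that ext_metric_sym[OF M pM a[OF i(1)[of m]]] by (intro add_mono) (auto simp: less_imp_le)
      finally show ?thesis using d e' by order
    qed
    then show "\<exists>N. \<forall>m\<ge>N. \<forall>n\<ge>N. ed X (h (i m)) (h (i n)) < e" by blast
  qed
  then obtain q where q: "q \<in> pts X" "\<forall>e>0. \<exists>N. \<forall>n\<ge>N. ed X (h (i n)) q < e"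
    using X(2)[OF True, unfolded complete_emet_def, rule_format, of "\<lambda>n. h (i n)"] h i(1) by blast
  have "\<exists>j\<in>I. ed M p (a j) < e \<and> ed X q (h j) < e" if e: "0 < e" for e
  proof -
    obtain N N' where "\<forall>n\<ge>N. ed M p (a (i n)) < e" "\<forall>n\<ge>N'. ed X (h (i n)) q < e"
      using small[OF e] q(2) e by blast
    then have "ed M p (a (i (max N N'))) < e" "ed X (h (i (max N N'))) q < e" by simp_all
    then show ?thesis using i(1) ext_metric_sym[OF X(1) q(1) h[OF i(1)]] by auto
  qed
  then show ?thesis using q(1) by blast
qed

text \<open>Transport of structure along an injection \<open>c\<close>, used to replace a space over
  another type by one over \<open>'u\<close>.\<close>

definition image_space :: "('a \<Rightarrow> 'b) \<Rightarrow> 'a emet \<Rightarrow> 'b emet" where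
  "image_space c X = \<lparr>pts = c ` pts X, ed = (\<lambda>x y. ed X (inv_into (pts X) c x) (inv_into (pts X) c y))\<rparr>"

lemma pts_image_space [simp]: "pts (image_space c X) = c ` pts X"
  by (simp add: image_space_def)

lemma ed_image_space:
  "inj_on c (pts X) \<Longrightarrow> x \<in> pts X \<Longrightarrow> y \<in> pts X \<Longrightarrow> ed (image_space c X) (c x) (c y) = ed X x y"
  by (simp add: image_space_def inv_into_f_f)

lemma complete_image_space:
  assumes c: "inj_on c (pts X)" and X: "complete_emet X"
  shows "complete_emet (image_space c X)"
  unfolding complete_emet_def
proof (intro allI impI, elim conjE)
  let ?Y = "image_space c X"
  fix s :: "nat \<Rightarrow> _" assume s: "\<forall>n. s n \<in> pts ?Y" and C: "\<forall>e>0. \<exists>N. \<forall>m\<ge>N. \<forall>n\<ge>N. ed ?Y (s m) (s n) < e"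
  have "\<forall>n. \<exists>x\<in>pts X. s n = c x" using s by auto
  then obtain t :: "nat \<Rightarrow> _" where t: "\<And>n. t n \<in> pts X" "\<And>n. s n = c (t n)" by metis
  have "\<forall>e>0. \<exists>N. \<forall>m\<ge>N. \<forall>n\<ge>N. ed X (t m) (t n) < e"
    using C by (simp add: t ed_image_space[OF c])
  then obtain x where x: "x \<in> pts X" "\<forall>e>0. \<exists>N. \<forall>n\<ge>N. ed X (t n) x < e"
    using X[unfolded complete_emet_def, rule_format, of t] t(1) by blast
  then show "\<exists>x\<in>pts ?Y. \<forall>e>0. \<exists>N. \<forall>n\<ge>N. ed ?Y (s n) x < e"
    by (intro bexI[of _ "c x"]) (simp_all add: t ed_image_space[OF c])
qed

lemma ext_metric_image_space:
  assumes c: "inj_on c (pts X)" and X: "ext_metric X"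
  shows "ext_metric (image_space c X)"
  unfolding ext_metric_def pts_image_space ball_simps
  using ext_metric_sym[OF X] ext_metric_tri[OF X] X c
  by (simp add: ed_image_space[OF c] inj_on_eq_iff[OF c]) (simp add: ext_metric_def)

context small_sets
begin

lemma image_space_in_spaces:
  "inj_on c (pts X) \<Longrightarrow> X \<in> spaces U b \<Longrightarrow> image_space c X \<in> spaces U b"
  by (simp add: spaces_def complete_image_space ext_metric_image_space small_image)

text \<open>A closure point is determined by any sequence in \<open>S\<close> converging to it, so
  choosing one such sequence for each point embeds the closure into the small set of sequences in
  \<open>S\<close>.\<close>

lemma small_closure_in:
  assumes X: "ext_metric X" "S \<subseteq> pts X" and S: "small U S"
  shows "small U (closure_in b X S)"
proof -
  have "\<forall>p\<in>closure_in b X S. \<forall>n. \<exists>s\<in>S. ed X p s < ennreal (1 / Suc n)"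
    using closure_in_approx[OF X] by simp
  then obtain s where s: "\<And>p n. p \<in> closure_in b X S \<Longrightarrow> s p n \<in> S \<and> ed X p (s p n) < ennreal (1 / Suc n)"
    by metis
  have "inj_on s (closure_in b X S)"
  proof (rule inj_onI)
    fix p q assume pq: "p \<in> closure_in b X S" "q \<in> closure_in b X S" "s p = s q"
    show "p = q"
    proof (rule ext_metric_eqI[OF X(1)])
      show "p \<in> pts X" "q \<in> pts X" using pq closure_in_subset[OF X(2)] by auto
      fix e :: ennreal assume "0 < e"
      then obtain n where "ennreal (1 / Suc n) < e" using ennreal_eventually_less by blast
      then have "ed X p (s p n) \<le> e" "ed X q (s p n) \<le> e" "s p n \<in> pts X"
        using s[OF pq(1), of n] s[OF pq(2), of n] pq(3) X(2) by auto
      then show "\<exists>z\<in>pts X. ed X p z \<le> e \<and> ed X q z \<le> e" by blast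
    qed
  qed
  moreover have "s ` closure_in b X S \<subseteq> {t. range t \<subseteq> S}" using s by auto
  ultimately show ?thesis using small_sequences[OF S] by (blast intro: small_if_inj_on small_subset)
qed

lemma subspace_closure_in_spaces:
  assumes X: "ext_metric X" "b \<Longrightarrow> complete_emet X" "S \<subseteq> pts X" and S: "small U S"
  shows "subspace X (closure_in b X S) \<in> spaces U b"
  using small_closure_in[OF X(1,3) S] ext_metric_subspace[OF X(1) closure_in_subset[OF X(3)]]
    complete_closure_in[OF X(1) X(2) X(3)]
  by (cases b) (simp_all add: spaces_def)

lemma discrete_in_spaces: "small U A \<Longrightarrow> discrete A \<in> spaces U b"
  by (simp add: spaces_def ext_metric_discrete complete_discrete)

end

section \<open>Weighted colimits by universal property\<close>

lemma nat_space_hom_into_iff: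
  "\<tau> \<in> pts (nat_space (op_cat C) W (hom_into D X)) \<longleftrightarrow>
     \<tau> \<in> extensional (Obj C) \<and>
     (\<forall>d\<in>Obj C. \<tau> d \<in> homs (fobj W d) (hom_space (fobj D d) X)) \<and>
     (\<forall>x\<in>Obj C. \<forall>y\<in>Obj C. \<forall>f\<in>pts (Hom C y x). \<forall>w\<in>pts (fobj W x).
        compose (pts (fobj D y)) (\<tau> x w) (farr D y x f) = \<tau> y (farr W x y f w))"
  (is "_ \<longleftrightarrow> ?R")
proof -
  have "compose (pts (fobj W x)) (\<lambda>h\<in>homs (fobj D x) X. compose (pts (fobj D y)) h (farr D y x f)) (\<tau> x)
        = compose (pts (fobj W x)) (\<tau> y) (farr W x y f) \<longleftrightarrow>
      (\<forall>w\<in>pts (fobj W x). compose (pts (fobj D y)) (\<tau> x w) (farr D y x f) = \<tau> y (farr W x y f w))"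
    if "\<tau> x \<in> homs (fobj W x) (hom_space (fobj D x) X)" for x y f
    using hom_in[OF that] by (auto simp: compose_def fun_eq_iff)
  then show ?thesis
    by (auto simp: nat_space_def op_cat_def hom_into_def PiE_iff)
qed

definition cocones :: "('o, 'm) ecat \<Rightarrow> ('o, 'm, 'a emet, 'a \<Rightarrow> 'a) efun
    \<Rightarrow> ('o, 'm, 'w emet, 'w \<Rightarrow> 'w) efun \<Rightarrow> 'a emet \<Rightarrow> ('o \<Rightarrow> 'w \<Rightarrow> 'a \<Rightarrow> 'a) set" where
  "cocones C D W X = pts (nat_space (op_cat C) W (hom_into D X))"

lemma coconesI:
  assumes "\<tau> \<in> extensional (Obj C)"
    and "\<And>d. d \<in> Obj C \<Longrightarrow> \<tau> d \<in> extensional (pts (fobj W d))"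
    and "\<And>d w. d \<in> Obj C \<Longrightarrow> w \<in> pts (fobj W d) \<Longrightarrow> \<tau> d w \<in> homs (fobj D d) X"
    and "\<And>d w w' z. d \<in> Obj C \<Longrightarrow> w \<in> pts (fobj W d) \<Longrightarrow> w' \<in> pts (fobj W d) \<Longrightarrow> z \<in> pts (fobj D d) \<Longrightarrow>
      ed X (\<tau> d w z) (\<tau> d w' z) \<le> ed (fobj W d) w w'"
    and "\<And>x y f w. x \<in> Obj C \<Longrightarrow> y \<in> Obj C \<Longrightarrow> f \<in> pts (Hom C y x) \<Longrightarrow> w \<in> pts (fobj W x) \<Longrightarrow>
      compose (pts (fobj D y)) (\<tau> x w) (farr D y x f) = \<tau> y (farr W x y f w)"
  shows "\<tau> \<in> cocones C D W X"
  unfolding cocones_def nat_space_hom_into_iff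
proof (intro conjI ballI)
  fix d assume d: "d \<in> Obj C"
  show "\<tau> d \<in> homs (fobj W d) (hom_space (fobj D d) X)"
    by (rule homI) (use assms(2-4)[OF d] in \<open>auto simp: hom_ed_le_iff\<close>)
qed (fact assms(1) assms(5))+

lemma coconesD:
  assumes "\<tau> \<in> cocones C D W X"
  shows "\<tau> \<in> extensional (Obj C)"
    and "d \<in> Obj C \<Longrightarrow> \<tau> d \<in> extensional (pts (fobj W d))"
    and "d \<in> Obj C \<Longrightarrow> w \<in> pts (fobj W d) \<Longrightarrow> \<tau> d w \<in> homs (fobj D d) X"
    and "d \<in> Obj C \<Longrightarrow> w \<in> pts (fobj W d) \<Longrightarrow> w' \<in> pts (fobj W d) \<Longrightarrow> z \<in> pts (fobj D d) \<Longrightarrow>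
      ed X (\<tau> d w z) (\<tau> d w' z) \<le> ed (fobj W d) w w'"
    and "x \<in> Obj C \<Longrightarrow> y \<in> Obj C \<Longrightarrow> f \<in> pts (Hom C y x) \<Longrightarrow> w \<in> pts (fobj W x) \<Longrightarrow>
      compose (pts (fobj D y)) (\<tau> x w) (farr D y x f) = \<tau> y (farr W x y f w)"
proof -
  note * = assms[unfolded cocones_def nat_space_hom_into_iff]
  have h: "\<tau> d \<in> homs (fobj W d) (hom_space (fobj D d) X)" if "d \<in> Obj C" for d using * that by blast
  show "\<tau> \<in> extensional (Obj C)" using * by blast
  show "d \<in> Obj C \<Longrightarrow> \<tau> d \<in> extensional (pts (fobj W d))" by (rule hom_extensional[OF h])
  show "d \<in> Obj C \<Longrightarrow> w \<in> pts (fobj W d) \<Longrightarrow> \<tau> d w \<in> homs (fobj D d) X" by (rule hom_in[OF h])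
  show "ed X (\<tau> d w z) (\<tau> d w' z) \<le> ed (fobj W d) w w'"
    if "d \<in> Obj C" "w \<in> pts (fobj W d)" "w' \<in> pts (fobj W d)" "z \<in> pts (fobj D d)"
    using hom_le[OF h[OF that(1)] that(2,3)] that(4) by (simp only: hom_ed_le_iff)
  show "x \<in> Obj C \<Longrightarrow> y \<in> Obj C \<Longrightarrow> f \<in> pts (Hom C y x) \<Longrightarrow> w \<in> pts (fobj W x) \<Longrightarrow>
      compose (pts (fobj D y)) (\<tau> x w) (farr D y x f) = \<tau> y (farr W x y f w)" using * by blast
qed

lemma cocones_eqI:
  assumes "\<tau> \<in> cocones C D W X" "\<tau>' \<in> cocones C D' W X'"
    and "\<And>d w. d \<in> Obj C \<Longrightarrow> w \<in> pts (fobj W d) \<Longrightarrow> \<tau> d w = \<tau>' d w"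
  shows "\<tau> = \<tau>'"
proof (rule extensionalityI)
  fix d assume d: "d \<in> Obj C"
  show "\<tau> d = \<tau>' d"
    by (rule extensionalityI[OF coconesD(2)[OF assms(1) d] coconesD(2)[OF assms(2) d]]) (rule assms(3)[OF d])
qed (use assms coconesD(1) in blast)+

text \<open>The universal property at the level of sets, in terms of the unit alone. For diagrams in
  \<open>spaces U b\<close> it already implies the isometric isomorphism demanded by
  \<open>wcolimit\<close>, which makes it the working notion of colimit.\<close>

definition colimit_cocone :: "'u emet set \<Rightarrow> ('o, 'm) ecat \<Rightarrow> ('o, 'm, 'u emet, 'u \<Rightarrow> 'u) efun
     \<Rightarrow> ('o, 'm, 'w emet, 'w \<Rightarrow> 'w) efun \<Rightarrow> 'u emet \<Rightarrow> ('o \<Rightarrow> 'w \<Rightarrow> 'u \<Rightarrow> 'u) \<Rightarrow> bool" where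
  "colimit_cocone V C D W c \<nu> \<longleftrightarrow> c \<in> V \<and> \<nu> \<in> cocones C D W c \<and>
     (\<forall>X\<in>V. \<forall>\<tau>\<in>cocones C D W X. \<exists>!f. f \<in> homs c X \<and>
        (\<forall>d\<in>Obj C. \<forall>w\<in>pts (fobj W d). compose (pts (fobj D d)) f (\<nu> d w) = \<tau> d w))"

definition weight :: "('o, 'm) ecat \<Rightarrow> ('o, 'm, 'w emet, 'w \<Rightarrow> 'w) efun \<Rightarrow> bool" where
  "weight C W \<longleftrightarrow> (\<forall>x\<in>Obj C. \<forall>y\<in>Obj C. \<forall>f\<in>pts (Hom C y x). \<forall>w\<in>pts (fobj W x). farr W x y f w \<in> pts (fobj W y))"

lemma functor_obj: "enriched_functor C (met_cat V) D \<Longrightarrow> x \<in> Obj C \<Longrightarrow> fobj D x \<in> V"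
  by (simp add: enriched_functor_def met_cat_def)

lemma functor_hom:
  "enriched_functor C (met_cat V) D \<Longrightarrow> x \<in> Obj C \<Longrightarrow> y \<in> Obj C \<Longrightarrow> f \<in> pts (Hom C x y) \<Longrightarrow>
    farr D x y f \<in> homs (fobj D x) (fobj D y)"
  by (auto simp: enriched_functor_def met_cat_def nonexpanding_def)

lemma functor_comp:
  "enriched_functor C (met_cat V) D \<Longrightarrow> x \<in> Obj C \<Longrightarrow> y \<in> Obj C \<Longrightarrow> z \<in> Obj C \<Longrightarrow>
    f \<in> pts (Hom C x y) \<Longrightarrow> g \<in> pts (Hom C y z) \<Longrightarrow>
    farr D x z (Comp C x y z g f) = compose (pts (fobj D x)) (farr D y z g) (farr D x y f)"
  by (simp add: enriched_functor_def met_cat_def)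

lemma met_functor_obj: "enriched_functor (met_cat V) (met_cat V') F \<Longrightarrow> X \<in> V \<Longrightarrow> fobj F X \<in> V'"
  by (simp add: enriched_functor_def met_cat_def)

lemma met_functor_hom:
  "enriched_functor (met_cat V) (met_cat V') F \<Longrightarrow> X \<in> V \<Longrightarrow> Y \<in> V \<Longrightarrow> f \<in> homs X Y \<Longrightarrow>
    farr F X Y f \<in> homs (fobj F X) (fobj F Y)"
  by (auto simp: enriched_functor_def met_cat_def nonexpanding_def)

lemma met_functor_le:
  "enriched_functor (met_cat V) (met_cat V') F \<Longrightarrow> X \<in> V \<Longrightarrow> Y \<in> V \<Longrightarrow> f \<in> homs X Y \<Longrightarrow> g \<in> homs X Y \<Longrightarrow>
    ed (hom_space (fobj F X) (fobj F Y)) (farr F X Y f) (farr F X Y g) \<le> ed (hom_space X Y) f g"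
  by (auto simp: enriched_functor_def met_cat_def nonexpanding_def)

lemma met_functor_comp:
  "enriched_functor (met_cat V) (met_cat V') F \<Longrightarrow> X \<in> V \<Longrightarrow> Y \<in> V \<Longrightarrow> Z \<in> V \<Longrightarrow>
    f \<in> homs X Y \<Longrightarrow> g \<in> homs Y Z \<Longrightarrow>
    farr F X Z (compose (pts X) g f) = compose (pts (fobj F X)) (farr F Y Z g) (farr F X Y f)"
  by (simp add: enriched_functor_def met_cat_def)

lemma met_functor_id:
  "enriched_functor (met_cat V) (met_cat V') F \<Longrightarrow> X \<in> V \<Longrightarrow> farr F X X (\<lambda>x\<in>pts X. x) = (\<lambda>x\<in>pts (fobj F X). x)"
  by (simp add: enriched_functor_def met_cat_def)

lemma cocones_compose:
  assumes D: "enriched_functor C (met_cat V) D" and W: "weight C W"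
    and \<nu>: "\<nu> \<in> cocones C D W c" and f: "f \<in> homs c X"
  shows "(\<lambda>d\<in>Obj C. \<lambda>w\<in>pts (fobj W d). compose (pts (fobj D d)) f (\<nu> d w)) \<in> cocones C D W X"
    (is "?\<tau> \<in> _")
proof (rule coconesI)
  fix d w w' z assume d: "d \<in> Obj C" "w \<in> pts (fobj W d)" "w' \<in> pts (fobj W d)" "z \<in> pts (fobj D d)"
  have "ed X (f (\<nu> d w z)) (f (\<nu> d w' z)) \<le> ed c (\<nu> d w z) (\<nu> d w' z)"
    using d by (intro hom_le[OF f] hom_in[OF coconesD(3)[OF \<nu>]])
  also have "\<dots> \<le> ed (fobj W d) w w'" using d by (intro coconesD(4)[OF \<nu>])
  finally show "ed X (?\<tau> d w z) (?\<tau> d w' z) \<le> ed (fobj W d) w w'" using d by (simp add: compose_app)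
next
  fix x y a w assume x: "x \<in> Obj C" "y \<in> Obj C" "a \<in> pts (Hom C y x)" "w \<in> pts (fobj W x)"
  have "compose (pts (fobj D y)) (compose (pts (fobj D x)) f (\<nu> x w)) (farr D y x a)
      = compose (pts (fobj D y)) f (compose (pts (fobj D y)) (\<nu> x w) (farr D y x a))"
    using functor_hom[OF D x(2,1,3)] by (rule hom_compose_assoc[symmetric])
  also have "\<dots> = compose (pts (fobj D y)) f (\<nu> y (farr W x y a w))"
    by (simp only: coconesD(5)[OF \<nu> x])
  finally show "compose (pts (fobj D y)) (?\<tau> x w) (farr D y x a) = ?\<tau> y (farr W x y a w)"
    using x W by (simp add: weight_def)
next
  fix d w assume "d \<in> Obj C" "w \<in> pts (fobj W d)"
  then show "?\<tau> d w \<in> homs (fobj D d) X" using hom_space_compose[OF coconesD(3)[OF \<nu>] f] by simp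
qed auto

text \<open>The Yoneda argument: naturality at the identity of \<open>c\<close> shows that
  \<open>\<psi> X f\<close> is the unit followed by \<open>f\<close>, so bijectivity of
  \<open>\<psi> X\<close> is unique factorization through the unit.\<close>

lemma wcolimit_imp_colimit_cocone:
  assumes wc: "wcolimit V C D W c \<psi>"
  shows "colimit_cocone V C D W c (wcolimit_unit c \<psi>)"
proof -
  let ?\<nu> = "wcolimit_unit c \<psi>" and ?i = "\<lambda>x\<in>pts c. x"
  have c: "c \<in> V" and iso: "\<And>X. X \<in> V \<Longrightarrow> met_iso (hom_space c X) (nat_space (op_cat C) W (hom_into D X)) (\<psi> X)"
    and nat: "\<And>X Y h f. X \<in> V \<Longrightarrow> Y \<in> V \<Longrightarrow> h \<in> homs X Y \<Longrightarrow> f \<in> homs c X \<Longrightarrow> \<psi> Y (compose (pts c) h f)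
          = (\<lambda>d\<in>Obj C. \<lambda>w\<in>pts (fobj W d). compose (pts (fobj D d)) h (\<psi> X f d w))"
    using wc by (auto simp: wcolimit_def)
  have \<psi>: "\<psi> X f = (\<lambda>d\<in>Obj C. \<lambda>w\<in>pts (fobj W d). compose (pts (fobj D d)) f (?\<nu> d w))"
    if "X \<in> V" "f \<in> homs c X" for X f
    using nat[OF c that(1) that(2) ident_in_hom] that by (simp add: wcolimit_unit_def compose_id_right)
  have \<psi>_in: "\<psi> X f \<in> cocones C D W X" if "X \<in> V" "f \<in> homs c X" for X f
    using iso[OF that(1)] that(2) by (auto simp: met_iso_def nonexpanding_def cocones_def)
  have "\<exists>!f. f \<in> homs c X \<and> (\<forall>d\<in>Obj C. \<forall>w\<in>pts (fobj W d). compose (pts (fobj D d)) f (?\<nu> d w) = \<tau> d w)"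
    if X: "X \<in> V" and \<tau>: "\<tau> \<in> cocones C D W X" for X \<tau>
  proof -
    from iso[OF X] obtain g where g: "\<And>t. t \<in> cocones C D W X \<Longrightarrow> g t \<in> homs c X"
      "\<And>f. f \<in> homs c X \<Longrightarrow> g (\<psi> X f) = f" "\<And>t. t \<in> cocones C D W X \<Longrightarrow> \<psi> X (g t) = t"
      unfolding met_iso_def cocones_def nonexpanding_def by blast
    have "compose (pts (fobj D d)) (g \<tau>) (?\<nu> d w) = \<tau> d w" if "d \<in> Obj C" "w \<in> pts (fobj W d)" for d w
      using fun_cong[OF fun_cong[OF \<psi>[OF X g(1)[OF \<tau>]], of d], of w] that g(3)[OF \<tau>] by simp
    moreover have "f = g \<tau>" if f: "f \<in> homs c X"
      "\<forall>d\<in>Obj C. \<forall>w\<in>pts (fobj W d). compose (pts (fobj D d)) f (?\<nu> d w) = \<tau> d w" for f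
    proof -
      have "\<psi> X f = \<tau>"
        by (rule cocones_eqI[OF \<psi>_in[OF X f(1)] \<tau>]) (simp add: \<psi>[OF X f(1)] f(2))
      then show ?thesis using g(2)[OF f(1)] by simp
    qed
    ultimately show ?thesis using g(1)[OF \<tau>] by (intro ex1I[of _ "g \<tau>"]) blast+
  qed
  moreover have "?\<nu> \<in> cocones C D W c"
    unfolding wcolimit_unit_def using c ident_in_hom by (rule \<psi>_in)
  ultimately show ?thesis using c by (simp add: colimit_cocone_def)
qed

text \<open>The unit is jointly epic: \<open>f\<close> and \<open>g\<close> both factor the cocone
  obtained by following \<open>\<nu>\<close> with \<open>f\<close>.\<close>

lemma colimit_cocone_unique:
  assumes \<nu>: "colimit_cocone V C D W c \<nu>" and D: "enriched_functor C (met_cat V) D" and W: "weight C W"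
    and X: "X \<in> V" "f \<in> homs c X" "g \<in> homs c X"
    and eq: "\<And>d w z. d \<in> Obj C \<Longrightarrow> w \<in> pts (fobj W d) \<Longrightarrow> z \<in> pts (fobj D d) \<Longrightarrow> f (\<nu> d w z) = g (\<nu> d w z)"
  shows "f = g"
proof -
  have \<nu>': "\<nu> \<in> cocones C D W c" using \<nu> by (simp add: colimit_cocone_def)
  let ?\<tau> = "\<lambda>d\<in>Obj C. \<lambda>w\<in>pts (fobj W d). compose (pts (fobj D d)) f (\<nu> d w)"
  have "\<exists>!h. h \<in> homs c X \<and> (\<forall>d\<in>Obj C. \<forall>w\<in>pts (fobj W d). compose (pts (fobj D d)) h (\<nu> d w) = ?\<tau> d w)"
    using \<nu> X(1) cocones_compose[OF D W \<nu>' X(2)] unfolding colimit_cocone_def by blast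
  moreover have "compose (pts (fobj D d)) g (\<nu> d w) = ?\<tau> d w" if "d \<in> Obj C" "w \<in> pts (fobj W d)" for d w
    using eq[OF that] that by (auto simp: compose_def fun_eq_iff)
  moreover have "compose (pts (fobj D d)) f (\<nu> d w) = ?\<tau> d w" if "d \<in> Obj C" "w \<in> pts (fobj W d)" for d w
    using that by simp
  ultimately show ?thesis using X by blast
qed

text \<open>For positive \<open>\<delta>\<close> this is the cotensor of \<open>X\<close> with two
  points at distance \<open>\<delta>\<close>: a nonexpanding map into it is a pair of morphisms into
  \<open>X\<close> at distance at most \<open>\<delta>\<close>.\<close>

definition close_pairs :: "'a emet \<Rightarrow> ennreal \<Rightarrow> ('a \<times> 'a) emet" where
  "close_pairs X \<delta> = \<lparr>pts = {(x, y). x \<in> pts X \<and> y \<in> pts X \<and> ed X x y \<le> \<delta>},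
     ed = (\<lambda>p q. max (ed X (fst p) (fst q)) (ed X (snd p) (snd q)))\<rparr>"

lemma ext_metric_close_pairs:
  assumes X: "ext_metric X"
  shows "ext_metric (close_pairs X \<delta>)"
  unfolding ext_metric_def
proof (intro conjI ballI)
  fix p q assume p: "p \<in> pts (close_pairs X \<delta>)" and q: "q \<in> pts (close_pairs X \<delta>)"
  then have m: "fst p \<in> pts X" "snd p \<in> pts X" "fst q \<in> pts X" "snd q \<in> pts X"
    by (auto simp: close_pairs_def)
  show "ed (close_pairs X \<delta>) p q = 0 \<longleftrightarrow> p = q"
  proof
    assume "ed (close_pairs X \<delta>) p q = 0"
    then have "max (ed X (fst p) (fst q)) (ed X (snd p) (snd q)) \<le> 0" by (simp add: close_pairs_def)
    then have "ed X (fst p) (fst q) \<le> 0" "ed X (snd p) (snd q) \<le> 0" by (simp_all only: max.bounded_iff)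
    then show "p = q" using m ext_metric_eqD[OF X] by (simp add: prod_eq_iff)
  next
    assume "p = q"
    then show "ed (close_pairs X \<delta>) p q = 0" using m ext_metric_refl[OF X] by (simp add: close_pairs_def)
  qed
  show "ed (close_pairs X \<delta>) p q = ed (close_pairs X \<delta>) q p"
    using m ext_metric_sym[OF X] by (simp add: close_pairs_def)
  fix r assume "r \<in> pts (close_pairs X \<delta>)"
  then have "fst r \<in> pts X" "snd r \<in> pts X" by (auto simp: close_pairs_def)
  then have "ed X (fst p) (fst r) \<le> ed X (fst p) (fst q) + ed X (fst q) (fst r)"
    "ed X (snd p) (snd r) \<le> ed X (snd p) (snd q) + ed X (snd q) (snd r)"
    using m by (blast intro: ext_metric_tri[OF X])+
  then show "ed (close_pairs X \<delta>) p r \<le> ed (close_pairs X \<delta>) p q + ed (close_pairs X \<delta>) q r"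
    unfolding close_pairs_def emet.simps by (intro max.boundedI) (meson add_mono max.cobounded1 max.cobounded2 order_trans)+
qed

lemma complete_close_pairs:
  fixes X :: "'a emet"
  assumes X: "ext_metric X" "complete_emet X"
  shows "complete_emet (close_pairs X \<delta>)"
  unfolding complete_emet_def
proof (intro allI impI, elim conjE)
  let ?P = "close_pairs X \<delta>"
  fix s :: "nat \<Rightarrow> 'a \<times> 'a"
  assume s: "\<forall>n. s n \<in> pts ?P" and C: "\<forall>e>0. \<exists>N. \<forall>m\<ge>N. \<forall>n\<ge>N. ed ?P (s m) (s n) < e"
  have sX: "fst (s n) \<in> pts X" "snd (s n) \<in> pts X" "ed X (fst (s n)) (snd (s n)) \<le> \<delta>" for n
    using s[rule_format, of n] by (auto simp: close_pairs_def)
  have C': "\<forall>e>0. \<exists>N. \<forall>m\<ge>N. \<forall>n\<ge>N. ed X (fst (s m)) (fst (s n)) < e \<and> ed X (snd (s m)) (snd (s n)) < e"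
    using C by (simp add: close_pairs_def)
  have "\<forall>e>0. \<exists>N. \<forall>m\<ge>N. \<forall>n\<ge>N. ed X (fst (s m)) (fst (s n)) < e"
    using C' by fast
  then obtain x where x: "x \<in> pts X" "\<forall>e>0. \<exists>N. \<forall>n\<ge>N. ed X (fst (s n)) x < e"
    using X(2)[unfolded complete_emet_def, THEN spec, of "\<lambda>n. fst (s n)"] sX by blast
  have "\<forall>e>0. \<exists>N. \<forall>m\<ge>N. \<forall>n\<ge>N. ed X (snd (s m)) (snd (s n)) < e"
    using C' by fast
  then obtain y where y: "y \<in> pts X" "\<forall>e>0. \<exists>N. \<forall>n\<ge>N. ed X (snd (s n)) y < e"
    using X(2)[unfolded complete_emet_def, THEN spec, of "\<lambda>n. snd (s n)"] sX by blast
  have lim: "\<exists>N. \<forall>n\<ge>N. ed X (fst (s n)) x < e \<and> ed X (snd (s n)) y < e" if e: "0 < e" for e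
  proof -
    obtain N N' where "\<forall>n\<ge>N. ed X (fst (s n)) x < e" "\<forall>n\<ge>N'. ed X (snd (s n)) y < e"
      using x(2) y(2) e by blast
    then show ?thesis by (intro exI[of _ "max N N'"]) simp
  qed
  \<comment> \<open>The bound on the distance survives limits, so the space of pairs is closed in
    the product.\<close>
  have "ed X x y \<le> \<delta>"
  proof (rule ennreal_le_all_pos)
    fix e :: ennreal assume "0 < e"
    then obtain d where d: "0 < d" "d + d \<le> e" using ennreal_half by blast
    obtain n where n: "ed X (fst (s n)) x < d" "ed X (snd (s n)) y < d" using lim[OF d(1)] by blast
    have "ed X x y \<le> ed X x (fst (s n)) + ed X (fst (s n)) y"
      using sX x y by (intro ext_metric_tri[OF X(1)])
    also have "ed X (fst (s n)) y \<le> ed X (fst (s n)) (snd (s n)) + ed X (snd (s n)) y"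
      using sX x y by (intro ext_metric_tri[OF X(1)])
    also have "ed X (fst (s n)) (snd (s n)) \<le> \<delta>" by (rule sX)
    also have "ed X (snd (s n)) y \<le> d" using n by simp
    also have "ed X x (fst (s n)) \<le> d" using n ext_metric_sym[OF X(1) x(1) sX(1)[of n]] by simp
    finally have "ed X x y \<le> \<delta> + (d + d)" by (simp add: ac_simps add_mono)
    also have "\<dots> \<le> \<delta> + e" using d by (intro add_mono) auto
    finally show "ed X x y \<le> \<delta> + e" .
  qed
  then show "\<exists>x\<in>pts ?P. \<forall>e>0. \<exists>N. \<forall>n\<ge>N. ed ?P (s n) x < e"
    using x(1) y(1) lim by (intro bexI[of _ "(x, y)"]) (auto simp: close_pairs_def)
qed

lemma (in small_sets) close_pairs_in_spaces: "X \<in> spaces U b \<Longrightarrow> close_pairs X \<delta> \<in> spaces U b"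
proof -
  assume X: "X \<in> spaces U b"
  have "small U (pts (close_pairs X \<delta>))"
    by (rule small_subset[OF small_Sigma[of "pts X" "\<lambda>_. pts X"]]) (auto simp: close_pairs_def spacesD[OF X])
  then show ?thesis using X by (simp add: spaces_def ext_metric_close_pairs complete_close_pairs)
qed

lemma colimit_cocone_factor:
  assumes "colimit_cocone V C D W c \<nu>" "X \<in> V" "\<tau> \<in> cocones C D W X"
  shows "\<exists>f\<in>homs c X. \<forall>d\<in>Obj C. \<forall>w\<in>pts (fobj W d). \<forall>z\<in>pts (fobj D d). f (\<nu> d w z) = \<tau> d w z"
proof -
  from assms obtain f where f: "f \<in> homs c X"
    "\<forall>d\<in>Obj C. \<forall>w\<in>pts (fobj W d). compose (pts (fobj D d)) f (\<nu> d w) = \<tau> d w"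
    unfolding colimit_cocone_def by blast
  have "f (\<nu> d w z) = \<tau> d w z" if "d \<in> Obj C" "w \<in> pts (fobj W d)" "z \<in> pts (fobj D d)" for d w z
    using fun_cong[OF f(2)[rule_format, OF that(1,2)], of z] that(3) by (simp add: compose_app)
  then show ?thesis using f(1) by blast
qed

lemma nat_space_ed_le_iff:
  "ed (nat_space (op_cat C) W (hom_into D X)) \<tau> \<tau>' \<le> \<delta> \<longleftrightarrow>
    (\<forall>d\<in>Obj C. \<forall>w\<in>pts (fobj W d). \<forall>z\<in>pts (fobj D d). ed X (\<tau> d w z) (\<tau>' d w z) \<le> \<delta>)"
  by (simp add: nat_space_def op_cat_def hom_into_def SUP_le_iff hom_ed_le_iff)

section \<open>From unique factorization to isometric isomorphisms\<close>

context small_sets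
begin

text \<open>
  The bijection between factorizations and cocones is isometric because a pair of cocones at
  distance \<open>\<delta>\<close> is a cocone to the space of pairs of points at distance at most \<open>\<delta>\<close>.
\<close>

lemma colimit_cocone_isometry:
  fixes D :: "('o, 'm, 'u emet, 'u \<Rightarrow> 'u) efun" and X :: "'u emet"
  assumes \<nu>: "colimit_cocone (spaces U b) C D W c \<nu>"
    and D: "enriched_functor C (met_cat (spaces U b)) D" and W: "weight C W"
    and X: "X \<in> spaces U b" and f: "f \<in> homs c X" and g: "g \<in> homs c X"
    and le: "\<And>d w z. d \<in> Obj C \<Longrightarrow> w \<in> pts (fobj W d) \<Longrightarrow> z \<in> pts (fobj D d) \<Longrightarrow> ed X (f (\<nu> d w z)) (g (\<nu> d w z)) \<le> \<delta>"
  shows "ed (hom_space c X) f g \<le> \<delta>"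
proof -
  have \<nu>': "\<nu> \<in> cocones C D W c" using \<nu> by (simp add: colimit_cocone_def)
  let ?P = "close_pairs X \<delta>"
  \<comment> \<open>The test object must have points of type \<open>'u\<close>, so the pairs are
    recoded by \<open>pr\<close>.\<close>
  let ?Q = "image_space pr ?P"
  have inj: "inj_on pr A" for A using inj_pr by (rule inj_on_subset) simp
  have Q: "?Q \<in> spaces U b" by (intro image_space_in_spaces inj close_pairs_in_spaces X)
  let ?\<tau> = "\<lambda>d\<in>Obj C. \<lambda>w\<in>pts (fobj W d). \<lambda>z\<in>pts (fobj D d). pr (f (\<nu> d w z), g (\<nu> d w z))"
  have mem: "(f (\<nu> d w z), g (\<nu> d w z)) \<in> pts ?P"
    if "d \<in> Obj C" "w \<in> pts (fobj W d)" "z \<in> pts (fobj D d)" for d w z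
    using that le[OF that] hom_in[OF f] hom_in[OF g] hom_in[OF coconesD(3)[OF \<nu>' that(1,2)] that(3)]
    by (simp add: close_pairs_def)
  have fg: "ed ?P (f y, g y) (f y', g y') \<le> ed c y y'" if "y \<in> pts c" "y' \<in> pts c" for y y'
    using that hom_le[OF f] hom_le[OF g] by (simp add: close_pairs_def)
  have \<tau>: "?\<tau> \<in> cocones C D W ?Q"
  proof (rule coconesI)
    fix d w w' z assume d: "d \<in> Obj C" "w \<in> pts (fobj W d)" "w' \<in> pts (fobj W d)" "z \<in> pts (fobj D d)"
    have "ed ?Q (?\<tau> d w z) (?\<tau> d w' z) = ed ?P (f (\<nu> d w z), g (\<nu> d w z)) (f (\<nu> d w' z), g (\<nu> d w' z))"
      using d by (simp add: ed_image_space[OF inj mem[OF d(1,2,4)] mem[OF d(1,3,4)]])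
    also have "\<dots> \<le> ed c (\<nu> d w z) (\<nu> d w' z)"
      using d by (intro fg hom_in[OF coconesD(3)[OF \<nu>']])
    also have "\<dots> \<le> ed (fobj W d) w w'" using d by (intro coconesD(4)[OF \<nu>'])
    finally show "ed ?Q (?\<tau> d w z) (?\<tau> d w' z) \<le> ed (fobj W d) w w'" .
  next
    fix d w assume d: "d \<in> Obj C" "w \<in> pts (fobj W d)"
    have "(\<lambda>z\<in>pts (fobj D d). pr (f (\<nu> d w z), g (\<nu> d w z))) \<in> homs (fobj D d) ?Q"
    proof (rule restrict_homI)
      fix z z' assume z: "z \<in> pts (fobj D d)" "z' \<in> pts (fobj D d)"
      have "ed ?P (f (\<nu> d w z), g (\<nu> d w z)) (f (\<nu> d w z'), g (\<nu> d w z')) \<le> ed c (\<nu> d w z) (\<nu> d w z')"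
        by (intro fg hom_in[OF coconesD(3)[OF \<nu>' d]] z)
      also have "\<dots> \<le> ed (fobj D d) z z'" by (intro hom_le[OF coconesD(3)[OF \<nu>' d]] z)
      finally show "ed ?Q (pr (f (\<nu> d w z), g (\<nu> d w z))) (pr (f (\<nu> d w z'), g (\<nu> d w z'))) \<le> ed (fobj D d) z z'"
        by (simp add: ed_image_space[OF inj mem[OF d z(1)] mem[OF d z(2)]])
    qed (use mem[OF d] in simp)
    then show "?\<tau> d w \<in> homs (fobj D d) ?Q" using d by simp
  next
    fix x y a w assume x: "x \<in> Obj C" "y \<in> Obj C" "a \<in> pts (Hom C y x)" "w \<in> pts (fobj W x)"
    have w': "farr W x y a w \<in> pts (fobj W y)" using W x by (simp add: weight_def)
    have "compose (pts (fobj D y)) (?\<tau> x w) (farr D y x a) z = ?\<tau> y (farr W x y a w) z" for z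
    proof (cases "z \<in> pts (fobj D y)")
      case True
      then have "\<nu> x w (farr D y x a z) = \<nu> y (farr W x y a w) z"
        using fun_cong[OF coconesD(5)[OF \<nu>' x], of z] by (simp add: compose_app)
      moreover have "farr D y x a z \<in> pts (fobj D x)" by (rule hom_in[OF functor_hom[OF D x(2,1,3)] True])
      ultimately show ?thesis using True x w' by (simp add: compose_app)
    qed (use x w' in \<open>simp add: compose_def\<close>)
    then show "compose (pts (fobj D y)) (?\<tau> x w) (farr D y x a) = ?\<tau> y (farr W x y a w)" by (rule ext)
  qed auto
  obtain t where t: "t \<in> homs c ?Q"
    and "\<forall>d\<in>Obj C. \<forall>w\<in>pts (fobj W d). \<forall>z\<in>pts (fobj D d). t (\<nu> d w z) = ?\<tau> d w z"
    using colimit_cocone_factor[OF \<nu> Q \<tau>] by blast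
  then have t\<nu>: "t (\<nu> d w z) = pr (f (\<nu> d w z), g (\<nu> d w z))"
    if "d \<in> Obj C" "w \<in> pts (fobj W d)" "z \<in> pts (fobj D d)" for d w z
    using that by simp
  let ?p = "\<lambda>y. inv pr (t y)"
  have p: "?p y \<in> pts ?P" "t y = pr (?p y)" if y: "y \<in> pts c" for y
    using hom_in[OF t y] inj_pr by auto
  have p_le: "ed ?P (?p y) (?p y') \<le> ed c y y'" if y: "y \<in> pts c" "y' \<in> pts c" for y y'
    using hom_le[OF t y] ed_image_space[OF inj p(1)[OF y(1)] p(1)[OF y(2)]] p(2) y by simp
  \<comment> \<open>On the unit the two coordinates of \<open>t\<close> agree with \<open>f\<close>
    and \<open>g\<close>, so uniqueness identifies them everywhere; membership in \<open>?P\<close>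
    then carries the bound \<open>\<delta>\<close>.\<close>
  have "f = (\<lambda>y\<in>pts c. fst (?p y))"
  proof (rule colimit_cocone_unique[OF \<nu> D W X f])
    show "(\<lambda>y\<in>pts c. fst (?p y)) \<in> homs c X"
      by (rule restrict_homI) (use p(1) p_le in \<open>force simp: close_pairs_def\<close>)+
  qed (use hom_in[OF coconesD(3)[OF \<nu>']] inj_pr in \<open>simp add: t\<nu>\<close>)
  moreover have "g = (\<lambda>y\<in>pts c. snd (?p y))"
  proof (rule colimit_cocone_unique[OF \<nu> D W X g])
    show "(\<lambda>y\<in>pts c. snd (?p y)) \<in> homs c X"
      by (rule restrict_homI) (use p(1) p_le in \<open>force simp: close_pairs_def\<close>)+
  qed (use hom_in[OF coconesD(3)[OF \<nu>']] inj_pr in \<open>simp add: t\<nu>\<close>)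
  ultimately have "f y = fst (?p y)" "g y = snd (?p y)" if "y \<in> pts c" for y
    using that by (metis restrict_apply)+
  then show ?thesis unfolding hom_ed_le_iff using p(1) by (force simp: close_pairs_def)
qed

text \<open>The isomorphism is composition with \<open>\<nu>\<close>, and its inverse picks
  factorizations. That the inverse is nonexpanding is the substantial part and comes from
  \<open>colimit_cocone_isometry\<close>.\<close>

lemma colimit_cocone_imp_wcolimit:
  fixes D :: "('o, 'm, 'u emet, 'u \<Rightarrow> 'u) efun"
  assumes \<nu>: "colimit_cocone (spaces U b) C D W c \<nu>"
    and D: "enriched_functor C (met_cat (spaces U b)) D" and W: "weight C W"
  obtains \<psi> where "wcolimit (spaces U b) C D W c \<psi>" "wcolimit_unit c \<psi> = \<nu>"
proof -
  have \<nu>': "\<nu> \<in> cocones C D W c" and c: "c \<in> spaces U b" using \<nu> by (simp_all add: colimit_cocone_def)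
  define \<psi> where "\<psi> = (\<lambda>(X :: 'u emet) (f :: 'u \<Rightarrow> 'u). \<lambda>d\<in>Obj C. \<lambda>w\<in>pts (fobj W d). compose (pts (fobj D d)) f (\<nu> d w))"
  have \<psi>_in: "\<psi> X f \<in> cocones C D W X" if "f \<in> homs c X" for X :: "'u emet" and f
    unfolding \<psi>_def using that by (rule cocones_compose[OF D W \<nu>'])
  have iso: "met_iso (hom_space c X) (nat_space (op_cat C) W (hom_into D X)) (\<psi> X)" if X: "X \<in> spaces U b" for X :: "'u emet"
  proof -
    have "\<forall>\<tau>\<in>cocones C D W X. \<exists>f. f \<in> homs c X \<and>
        (\<forall>d\<in>Obj C. \<forall>w\<in>pts (fobj W d). compose (pts (fobj D d)) f (\<nu> d w) = \<tau> d w)"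
      using \<nu> X unfolding colimit_cocone_def by blast
    then obtain g where g: "\<And>\<tau>. \<tau> \<in> cocones C D W X \<Longrightarrow> g \<tau> \<in> homs c X"
      "\<And>\<tau> d w. \<tau> \<in> cocones C D W X \<Longrightarrow> d \<in> Obj C \<Longrightarrow> w \<in> pts (fobj W d) \<Longrightarrow> compose (pts (fobj D d)) (g \<tau>) (\<nu> d w) = \<tau> d w"
      unfolding bchoice_iff by blast
    have g_app: "g \<tau> (\<nu> d w z) = \<tau> d w z" if "\<tau> \<in> cocones C D W X" "d \<in> Obj C" "w \<in> pts (fobj W d)" "z \<in> pts (fobj D d)" for \<tau> d w z
      using fun_cong[OF g(2)[OF that(1,2,3)], of z] that(4) by (simp add: compose_app)
    have \<psi>g: "\<psi> X (g \<tau>) = \<tau>" if \<tau>: "\<tau> \<in> cocones C D W X" for \<tau>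
      by (rule cocones_eqI[OF \<psi>_in[OF g(1)[OF \<tau>]] \<tau>]) (simp add: \<psi>_def g(2)[OF \<tau>])
    have \<psi>_le: "ed (nat_space (op_cat C) W (hom_into D X)) (\<psi> X f) (\<psi> X f') \<le> ed (hom_space c X) f f'"
      for f f'
      unfolding nat_space_ed_le_iff
      using hom_in[OF coconesD(3)[OF \<nu>']] by (auto simp: \<psi>_def compose_app intro: hom_ed_ge)
    have g_le: "ed (hom_space c X) (g \<tau>) (g \<tau>') \<le> ed (nat_space (op_cat C) W (hom_into D X)) \<tau> \<tau>'"
      if \<tau>: "\<tau> \<in> cocones C D W X" "\<tau>' \<in> cocones C D W X" for \<tau> \<tau>'
    proof (rule colimit_cocone_isometry[OF \<nu> D W X g(1)[OF \<tau>(1)] g(1)[OF \<tau>(2)]])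
      fix d w z assume d: "d \<in> Obj C" "w \<in> pts (fobj W d)" "z \<in> pts (fobj D d)"
      have "ed X (\<tau> d w z) (\<tau>' d w z) \<le> ed (nat_space (op_cat C) W (hom_into D X)) \<tau> \<tau>'"
        using nat_space_ed_le_iff[of C W D X \<tau> \<tau>'] d by blast
      then show "ed X (g \<tau> (\<nu> d w z)) (g \<tau>' (\<nu> d w z)) \<le> ed (nat_space (op_cat C) W (hom_into D X)) \<tau> \<tau>'"
        by (simp add: g_app[OF \<tau>(1) d] g_app[OF \<tau>(2) d])
    qed
    have g\<psi>: "g (\<psi> X f) = f" if f: "f \<in> homs c X" for f
    proof (rule colimit_cocone_unique[OF \<nu> D W X g(1)[OF \<psi>_in[OF f]] f])
      fix d w z assume "d \<in> Obj C" "w \<in> pts (fobj W d)" "z \<in> pts (fobj D d)"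
      then show "g (\<psi> X f) (\<nu> d w z) = f (\<nu> d w z)"
        using g_app[OF \<psi>_in[OF f], of d w z] by (simp add: \<psi>_def compose_app)
    qed
    show ?thesis
      unfolding met_iso_def nonexpanding_def cocones_def[symmetric]
      using \<psi>_in \<psi>_le g(1) g_le g\<psi> \<psi>g by (intro conjI exI[of _ g]) auto
  qed
  have nat: "\<psi> Y (compose (pts c) h f) = (\<lambda>d\<in>Obj C. \<lambda>w\<in>pts (fobj W d). compose (pts (fobj D d)) h (\<psi> X f d w))"
    for X Y :: "'u emet" and h f
    unfolding \<psi>_def using hom_compose_assoc[OF coconesD(3)[OF \<nu>'], of _ _ h f] by (auto simp: fun_eq_iff restrict_def)
  have "wcolimit (spaces U b) C D W c \<psi>"
    unfolding wcolimit_def using c iso nat by blast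
  moreover have "wcolimit_unit c \<psi> = \<nu>"
  proof (rule cocones_eqI)
    show "wcolimit_unit c \<psi> \<in> cocones C D W c" unfolding wcolimit_unit_def by (rule \<psi>_in[OF ident_in_hom])
  qed (use \<nu>' in \<open>simp_all add: wcolimit_unit_def \<psi>_def compose_id_left[OF coconesD(3)[OF \<nu>']]\<close>)
  ultimately show thesis by (rule that)
qed

end

section \<open>Images of cocones under an enriched functor, and preservation\<close>

definition image_cocone :: "('u emet, 'u \<Rightarrow> 'u, 'v emet, 'v \<Rightarrow> 'v) efun \<Rightarrow> ('o, 'm) ecat
     \<Rightarrow> ('o, 'm, 'u emet, 'u \<Rightarrow> 'u) efun \<Rightarrow> ('o, 'm, 'w emet, 'w \<Rightarrow> 'w) efun \<Rightarrow> 'u emet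
     \<Rightarrow> ('o \<Rightarrow> 'w \<Rightarrow> 'u \<Rightarrow> 'u) \<Rightarrow> 'o \<Rightarrow> 'w \<Rightarrow> 'v \<Rightarrow> 'v" where
  "image_cocone F C D W c \<nu> = (\<lambda>d\<in>Obj C. \<lambda>w\<in>pts (fobj W d). farr F (fobj D d) c (\<nu> d w))"

lemma comp_fun_simps [simp]:
  "fobj (comp_fun G F) x = fobj G (fobj F x)"
  "farr (comp_fun G F) x y f = farr G (fobj F x) (fobj F y) (farr F x y f)"
  by (simp_all add: comp_fun_def)

lemma enriched_functor_comp_fun:
  assumes G: "enriched_functor (met_cat V) (met_cat V') G" and F: "enriched_functor C (met_cat V) F"
  shows "enriched_functor C (met_cat V') (comp_fun G F)"
proof -
  have F': "nonexpanding (Hom C x y) (hom_space (fobj F x) (fobj F y)) (farr F x y)" if "x \<in> Obj C" "y \<in> Obj C" for x y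
    using F that by (simp add: enriched_functor_def met_cat_def)
  have "nonexpanding (Hom C x y) (hom_space (fobj G (fobj F x)) (fobj G (fobj F y)))
      (farr G (fobj F x) (fobj F y) \<circ> farr F x y)" if xy: "x \<in> Obj C" "y \<in> Obj C" for x y
    unfolding nonexpanding_def
  proof (intro conjI ballI)
    note h = functor_hom[OF F xy] and o = functor_obj[OF F xy(1)] functor_obj[OF F xy(2)]
    show "farr G (fobj F x) (fobj F y) \<circ> farr F x y \<in> pts (Hom C x y) \<rightarrow> homs (fobj G (fobj F x)) (fobj G (fobj F y))"
      using met_functor_hom[OF G o h] by auto
    fix f f' assume f: "f \<in> pts (Hom C x y)" "f' \<in> pts (Hom C x y)"
    show "ed (hom_space (fobj G (fobj F x)) (fobj G (fobj F y)))
        ((farr G (fobj F x) (fobj F y) \<circ> farr F x y) f) ((farr G (fobj F x) (fobj F y) \<circ> farr F x y) f')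
        \<le> ed (Hom C x y) f f'"
      using order_trans[OF met_functor_le[OF G o h[OF f(1)] h[OF f(2)]] ed_nonexp[OF F'[OF xy] f]] by simp
  qed
  moreover have "farr G (fobj F x) (fobj F z) (farr F x z (Comp C x y z g f)) =
      compose (pts (fobj G (fobj F x))) (farr G (fobj F y) (fobj F z) (farr F y z g)) (farr G (fobj F x) (fobj F y) (farr F x y f))"
    if "x \<in> Obj C" "y \<in> Obj C" "z \<in> Obj C" "f \<in> pts (Hom C x y)" "g \<in> pts (Hom C y z)" for x y z f g
    using that by (simp add: functor_comp[OF F] met_functor_comp[OF G] functor_obj[OF F] functor_hom[OF F])
  moreover have "farr F x x (Ident C x) = (\<lambda>z\<in>pts (fobj F x). z)" if "x \<in> Obj C" for x
    using F that by (simp add: enriched_functor_def met_cat_def)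
  ultimately show ?thesis
    using F G met_functor_obj[OF G] functor_obj[OF F] met_functor_id[OF G]
    unfolding enriched_functor_def[of C "met_cat V'"] comp_fun_simps comp_def
    by (intro conjI ballI) (simp_all add: enriched_functor_def met_cat_def)
qed

text \<open>Local nonexpansion of \<open>F\<close> keeps the metric condition: components at points
  \<open>w\<close>, \<open>w'\<close> of the weight are close in the supremum metric, hence so are
  their images.\<close>

lemma image_cocone_in_cocones:
  assumes F: "enriched_functor (met_cat V) (met_cat V') F" and D: "enriched_functor C (met_cat V) D"
    and W: "weight C W" and c: "c \<in> V" and \<nu>: "\<nu> \<in> cocones C D W c"
  shows "image_cocone F C D W c \<nu> \<in> cocones C (comp_fun F D) W (fobj F c)"
proof (rule coconesI)
  fix d w w' z assume d: "d \<in> Obj C" "w \<in> pts (fobj W d)" "w' \<in> pts (fobj W d)" "z \<in> pts (fobj (comp_fun F D) d)"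
  have "ed (fobj F c) (farr F (fobj D d) c (\<nu> d w) z) (farr F (fobj D d) c (\<nu> d w') z)
      \<le> ed (hom_space (fobj F (fobj D d)) (fobj F c)) (farr F (fobj D d) c (\<nu> d w)) (farr F (fobj D d) c (\<nu> d w'))"
    using d by (intro hom_ed_ge) simp
  also have "\<dots> \<le> ed (hom_space (fobj D d) c) (\<nu> d w) (\<nu> d w')"
    using d by (intro met_functor_le[OF F] functor_obj[OF D] c coconesD(3)[OF \<nu>])
  also have "\<dots> \<le> ed (fobj W d) w w'"
    unfolding hom_ed_le_iff using coconesD(4)[OF \<nu>] d by blast
  finally show "ed (fobj F c) (image_cocone F C D W c \<nu> d w z) (image_cocone F C D W c \<nu> d w' z) \<le> ed (fobj W d) w w'"
    using d by (simp add: image_cocone_def)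
next
  fix x y a w assume x: "x \<in> Obj C" "y \<in> Obj C" "a \<in> pts (Hom C y x)" "w \<in> pts (fobj W x)"
  have "compose (pts (fobj F (fobj D y))) (farr F (fobj D x) c (\<nu> x w)) (farr F (fobj D y) (fobj D x) (farr D y x a))
      = farr F (fobj D y) c (compose (pts (fobj D y)) (\<nu> x w) (farr D y x a))"
    using x by (intro met_functor_comp[OF F, symmetric] functor_obj[OF D] functor_hom[OF D] c coconesD(3)[OF \<nu>])
  then show "compose (pts (fobj (comp_fun F D) y)) (image_cocone F C D W c \<nu> x w) (farr (comp_fun F D) y x a)
      = image_cocone F C D W c \<nu> y (farr W x y a w)"
    using x W by (simp add: image_cocone_def weight_def coconesD(5)[OF \<nu> x])
next
  fix d w assume "d \<in> Obj C" "w \<in> pts (fobj W d)"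
  then show "image_cocone F C D W c \<nu> d w \<in> homs (fobj (comp_fun F D) d) (fobj F c)"
    using met_functor_hom[OF F functor_obj[OF D] c coconesD(3)[OF \<nu>]] by (simp add: image_cocone_def)
qed (auto simp: image_cocone_def)

text \<open>The prescribed unit determines the isomorphisms, so preservation becomes a statement
  about the image cocone only.\<close>

lemma (in small_sets) preserves_wcolimit_iff:
  fixes F :: "('u emet, 'u \<Rightarrow> 'u, 'u emet, 'u \<Rightarrow> 'u) efun"
  assumes F: "enriched_functor (met_cat (spaces U b)) (met_cat (spaces U b)) F"
    and D: "enriched_functor C (met_cat (spaces U b)) D" and W: "weight C W"
  shows "preserves_wcolimit (spaces U b) F C D W c \<psi> \<longleftrightarrow>
    colimit_cocone (spaces U b) C (comp_fun F D) W (fobj F c) (image_cocone F C D W c (wcolimit_unit c \<psi>))"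
    (is "?P \<longleftrightarrow> colimit_cocone _ _ _ _ _ ?\<nu>")
proof
  assume ?P
  then obtain \<psi>' where "wcolimit (spaces U b) C (comp_fun F D) W (fobj F c) \<psi>'" "wcolimit_unit (fobj F c) \<psi>' = ?\<nu>"
    unfolding preserves_wcolimit_def image_cocone_def by blast
  then show "colimit_cocone (spaces U b) C (comp_fun F D) W (fobj F c) ?\<nu>"
    using wcolimit_imp_colimit_cocone by metis
next
  assume *: "colimit_cocone (spaces U b) C (comp_fun F D) W (fobj F c) ?\<nu>"
  show ?P
    by (rule colimit_cocone_imp_wcolimit[OF * enriched_functor_comp_fun[OF F D] W])
      (auto simp: preserves_wcolimit_def image_cocone_def)
qed

section \<open>Directed colimits and precongruences\<close>

lemma compose_eq_compose_iff: "compose A g h = compose A g' h' \<longleftrightarrow> (\<forall>z\<in>A. g (h z) = g' (h' z))"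
  by (auto simp: compose_def fun_eq_iff)

lemma nat_space_iff:
  "\<tau> \<in> pts (nat_space C S T) \<longleftrightarrow> \<tau> \<in> extensional (Obj C) \<and>
     (\<forall>x\<in>Obj C. \<tau> x \<in> homs (fobj S x) (fobj T x)) \<and>
     (\<forall>x\<in>Obj C. \<forall>y\<in>Obj C. \<forall>f\<in>pts (Hom C x y). \<forall>z\<in>pts (fobj S x).
        farr T x y f (\<tau> x z) = \<tau> y (farr S x y f z))"
  unfolding nat_space_def compose_eq_compose_iff by (auto simp: PiE_iff)

lemma Obj_met_cat [simp]: "Obj (met_cat V) = V"
  by (simp add: met_cat_def)

lemma Hom_met_cat [simp]: "Hom (met_cat V) = hom_space"
  by (simp add: met_cat_def)

lemma fin_cat_simps [simp]: "Obj fin_cat = {A. finite A}" "pts (Hom fin_cat A B) = A \<rightarrow>\<^sub>E B"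
  by (simp_all add: fin_cat_def)

lemma K_fun_simps [simp]: "fobj K_fun = discrete" "farr K_fun A B f = f"
  by (simp_all add: K_fun_def)

lemma weight_conical: "weight C conical_weight"
  by (simp add: weight_def conical_weight_def)

lemma conical_coconesI:
  assumes X: "ext_metric X"
    and "\<tau> \<in> extensional P" "\<And>p. p \<in> P \<Longrightarrow> \<tau> p () \<in> homs (fobj D p) X"
    and D: "\<And>p q. p \<in> P \<Longrightarrow> q \<in> P \<Longrightarrow> (p, q) \<in> r \<Longrightarrow> farr D p q () \<in> homs (fobj D p) (fobj D q)"
    and eq: "\<And>p q z. p \<in> P \<Longrightarrow> q \<in> P \<Longrightarrow> (p, q) \<in> r \<Longrightarrow> z \<in> pts (fobj D p) \<Longrightarrow> \<tau> q () (farr D p q () z) = \<tau> p () z"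
  shows "\<tau> \<in> cocones (poset_cat P r) D conical_weight X"
proof (rule coconesI)
  fix d w w' z assume "d \<in> Obj (poset_cat P r)" "z \<in> pts (fobj D d)"
  then have "\<tau> d w z \<in> pts X" using hom_in[OF assms(3)] by (simp add: poset_cat_def)
  then show "ed X (\<tau> d w z) (\<tau> d w' z) \<le> ed (fobj conical_weight d) w w'"
    using ext_metric_refl[OF X] by simp
next
  fix x y f w assume "x \<in> Obj (poset_cat P r)" "y \<in> Obj (poset_cat P r)" "f \<in> pts (Hom (poset_cat P r) y x)"
  then have xy: "x \<in> P" "y \<in> P" "(y, x) \<in> r" by (simp_all add: poset_cat_def discrete_def split: if_splits)
  show "compose (pts (fobj D y)) (\<tau> x w) (farr D y x f) = \<tau> y (farr conical_weight x y f w)"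
  proof (rule extensionalityI[OF compose_extensional])
    show "\<tau> y (farr conical_weight x y f w) \<in> extensional (pts (fobj D y))"
      using hom_extensional[OF assms(3)[OF xy(2)]] by simp
    show "compose (pts (fobj D y)) (\<tau> x w) (farr D y x f) z = \<tau> y (farr conical_weight x y f w) z"
      if "z \<in> pts (fobj D y)" for z
      using eq[OF xy(2,1,3) that] that by (simp add: compose_app)
  qed
qed (use assms in \<open>simp_all add: poset_cat_def conical_weight_def extensional_def\<close>)

section \<open>Cocones for the basic weight\<close>

lemma pc_cat_cases:
  assumes "x \<in> Obj pc_cat" "y \<in> Obj pc_cat" "f \<in> pts (Hom pc_cat y x)"
  obtains "x = y" "f = Idle" | e where "0 < e" "x = Base" "y = Level e" "f = Lam"
    | e where "0 < e" "x = Base" "y = Level e" "f = Rho"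
  using assms by (auto simp: pc_cat_def discrete_def split: if_splits)

lemma weight_pc: "weight pc_cat pc_weight"
  unfolding weight_def
proof (intro ballI)
  fix x y f w assume x: "x \<in> Obj pc_cat" "y \<in> Obj pc_cat" "f \<in> pts (Hom pc_cat y x)" and w: "w \<in> pts (fobj pc_weight x)"
  from x show "farr pc_weight x y f w \<in> pts (fobj pc_weight y)"
    by (cases rule: pc_cat_cases) (use w in \<open>simp_all add: pc_weight_def\<close>)
qed

text \<open>A cocone for the basic weight is determined by its value \<open>u\<close> at
  \<open>Base\<close>: the arrows \<open>Lam\<close> and \<open>Rho\<close> force the values at
  \<open>Lft\<close> and \<open>Rgt\<close>.\<close>

definition pc_cocone :: "(pc_obj, pc_arr, 'a emet, 'a \<Rightarrow> 'a) efun \<Rightarrow> ('a \<Rightarrow> 'a) \<Rightarrow> pc_obj \<Rightarrow> pc_pt \<Rightarrow> 'a \<Rightarrow> 'a" where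
  "pc_cocone D u = (\<lambda>d\<in>Obj pc_cat. \<lambda>w\<in>pts (pc_weight_obj d). case w of Zero \<Rightarrow> u
     | Lft \<Rightarrow> compose (pts (fobj D d)) u (farr D d Base Lam)
     | Rgt \<Rightarrow> compose (pts (fobj D d)) u (farr D d Base Rho))"

lemma pc_obj_in: "Base \<in> Obj pc_cat" "0 < e \<Longrightarrow> Level e \<in> Obj pc_cat"
  "0 < e \<Longrightarrow> Lam \<in> pts (Hom pc_cat (Level e) Base)" "0 < e \<Longrightarrow> Rho \<in> pts (Hom pc_cat (Level e) Base)"
  by (simp_all add: pc_cat_def discrete_def)

text \<open>The points \<open>Lft\<close> and \<open>Rgt\<close> of the weight at level
  \<open>e\<close> have distance \<open>e\<close>, so the metric condition on a cocone is precisely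
  \<open>le\<close>: the two projections of a point of level \<open>e\<close> go to points at
  distance at most \<open>e\<close>.\<close>

lemma pc_cocone_in_cocones:
  assumes D: "enriched_functor pc_cat (met_cat V) D" and X: "ext_metric X" and u: "u \<in> homs (fobj D Base) X"
    and le: "\<And>e z. 0 < e \<Longrightarrow> z \<in> pts (fobj D (Level e)) \<Longrightarrow>
      ed X (u (farr D (Level e) Base Lam z)) (u (farr D (Level e) Base Rho z)) \<le> ennreal (real_of_rat e)"
  shows "pc_cocone D u \<in> cocones pc_cat D pc_weight X"
proof (rule coconesI)
  have l: "compose (pts (fobj D (Level e))) u (farr D (Level e) Base Lam) \<in> homs (fobj D (Level e)) X"
    and r: "compose (pts (fobj D (Level e))) u (farr D (Level e) Base Rho) \<in> homs (fobj D (Level e)) X"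
    if "0 < e" for e
    using that by (auto intro!: hom_space_compose[OF functor_hom[OF D] u] pc_obj_in)
  show hom: "pc_cocone D u d w \<in> homs (fobj D d) X" if d: "d \<in> Obj pc_cat" and w: "w \<in> pts (fobj pc_weight d)" for d w
  proof (cases d)
    case Base
    then show ?thesis using w d u by (simp add: pc_cocone_def pc_weight_def)
  next
    case (Level e)
    then have "0 < e" using d by (auto simp: pc_cat_def)
    then show ?thesis using Level w d l r by (auto simp: pc_cocone_def pc_weight_def)
  qed
  show "ed X (pc_cocone D u d w z) (pc_cocone D u d w' z) \<le> ed (fobj pc_weight d) w w'"
    if d: "d \<in> Obj pc_cat" and w: "w \<in> pts (fobj pc_weight d)" "w' \<in> pts (fobj pc_weight d)" and z: "z \<in> pts (fobj D d)" for d w w' z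
  proof (cases "w = w'")
    case True
    then show ?thesis using ext_metric_refl[OF X hom_in[OF hom[OF d w(1)] z]] by simp
  next
    case False
    then obtain e where e: "d = Level e" using w by (cases d) (auto simp: pc_weight_def)
    then have e': "0 < e" using d by (auto simp: pc_cat_def)
    have "farr D (Level e) Base Lam z \<in> pts (fobj D Base)" "farr D (Level e) Base Rho z \<in> pts (fobj D Base)"
      using hom_in[OF functor_hom[OF D pc_obj_in(2,1,3)]] hom_in[OF functor_hom[OF D pc_obj_in(2,1,4)]] e' z e by blast+
    then have "u (farr D (Level e) Base Lam z) \<in> pts X" "u (farr D (Level e) Base Rho z) \<in> pts X"
      using hom_in[OF u] by blast+
    from ext_metric_sym[OF X this] le[OF e' z[unfolded e]]
    show ?thesis using w z False d unfolding e by (auto simp: pc_cocone_def pc_weight_def compose_app)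
  qed
  show "compose (pts (fobj D y)) (pc_cocone D u x w) (farr D y x f) = pc_cocone D u y (farr pc_weight x y f w)"
    if x: "x \<in> Obj pc_cat" "y \<in> Obj pc_cat" "f \<in> pts (Hom pc_cat y x)" and w: "w \<in> pts (fobj pc_weight x)" for x y f w
    using x
  proof (cases rule: pc_cat_cases)
    case 1
    have "farr D x x Idle = (\<lambda>z\<in>pts (fobj D x). z)"
    proof -
      have "farr D x x (Ident pc_cat x) = Ident (met_cat V) (fobj D x)"
        using D x(1) unfolding enriched_functor_def by blast
      then show ?thesis by (simp add: pc_cat_def met_cat_def)
    qed
    then have "compose (pts (fobj D y)) (pc_cocone D u x w) (farr D y x f) = pc_cocone D u x w"
      using 1 compose_id_right[OF hom[OF x(1) w]] by simp
    then show ?thesis using 1 w by (simp add: pc_weight_def)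
  next
    case (2 e)
    then show ?thesis using w x by (simp add: pc_cocone_def pc_weight_def)
  next
    case (3 e)
    then show ?thesis using w x by (simp add: pc_cocone_def pc_weight_def)
  qed
qed (auto simp: pc_cocone_def pc_weight_def)

lemma pc_cocone_Base: "pc_cocone D u Base Zero = u"
  by (simp add: pc_cocone_def pc_cat_def)

lemma pc_coconesD:
  assumes "\<tau> \<in> cocones pc_cat D pc_weight X"
  shows "\<tau> Base Zero \<in> homs (fobj D Base) X"
    and "0 < e \<Longrightarrow> \<tau> (Level e) Lft = compose (pts (fobj D (Level e))) (\<tau> Base Zero) (farr D (Level e) Base Lam)"
    and "0 < e \<Longrightarrow> \<tau> (Level e) Rgt = compose (pts (fobj D (Level e))) (\<tau> Base Zero) (farr D (Level e) Base Rho)"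
    and "0 < e \<Longrightarrow> z \<in> pts (fobj D (Level e)) \<Longrightarrow>
      ed X (\<tau> Base Zero (farr D (Level e) Base Lam z)) (\<tau> Base Zero (farr D (Level e) Base Rho z)) \<le> ennreal (real_of_rat e)"
proof -
  show "\<tau> Base Zero \<in> homs (fobj D Base) X"
    by (rule coconesD(3)[OF assms pc_obj_in(1)]) (simp add: pc_weight_def)
  show l: "0 < e \<Longrightarrow> \<tau> (Level e) Lft = compose (pts (fobj D (Level e))) (\<tau> Base Zero) (farr D (Level e) Base Lam)"
    using coconesD(5)[OF assms pc_obj_in(1,2,3), of e Zero] by (simp add: pc_weight_def)
  show r: "0 < e \<Longrightarrow> \<tau> (Level e) Rgt = compose (pts (fobj D (Level e))) (\<tau> Base Zero) (farr D (Level e) Base Rho)"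
    using coconesD(5)[OF assms pc_obj_in(1,2,4), of e Zero] by (simp add: pc_weight_def)
  show "0 < e \<Longrightarrow> z \<in> pts (fobj D (Level e)) \<Longrightarrow>
      ed X (\<tau> Base Zero (farr D (Level e) Base Lam z)) (\<tau> Base Zero (farr D (Level e) Base Rho z)) \<le> ennreal (real_of_rat e)"
    using coconesD(4)[OF assms pc_obj_in(2), of e Lft Rgt z] l r by (simp add: pc_weight_def compose_app)
qed

lemma pc_colimit_factor:
  assumes \<nu>: "colimit_cocone V pc_cat D pc_weight c \<nu>" and D: "enriched_functor pc_cat (met_cat V) D"
    and X: "X \<in> V" "ext_metric X" and u: "u \<in> homs (fobj D Base) X"
    and le: "\<And>e z. 0 < e \<Longrightarrow> z \<in> pts (fobj D (Level e)) \<Longrightarrow>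
      ed X (u (farr D (Level e) Base Lam z)) (u (farr D (Level e) Base Rho z)) \<le> ennreal (real_of_rat e)"
  shows "\<exists>f\<in>homs c X. \<forall>z\<in>pts (fobj D Base). f (\<nu> Base Zero z) = u z"
proof -
  obtain f where "f \<in> homs c X"
    "\<forall>d\<in>Obj pc_cat. \<forall>w\<in>pts (fobj pc_weight d). \<forall>z\<in>pts (fobj D d). f (\<nu> d w z) = pc_cocone D u d w z"
    using colimit_cocone_factor[OF \<nu> X(1) pc_cocone_in_cocones[OF D X(2) u le]] by blast
  moreover have "Zero \<in> pts (fobj pc_weight Base)" by (simp add: pc_weight_def)
  ultimately show ?thesis using pc_obj_in(1) pc_cocone_Base by metis
qed

lemma pc_cocone_agree:
  assumes D: "enriched_functor pc_cat (met_cat V) D"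
    and \<nu>: "\<nu> \<in> cocones pc_cat D pc_weight c"
    and eq: "\<And>z. z \<in> pts (fobj D Base) \<Longrightarrow> f (\<nu> Base Zero z) = g (\<nu> Base Zero z)"
    and d: "d \<in> Obj pc_cat" "w \<in> pts (fobj pc_weight d)" "z \<in> pts (fobj D d)"
  shows "f (\<nu> d w z) = g (\<nu> d w z)"
proof (cases d)
  case Base
  then show ?thesis using d eq by (simp add: pc_weight_def)
next
  case (Level e)
  then have e: "0 < e" using d(1) by (auto simp: pc_cat_def)
  have "farr D (Level e) Base Lam z \<in> pts (fobj D Base)" "farr D (Level e) Base Rho z \<in> pts (fobj D Base)"
    using hom_in[OF functor_hom[OF D pc_obj_in(2,1,3)]] hom_in[OF functor_hom[OF D pc_obj_in(2,1,4)]] e d Level by blast+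
  moreover have "w = Lft \<or> w = Rgt" using d Level by (auto simp: pc_weight_def)
  ultimately show ?thesis using Level eq d pc_coconesD(2,3)[OF \<nu> e] by (auto simp: compose_app)
qed

lemma pc_colimit_unique:
  assumes \<nu>: "colimit_cocone V pc_cat D pc_weight c \<nu>" and D: "enriched_functor pc_cat (met_cat V) D"
    and X: "X \<in> V" and f: "f \<in> homs c X" "g \<in> homs c X"
    and eq: "\<And>z. z \<in> pts (fobj D Base) \<Longrightarrow> f (\<nu> Base Zero z) = g (\<nu> Base Zero z)"
  shows "f = g"
proof (rule colimit_cocone_unique[OF \<nu> D weight_pc X f])
  have \<nu>': "\<nu> \<in> cocones pc_cat D pc_weight c" using \<nu> by (simp add: colimit_cocone_def)
  show "d \<in> Obj pc_cat \<Longrightarrow> w \<in> pts (fobj pc_weight d) \<Longrightarrow> z \<in> pts (fobj D d) \<Longrightarrow> f (\<nu> d w z) = g (\<nu> d w z)" for d w z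
    using pc_cocone_agree[OF D \<nu>', of f g] eq by blast
qed

text \<open>Both halves of the universal property are reduced to the component at
  \<open>Base\<close>, as the other components of any cocone are composites with it.\<close>

lemma pc_colimit_coconeI:
  assumes D: "enriched_functor pc_cat (met_cat V) D" and c: "c \<in> V" and \<nu>: "\<nu> \<in> cocones pc_cat D pc_weight c"
    and ex: "\<And>X u. X \<in> V \<Longrightarrow> u \<in> homs (fobj D Base) X \<Longrightarrow>
      (\<And>e z. 0 < e \<Longrightarrow> z \<in> pts (fobj D (Level e)) \<Longrightarrow>
        ed X (u (farr D (Level e) Base Lam z)) (u (farr D (Level e) Base Rho z)) \<le> ennreal (real_of_rat e)) \<Longrightarrow>
      \<exists>f\<in>homs c X. \<forall>z\<in>pts (fobj D Base). f (\<nu> Base Zero z) = u z"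
    and un: "\<And>X f g. X \<in> V \<Longrightarrow> f \<in> homs c X \<Longrightarrow> g \<in> homs c X \<Longrightarrow>
      (\<And>z. z \<in> pts (fobj D Base) \<Longrightarrow> f (\<nu> Base Zero z) = g (\<nu> Base Zero z)) \<Longrightarrow> f = g"
  shows "colimit_cocone V pc_cat D pc_weight c \<nu>"
  unfolding colimit_cocone_def
proof (intro conjI ballI c \<nu>)
  fix X \<tau> assume X: "X \<in> V" and \<tau>: "\<tau> \<in> cocones pc_cat D pc_weight X"
  obtain f where f: "f \<in> homs c X" "\<forall>z\<in>pts (fobj D Base). f (\<nu> Base Zero z) = \<tau> Base Zero z"
    using ex[OF X pc_coconesD(1,4)[OF \<tau>]] by blast
  have f\<nu>: "compose (pts (fobj D d)) f (\<nu> d w) = \<tau> d w" if d: "d \<in> Obj pc_cat" "w \<in> pts (fobj pc_weight d)" for d w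
  proof (rule extensionalityI[OF compose_extensional hom_extensional[OF coconesD(3)[OF \<tau> d]]])
    fix z assume z: "z \<in> pts (fobj D d)"
    show "compose (pts (fobj D d)) f (\<nu> d w) z = \<tau> d w z"
    proof (cases d)
      case Base
      then show ?thesis using d f(2) z by (simp add: pc_weight_def compose_app)
    next
      case (Level e)
      then have e: "0 < e" using d(1) by (auto simp: pc_cat_def)
      have "farr D (Level e) Base Lam z \<in> pts (fobj D Base)" "farr D (Level e) Base Rho z \<in> pts (fobj D Base)"
        using hom_in[OF functor_hom[OF D pc_obj_in(2,1,3)]] hom_in[OF functor_hom[OF D pc_obj_in(2,1,4)]] e z Level by blast+
      moreover have "w = Lft \<or> w = Rgt" using d Level by (auto simp: pc_weight_def)
      ultimately show ?thesis
        using Level f(2) z pc_coconesD(2,3)[OF \<nu> e] pc_coconesD(2,3)[OF \<tau> e] by (auto simp: compose_app)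
    qed
  qed
  show "\<exists>!f. f \<in> homs c X \<and>
      (\<forall>d\<in>Obj pc_cat. \<forall>w\<in>pts (fobj pc_weight d). compose (pts (fobj D d)) f (\<nu> d w) = \<tau> d w)"
  proof (intro ex1I[of _ f] conjI ballI f\<nu> f(1))
    fix g assume g: "g \<in> homs c X \<and>
      (\<forall>d\<in>Obj pc_cat. \<forall>w\<in>pts (fobj pc_weight d). compose (pts (fobj D d)) g (\<nu> d w) = \<tau> d w)"
    then have "compose (pts (fobj D Base)) g (\<nu> Base Zero) = \<tau> Base Zero"
      using pc_obj_in(1) by (simp add: pc_weight_def)
    then have "g (\<nu> Base Zero z) = f (\<nu> Base Zero z)" if "z \<in> pts (fobj D Base)" for z
      using f(2) that by (metis compose_app)
    then show "g = f" using un[OF X] g f(1) by blast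
  qed
qed

section \<open>Preservation implies strong finitarity\<close>

lemma met_functor_comp_app:
  assumes "enriched_functor (met_cat V) (met_cat V') F" "X \<in> V" "Y \<in> V" "Z \<in> V"
    "f \<in> homs X Y" "g \<in> homs Y Z" "z \<in> pts (fobj F X)"
  shows "farr F Y Z g (farr F X Y f z) = farr F X Z (compose (pts X) g f) z"
  using assms(7) by (simp add: met_functor_comp[OF assms(1-6)] compose_app)

lemma met_functor_id_app:
  assumes "enriched_functor (met_cat V) (met_cat V') F" "X \<in> V" "z \<in> pts (fobj F X)"
  shows "farr F X X (\<lambda>x\<in>pts X. x) z = z"
  using assms(3) by (simp add: met_functor_id[OF assms(1,2)])

lemma met_functor_in:
  assumes "enriched_functor (met_cat V) (met_cat V') F" "X \<in> V" "Y \<in> V" "f \<in> homs X Y" "z \<in> pts (fobj F X)"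
  shows "farr F X Y f z \<in> pts (fobj F Y)"
  by (rule hom_in[OF met_functor_hom[OF assms(1-4)] assms(5)])

lemma restrict_in_homs_discrete:
  "ext_metric Y \<Longrightarrow> f \<in> A \<rightarrow> pts Y \<Longrightarrow> restrict f A \<in> homs (discrete A) Y"
  by (simp add: homs_discrete)

locale met_endofunctor = small_sets U pr for U :: "'u set set" and pr :: "'u \<times> 'u \<Rightarrow> 'u" +
  fixes b :: bool and F :: "('u emet, 'u \<Rightarrow> 'u, 'u emet, 'u \<Rightarrow> 'u) efun"
  assumes F_functor: "enriched_functor (met_cat (spaces U b)) (met_cat (spaces U b)) F"
begin

abbreviation V :: "'u emet set" where "V \<equiv> spaces U b"

lemma discrete_in: "small U A \<Longrightarrow> discrete A \<in> V"
  by (rule discrete_in_spaces)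

lemma small_finite: "finite A \<Longrightarrow> small U A"
  by (simp add: small_countable countable_finite)

lemma functor_precongruence:
  assumes M: "M \<in> V"
  shows "enriched_functor pc_cat (met_cat V) (precongruence pr M)"
proof (rule enriched_functor_precongruence)
  show "precongruence_obj pr M d \<in> V" for d
  proof (cases d)
    case Base
    then show ?thesis using discrete_in spacesD(2)[OF M] by simp
  next
    case (Level e)
    have "small U (pts M \<times> pts M)" by (intro small_Sigma spacesD(2)[OF M])
    then have "small U (pr ` {(x, y). x \<in> pts M \<and> y \<in> pts M \<and> ed M x y \<le> ennreal (real_of_rat e)})"
      by (rule small_image[OF small_subset]) auto
    then show ?thesis using Level discrete_in by simp
  qed
qed (auto simp: spaces_def inj_pr)

lemma precongruence_simps [simp]:
  "fobj (precongruence pr M) Base = discrete (pts M)"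
  "fobj (precongruence pr M) (Level e) = discrete (pr ` {(x, y). x \<in> pts M \<and> y \<in> pts M \<and> ed M x y \<le> ennreal (real_of_rat e)})"
  "farr (precongruence pr M) (Level e) Base Lam = (\<lambda>z\<in>pts (fobj (precongruence pr M) (Level e)). fst (inv pr z))"
  "farr (precongruence pr M) (Level e) Base Rho = (\<lambda>z\<in>pts (fobj (precongruence pr M) (Level e)). snd (inv pr z))"
  by (simp_all add: precongruence_def)

text \<open>Preservation is applied to the canonical colimit \<open>M\<close>, whose unit at
  \<open>Base\<close> is the identity of the points, regarded as a morphism from the discrete space
  to \<open>M\<close>.\<close>

lemma precongruence_image_colimit:
  assumes pres: "preserves_precongruence_colimits pr V F" and M: "M \<in> V"
  obtains \<nu> where "colimit_cocone V pc_cat (comp_fun F (precongruence pr M)) pc_weight (fobj F M) \<nu>"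
    "\<nu> Base Zero = farr F (discrete (pts M)) M (\<lambda>x\<in>pts M. x)"
proof -
  have "wcolimit V pc_cat (precongruence pr M) pc_weight M (precongruence_psi pr M)"
    by (rule wcolimit_precongruence[OF M _ inj_pr]) (rule spacesD)
  then have "preserves_wcolimit V F pc_cat (precongruence pr M) pc_weight M (precongruence_psi pr M)"
    using pres M unfolding preserves_precongruence_colimits_def by blast
  then have *: "colimit_cocone V pc_cat (comp_fun F (precongruence pr M)) pc_weight (fobj F M)
      (image_cocone F pc_cat (precongruence pr M) pc_weight M (wcolimit_unit M (precongruence_psi pr M)))"
    unfolding preserves_wcolimit_iff[OF F_functor functor_precongruence[OF M] weight_pc] .
  have "wcolimit_unit M (precongruence_psi pr M) Base Zero = (\<lambda>x\<in>pts M. x)"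
    by (auto simp: wcolimit_unit_def precongruence_psi_def precongruence_unit_def pc_cat_def compose_def)
  then show thesis
    by (intro that[OF *]) (simp add: image_cocone_def pc_cat_def pc_weight_def)
qed

lemma incl_in_homs: "M \<in> V \<Longrightarrow> (\<lambda>x\<in>pts M. x) \<in> homs (discrete (pts M)) M"
  by (rule restrict_in_homs_discrete[OF spacesD(1)]) auto

text \<open>For \<open>S\<close> the coded relation of level \<open>e\<close> and its two
  projections, \<open>le\<close> is the cocone condition. It is asked for all small \<open>S\<close>
  and all close pairs of maps because a locally nonexpanding functor provides the bound in that
  form.\<close>

lemma extend_along_precongruence:
  assumes pres: "preserves_precongruence_colimits pr V F" and M: "M \<in> V" and X: "X \<in> V"
    and u: "u \<in> homs (fobj F (discrete (pts M))) X"
    and le: "\<And>S f f' e z. small U S \<Longrightarrow> f \<in> S \<rightarrow>\<^sub>E pts M \<Longrightarrow> f' \<in> S \<rightarrow>\<^sub>E pts M \<Longrightarrow>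
      (\<And>s. s \<in> S \<Longrightarrow> ed M (f s) (f' s) \<le> e) \<Longrightarrow> z \<in> pts (fobj F (discrete S)) \<Longrightarrow>
      ed X (u (farr F (discrete S) (discrete (pts M)) f z)) (u (farr F (discrete S) (discrete (pts M)) f' z)) \<le> e"
  shows "\<exists>g\<in>homs (fobj F M) X. \<forall>z\<in>pts (fobj F (discrete (pts M))).
    g (farr F (discrete (pts M)) M (\<lambda>x\<in>pts M. x) z) = u z"
proof -
  let ?D = "comp_fun F (precongruence pr M)"
  obtain \<nu> where \<nu>: "colimit_cocone V pc_cat ?D pc_weight (fobj F M) \<nu>"
    "\<nu> Base Zero = farr F (discrete (pts M)) M (\<lambda>x\<in>pts M. x)"
    by (rule precongruence_image_colimit[OF pres M])
  have D: "enriched_functor pc_cat (met_cat V) ?D"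
    by (rule enriched_functor_comp_fun[OF F_functor functor_precongruence[OF M]])
  have "\<exists>f\<in>homs (fobj F M) X. \<forall>z\<in>pts (fobj ?D Base). f (\<nu> Base Zero z) = u z"
  proof (rule pc_colimit_factor[OF \<nu>(1) D X spacesD(1)[OF X]])
    fix e z assume e: "(0 :: rat) < e" and z: "z \<in> pts (fobj ?D (Level e))"
    let ?S = "pr ` {(x, y). x \<in> pts M \<and> y \<in> pts M \<and> ed M x y \<le> ennreal (real_of_rat e)}"
    have "small U (pts (fobj (precongruence pr M) (Level e)))"
      by (intro spacesD(2)[of _ U b] functor_obj[OF functor_precongruence[OF M]] pc_obj_in e)
    then have S: "small U ?S" by simp
    have "ed X (u (farr F (discrete ?S) (discrete (pts M)) (\<lambda>z\<in>?S. fst (inv pr z)) z))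
      (u (farr F (discrete ?S) (discrete (pts M)) (\<lambda>z\<in>?S. snd (inv pr z)) z)) \<le> ennreal (real_of_rat e)"
      by (rule le[OF S]) (use z inj_pr in auto)
    then show "ed X (u (farr ?D (Level e) Base Lam z)) (u (farr ?D (Level e) Base Rho z)) \<le> ennreal (real_of_rat e)"
      by simp
  qed (use u in simp)
  then show ?thesis by (simp add: \<nu>(2))
qed

lemma precongruence_extension_unique:
  assumes pres: "preserves_precongruence_colimits pr V F" and M: "M \<in> V" and X: "X \<in> V"
    and f: "f \<in> homs (fobj F M) X" "g \<in> homs (fobj F M) X"
    and eq: "\<And>z. z \<in> pts (fobj F (discrete (pts M))) \<Longrightarrow>
      f (farr F (discrete (pts M)) M (\<lambda>x\<in>pts M. x) z) = g (farr F (discrete (pts M)) M (\<lambda>x\<in>pts M. x) z)"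
  shows "f = g"
proof -
  obtain \<nu> where \<nu>: "colimit_cocone V pc_cat (comp_fun F (precongruence pr M)) pc_weight (fobj F M) \<nu>"
    "\<nu> Base Zero = farr F (discrete (pts M)) M (\<lambda>x\<in>pts M. x)"
    by (rule precongruence_image_colimit[OF pres M])
  show ?thesis
    by (rule pc_colimit_unique[OF \<nu>(1) enriched_functor_comp_fun[OF F_functor functor_precongruence[OF M]] X f])
      (simp add: \<nu>(2) eq)
qed

text \<open>The index posets of directed colimits have elements of type \<open>'u\<close>, so finite
  subsets of \<open>A\<close> are coded by an injection \<open>e\<close>; \<open>s\<close> decodes,
  and \<open>r\<close> is inclusion of the decoded sets. Upper bounds are unions.\<close>

lemma finite_subsets_colimit:
  assumes A: "A \<in> U"
  obtains P r D s where "P \<in> U" "directed_poset P r" "enriched_functor (poset_cat P r) (met_cat V) D"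
    "s ` P = {B. finite B \<and> B \<subseteq> A}" "inj_on s P" "r = {(p, q). p \<in> P \<and> q \<in> P \<and> s p \<subseteq> s q}"
    "\<forall>p. fobj D p = discrete (s p)" "\<forall>p q u. farr D p q u = (\<lambda>x\<in>s p. x)"
    "colimit_cocone V (poset_cat P r) D conical_weight (discrete A) (\<lambda>p\<in>P. \<lambda>u. \<lambda>x\<in>s p. x)"
proof -
  let ?Fin = "{B. finite B \<and> B \<subseteq> A}"
  obtain e :: "'u set \<Rightarrow> 'u" where e: "inj_on e ?Fin" "e ` ?Fin \<in> U"
    using small_inj_on[OF small_finite_subsets[OF iffD2[OF small_iff_in A]]] by blast
  define P where "P = e ` ?Fin"
  define s where "s = inv_into ?Fin e"
  define r where "r = {(p, q). p \<in> P \<and> q \<in> P \<and> s p \<subseteq> s q}"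
  define D :: "('u, unit, 'u emet, 'u \<Rightarrow> 'u) efun"
    where "D = \<lparr>fobj = (\<lambda>p. discrete (s p)), farr = (\<lambda>p q u. \<lambda>x\<in>s p. x)\<rparr>"
  have se: "s (e B) = B" if "finite B" "B \<subseteq> A" for B
    using e(1) that by (simp add: s_def)
  have sP: "s ` P = ?Fin" using se by (auto simp: P_def image_image)
  have fin: "finite (s p)" "s p \<subseteq> A" if "p \<in> P" for p using sP that by blast+
  have inj: "inj_on s P" using e(1) by (auto simp: P_def s_def intro: inj_on_inv_into)
  have po: "partial_order_on P r"
  proof -
    have "antisym r" using inj by (auto intro!: antisymI simp: r_def dest: inj_onD)
    moreover have "trans r" by (auto intro!: transI simp: r_def)
    moreover have "refl_on P r" by (auto simp: r_def refl_on_def)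
    moreover have "r \<subseteq> P \<times> P" by (auto simp: r_def)
    ultimately show ?thesis by (simp add: order_on_defs)
  qed
  have dir: "directed_poset P r"
    unfolding directed_poset_def
  proof (intro conjI ballI po)
    show "P \<noteq> {}" by (auto simp: P_def)
    fix p q assume pq: "p \<in> P" "q \<in> P"
    have "e (s p \<union> s q) \<in> P" "s (e (s p \<union> s q)) = s p \<union> s q"
      using fin[OF pq(1)] fin[OF pq(2)] by (auto simp: P_def se)
    then show "\<exists>z\<in>P. (p, z) \<in> r \<and> (q, z) \<in> r" using pq by (auto simp: r_def)
  qed
  have sm: "small U (s p)" if "p \<in> P" for p using fin(1)[OF that] by (rule small_finite)
  have D: "enriched_functor (poset_cat P r) (met_cat V) D"
    unfolding enriched_functor_def
  proof (intro conjI ballI enriched_category_poset[OF po] enriched_category_met_cat)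
    fix p q assume pq: "p \<in> Obj (poset_cat P r)" "q \<in> Obj (poset_cat P r)"
    show "nonexpanding (Hom (poset_cat P r) p q) (Hom (met_cat V) (fobj D p) (fobj D q)) (farr D p q)"
    proof -
      have "(\<lambda>x\<in>s p. x) \<in> s p \<rightarrow>\<^sub>E s q" if "(p, q) \<in> r" using that by (auto simp: r_def)
      moreover have "ed (hom_space (discrete (s p)) (discrete (s q))) f f = 0" if "(p, q) \<in> r" "f \<in> s p \<rightarrow>\<^sub>E s q" for f
        using that ext_metric_refl[OF ext_metric_hom_space[OF ext_metric_discrete ext_metric_discrete]]
        by (metis homs_discrete ext_metric_discrete pts_discrete)
      ultimately show ?thesis
        by (simp add: nonexpanding_def D_def poset_cat_def homs_discrete ext_metric_discrete)
    qed
  next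
    fix p q t f g assume "f \<in> pts (Hom (poset_cat P r) p q)" "g \<in> pts (Hom (poset_cat P r) q t)"
    then have "s p \<subseteq> s q" by (auto simp: poset_cat_def r_def split: if_splits)
    then show "farr D p t (Comp (poset_cat P r) p q t g f)
        = Comp (met_cat V) (fobj D p) (fobj D q) (fobj D t) (farr D q t g) (farr D p q f)"
      by (auto simp: D_def met_cat_def compose_def fun_eq_iff)
  qed (auto simp: D_def met_cat_def poset_cat_def sm discrete_in spacesD)
  let ?\<nu> = "\<lambda>p\<in>P. \<lambda>u :: unit. \<lambda>x\<in>s p. x"
  have "colimit_cocone V (poset_cat P r) D conical_weight (discrete A) ?\<nu>"
    unfolding colimit_cocone_def
  proof (intro conjI ballI)
    show "discrete A \<in> V" using A small_iff_in by (blast intro: discrete_in)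
    show "?\<nu> \<in> cocones (poset_cat P r) D conical_weight (discrete A)"
      using fin(2) by (intro conical_coconesI ext_metric_discrete)
        (auto simp: D_def homs_discrete ext_metric_discrete r_def)
    fix X \<tau> assume X: "X \<in> V" and \<tau>: "\<tau> \<in> cocones (poset_cat P r) D conical_weight X"
    have Xm: "ext_metric X" using X by (rule spacesD)
    have \<tau>p: "\<tau> p () \<in> s p \<rightarrow>\<^sub>E pts X" if "p \<in> P" for p
      using coconesD(3)[OF \<tau>, of p "()"] that
      by (simp add: poset_cat_def conical_weight_def D_def homs_discrete Xm)
    have \<tau>_eq: "\<tau> q () x = \<tau> p () x" if "(p, q) \<in> r" "x \<in> s p" for p q x
    proof -
      have "compose (pts (fobj D p)) (\<tau> q ()) (farr D p q ()) = \<tau> p (farr conical_weight q p () ())"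
        using that(1) by (intro coconesD(5)[OF \<tau>]) (auto simp: poset_cat_def r_def conical_weight_def)
      from fun_cong[OF this, of x] that(2) show ?thesis by (simp add: D_def compose_app)
    qed
    have enc: "e {a} \<in> P" "s (e {a}) = {a}" if "a \<in> A" for a
      using that by (auto simp: P_def se)
    have \<tau>_enc: "\<tau> p () x = \<tau> (e {x}) () x" if "p \<in> P" "x \<in> s p" for p x
    proof -
      have "x \<in> A" using fin(2)[OF that(1)] that(2) by blast
      then show ?thesis using \<tau>_eq[of "e {x}" p x] enc[of x] that by (simp add: r_def)
    qed
    \<comment> \<open>A map on \<open>A\<close> is read off at the codes of the singletons;
      compatibility of \<open>\<tau>\<close> makes it agree with the value on every finite
      subset.\<close>
    let ?f = "\<lambda>a\<in>A. \<tau> (e {a}) () a"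
    have f: "?f \<in> homs (discrete A) X"
      using \<tau>p enc unfolding homs_discrete[OF Xm] by fastforce
    show "\<exists>!f. f \<in> homs (discrete A) X \<and>
      (\<forall>d\<in>Obj (poset_cat P r). \<forall>w\<in>pts (fobj conical_weight d). compose (pts (fobj D d)) f (?\<nu> d w) = \<tau> d w)"
    proof (intro ex1I[of _ ?f] conjI ballI f)
      fix p and w :: unit assume "p \<in> Obj (poset_cat P r)"
      then have p: "p \<in> P" by (simp add: poset_cat_def)
      show "compose (pts (fobj D p)) ?f (?\<nu> p w) = \<tau> p w"
      proof (rule extensionalityI[OF compose_extensional])
        show "\<tau> p w \<in> extensional (pts (fobj D p))" using \<tau>p[OF p] by (simp add: D_def PiE_iff)
        fix x assume "x \<in> pts (fobj D p)"
        then have x: "x \<in> s p" by (simp add: D_def)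
        then show "compose (pts (fobj D p)) ?f (?\<nu> p w) x = \<tau> p w x"
          using \<tau>_enc[OF p x] fin(2)[OF p] p by (auto simp: D_def compose_app)
      qed
    next
      fix g assume g: "g \<in> homs (discrete A) X \<and>
        (\<forall>d\<in>Obj (poset_cat P r). \<forall>w\<in>pts (fobj conical_weight d). compose (pts (fobj D d)) g (?\<nu> d w) = \<tau> d w)"
      show "g = ?f"
      proof (rule hom_eqI[OF conjunct1[OF g] f])
        fix a assume "a \<in> pts (discrete A)"
        then have a: "a \<in> A" by simp
        have "compose (pts (fobj D (e {a}))) g (?\<nu> (e {a}) ()) = \<tau> (e {a}) ()"
          using g enc(1)[OF a] by (simp add: poset_cat_def conical_weight_def)
        from fun_cong[OF this, of a] show "g a = ?f a"
          using enc[OF a] a by (simp add: D_def compose_app)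
      qed
    qed
  qed
  then show thesis
    by (intro that[of P r D s] dir D sP inj) (use e(2) in \<open>simp_all add: P_def r_def D_def\<close>)
qed

end

context met_endofunctor
begin

lemma finite_subsets_image_colimit:
  assumes pres: "preserves_directed_colimits U V F" and A: "A \<in> U"
  obtains P r and D :: "('u, unit, 'u emet, 'u \<Rightarrow> 'u) efun" and s where "enriched_functor (poset_cat P r) (met_cat V) (comp_fun F D)"
    "s ` P = {B. finite B \<and> B \<subseteq> A}" "r = {(p, q). p \<in> P \<and> q \<in> P \<and> s p \<subseteq> s q}"
    "\<forall>p. fobj D p = discrete (s p)" "\<forall>p q u. farr D p q u = (\<lambda>x\<in>s p. x)"
    "colimit_cocone V (poset_cat P r) (comp_fun F D) conical_weight (fobj F (discrete A))
      (\<lambda>p\<in>P. \<lambda>u. farr F (discrete (s p)) (discrete A) (\<lambda>x\<in>s p. x))"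
proof -
  obtain P r and D :: "('u, unit, 'u emet, 'u \<Rightarrow> 'u) efun" and s where *: "P \<in> U" "directed_poset P r" "enriched_functor (poset_cat P r) (met_cat V) D"
    and sP: "s ` P = {B. finite B \<and> B \<subseteq> A}" and "inj_on s P" and r: "r = {(p, q). p \<in> P \<and> q \<in> P \<and> s p \<subseteq> s q}"
    and D: "\<forall>p. fobj D p = discrete (s p)" "\<forall>p q u. farr D p q u = (\<lambda>x\<in>s p. x)"
    and colim: "colimit_cocone V (poset_cat P r) D conical_weight (discrete A) (\<lambda>p\<in>P. \<lambda>u. \<lambda>x\<in>s p. x)"
    by (rule finite_subsets_colimit[OF A])
  obtain \<psi> where \<psi>: "wcolimit V (poset_cat P r) D conical_weight (discrete A) \<psi>"
    "wcolimit_unit (discrete A) \<psi> = (\<lambda>p\<in>P. \<lambda>u. \<lambda>x\<in>s p. x)"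
    by (rule colimit_cocone_imp_wcolimit[OF colim *(3) weight_conical])
  have "preserves_wcolimit V F (poset_cat P r) D conical_weight (discrete A) \<psi>"
    using pres * \<psi>(1) unfolding preserves_directed_colimits_def by blast
  then have "colimit_cocone V (poset_cat P r) (comp_fun F D) conical_weight (fobj F (discrete A))
      (image_cocone F (poset_cat P r) D conical_weight (discrete A) (\<lambda>p\<in>P. \<lambda>u. \<lambda>x\<in>s p. x))"
    unfolding preserves_wcolimit_iff[OF F_functor *(3) weight_conical] \<psi>(2) .
  moreover have "image_cocone F (poset_cat P r) D conical_weight (discrete A) (\<lambda>p\<in>P. \<lambda>u. \<lambda>x\<in>s p. x)
      = (\<lambda>p\<in>P. \<lambda>u. farr F (discrete (s p)) (discrete A) (\<lambda>x\<in>s p. x))"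
    by (rule ext) (auto simp: image_cocone_def poset_cat_def conical_weight_def D(1) restrict_def)
  ultimately show thesis
    using that[OF enriched_functor_comp_fun[OF F_functor *(3)] sP r D] by simp
qed

text \<open>The index codes disappear here: compatible families are indexed by the finite subsets
  themselves.\<close>

lemma extend_from_finite_subsets:
  assumes pres: "preserves_directed_colimits U V F" and A: "A \<in> U" and X: "X \<in> V"
    and v: "\<And>B. finite B \<Longrightarrow> B \<subseteq> A \<Longrightarrow> v B \<in> homs (fobj F (discrete B)) X"
    and eq: "\<And>B B' z. finite B' \<Longrightarrow> B \<subseteq> B' \<Longrightarrow> B' \<subseteq> A \<Longrightarrow> z \<in> pts (fobj F (discrete B)) \<Longrightarrow>
      v B' (farr F (discrete B) (discrete B') (\<lambda>x\<in>B. x) z) = v B z"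
  shows "\<exists>g\<in>homs (fobj F (discrete A)) X. \<forall>B. finite B \<and> B \<subseteq> A \<longrightarrow>
    (\<forall>z\<in>pts (fobj F (discrete B)). g (farr F (discrete B) (discrete A) (\<lambda>x\<in>B. x) z) = v B z)"
proof -
  obtain P r and D :: "('u, unit, 'u emet, 'u \<Rightarrow> 'u) efun" and s where D: "enriched_functor (poset_cat P r) (met_cat V) (comp_fun F D)"
    and s: "s ` P = {B. finite B \<and> B \<subseteq> A}" and r: "r = {(p, q). p \<in> P \<and> q \<in> P \<and> s p \<subseteq> s q}"
    and [simp]: "\<forall>p. fobj D p = discrete (s p)" "\<forall>p q u. farr D p q u = (\<lambda>x\<in>s p. x)"
    and colim: "colimit_cocone V (poset_cat P r) (comp_fun F D) conical_weight (fobj F (discrete A))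
      (\<lambda>p\<in>P. \<lambda>u. farr F (discrete (s p)) (discrete A) (\<lambda>x\<in>s p. x))"
    by (rule finite_subsets_image_colimit[OF pres A])
  have fin: "finite (s p)" "s p \<subseteq> A" if "p \<in> P" for p using s that by blast+
  have "(\<lambda>p\<in>P. \<lambda>u. v (s p)) \<in> cocones (poset_cat P r) (comp_fun F D) conical_weight X"
  proof (rule conical_coconesI[OF spacesD(1)[OF X]])
    fix p q assume "p \<in> P" "q \<in> P" "(p, q) \<in> r"
    then show "farr (comp_fun F D) p q () \<in> homs (fobj (comp_fun F D) p) (fobj (comp_fun F D) q)"
      by (intro functor_hom[OF D]) (simp_all add: poset_cat_def)
  qed (use v eq fin in \<open>auto simp: r\<close>)
  from colimit_cocone_factor[OF colim X this] obtain g where g: "g \<in> homs (fobj F (discrete A)) X"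
    "\<And>p z. p \<in> P \<Longrightarrow> z \<in> pts (fobj F (discrete (s p))) \<Longrightarrow> g (farr F (discrete (s p)) (discrete A) (\<lambda>x\<in>s p. x) z) = v (s p) z"
    by (auto simp: poset_cat_def conical_weight_def)
  have "g (farr F (discrete B) (discrete A) (\<lambda>x\<in>B. x) z) = v B z"
    if "finite B" "B \<subseteq> A" "z \<in> pts (fobj F (discrete B))" for B z
  proof -
    obtain p where "p \<in> P" "B = s p" using s \<open>finite B\<close> \<open>B \<subseteq> A\<close> by blast
    then show ?thesis using g(2) that(3) by simp
  qed
  then show ?thesis using g(1) by blast
qed

lemma finite_subsets_extension_unique:
  assumes pres: "preserves_directed_colimits U V F" and A: "A \<in> U" and X: "X \<in> V"
    and f: "f \<in> homs (fobj F (discrete A)) X" "g \<in> homs (fobj F (discrete A)) X"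
    and eq: "\<And>B z. finite B \<Longrightarrow> B \<subseteq> A \<Longrightarrow> z \<in> pts (fobj F (discrete B)) \<Longrightarrow>
      f (farr F (discrete B) (discrete A) (\<lambda>x\<in>B. x) z) = g (farr F (discrete B) (discrete A) (\<lambda>x\<in>B. x) z)"
  shows "f = g"
proof -
  obtain P r and D :: "('u, unit, 'u emet, 'u \<Rightarrow> 'u) efun" and s where D: "enriched_functor (poset_cat P r) (met_cat V) (comp_fun F D)"
    and s: "s ` P = {B. finite B \<and> B \<subseteq> A}" and "r = {(p, q). p \<in> P \<and> q \<in> P \<and> s p \<subseteq> s q}"
    and [simp]: "\<forall>p. fobj D p = discrete (s p)" "\<forall>p q u. farr D p q u = (\<lambda>x\<in>s p. x)"
    and colim: "colimit_cocone V (poset_cat P r) (comp_fun F D) conical_weight (fobj F (discrete A))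
      (\<lambda>p\<in>P. \<lambda>u. farr F (discrete (s p)) (discrete A) (\<lambda>x\<in>s p. x))"
    by (rule finite_subsets_image_colimit[OF pres A])
  have fin: "finite (s p)" "s p \<subseteq> A" if "p \<in> P" for p using s that by blast+
  show ?thesis
    by (rule colimit_cocone_unique[OF colim D weight_conical X f]) (simp add: poset_cat_def eq fin)
qed

text \<open>By preservation, the images under \<open>F\<close> of the inclusions of finite subsets
  are jointly epic, and so is the image of the map from the discrete space of points to
  \<open>M\<close>. Naturality at these maps spreads the agreement.\<close>

lemma nat_transformations_agree:
  assumes dir: "preserves_directed_colimits U V F" and pc: "preserves_precongruence_colimits pr V F"
    and G: "enriched_functor (met_cat V) (met_cat V) G"
    and \<alpha>: "\<alpha> \<in> pts (nat_space (met_cat V) F G)" and \<beta>: "\<beta> \<in> pts (nat_space (met_cat V) F G)"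
    and eq: "\<And>A. finite A \<Longrightarrow> \<alpha> (discrete A) = \<beta> (discrete A)"
  shows "\<alpha> = \<beta>"
proof -
  have h: "\<alpha> X \<in> homs (fobj F X) (fobj G X)" "\<beta> X \<in> homs (fobj F X) (fobj G X)" if "X \<in> V" for X
    using \<alpha> \<beta> that unfolding nat_space_iff by auto
  have n: "farr G X Y f (\<alpha> X z) = \<alpha> Y (farr F X Y f z)" "farr G X Y f (\<beta> X z) = \<beta> Y (farr F X Y f z)"
    if "X \<in> V" "Y \<in> V" "f \<in> homs X Y" "z \<in> pts (fobj F X)" for X Y f z
    using \<alpha> \<beta> that unfolding nat_space_iff by auto
  have d: "\<alpha> (discrete A) = \<beta> (discrete A)" if A: "A \<in> U" for A
  proof (rule finite_subsets_extension_unique[OF dir A])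
    have AV: "discrete A \<in> V" using A small_iff_in discrete_in by blast
    then show "fobj G (discrete A) \<in> V" "\<alpha> (discrete A) \<in> homs (fobj F (discrete A)) (fobj G (discrete A))"
      "\<beta> (discrete A) \<in> homs (fobj F (discrete A)) (fobj G (discrete A))"
      by (rule met_functor_obj[OF G] h)+
    fix B z assume B: "finite B" "B \<subseteq> A" "z \<in> pts (fobj F (discrete B))"
    then have "discrete B \<in> V" by (blast intro: discrete_in small_finite)
    moreover have "(\<lambda>x\<in>B. x) \<in> homs (discrete B) (discrete A)"
      using B(2) by (auto intro!: restrict_in_homs_discrete ext_metric_discrete)
    ultimately show "\<alpha> (discrete A) (farr F (discrete B) (discrete A) (\<lambda>x\<in>B. x) z) =
        \<beta> (discrete A) (farr F (discrete B) (discrete A) (\<lambda>x\<in>B. x) z)"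
      using n[OF _ AV _ B(3)] eq[OF B(1)] by metis
  qed
  have "\<alpha> M = \<beta> M" if M: "M \<in> V" for M
  proof (rule precongruence_extension_unique[OF pc M met_functor_obj[OF G M] h[OF M]])
    fix z assume z: "z \<in> pts (fobj F (discrete (pts M)))"
    have "pts M \<in> U" using spacesD(2)[OF M] small_iff_in by blast
    moreover have "discrete (pts M) \<in> V" using discrete_in[OF spacesD(2)[OF M]] .
    ultimately show "\<alpha> M (farr F (discrete (pts M)) M (\<lambda>x\<in>pts M. x) z) = \<beta> M (farr F (discrete (pts M)) M (\<lambda>x\<in>pts M. x) z)"
      using n[OF _ M incl_in_homs[OF M] z] d by metis
  qed
  moreover have "\<alpha> \<in> extensional V" "\<beta> \<in> extensional V" using \<alpha> \<beta> by (auto simp: nat_space_iff)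
  ultimately show ?thesis by (rule extensionalityI[rotated 2])
qed

lemma strongly_finitary_if_preserves:
  assumes dir: "preserves_directed_colimits U V F" and pc: "preserves_precongruence_colimits pr V F"
  shows "strongly_finitary V F"
  unfolding strongly_finitary_def
proof (intro allI impI ballI)
  fix G \<sigma> assume G: "enriched_functor (met_cat V) (met_cat V) G"
    and \<sigma>: "\<sigma> \<in> pts (nat_space fin_cat (comp_fun F K_fun) (comp_fun G K_fun))"
  note Fc = met_functor_comp_app[OF F_functor] and Gc = met_functor_comp_app[OF G]
    and Fin = met_functor_in[OF F_functor]
  have \<sigma>h: "\<sigma> A \<in> homs (fobj F (discrete A)) (fobj G (discrete A))" if "finite A" for A
    using \<sigma> that by (simp add: nat_space_iff)
  have \<sigma>n: "farr G (discrete A) (discrete B) f (\<sigma> A z) = \<sigma> B (farr F (discrete A) (discrete B) f z)"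
    if "finite A" "finite B" "f \<in> A \<rightarrow>\<^sub>E B" "z \<in> pts (fobj F (discrete A))" for A B f z
    using \<sigma> that by (simp add: nat_space_iff)
  have dh: "f \<in> homs (discrete A) (discrete B)" if "f \<in> A \<rightarrow>\<^sub>E B" for A B and f :: "'u \<Rightarrow> 'u"
    using that by (simp add: homs_discrete ext_metric_discrete)
  have dU: "discrete A \<in> V" if "A \<in> U" for A using that small_iff_in discrete_in by blast
  have df: "discrete A \<in> V" if "finite A" for A using that small_finite discrete_in by blast
  \<comment> \<open>The prescribed value on a finite subset \<open>B\<close> is
    \<open>\<sigma> B\<close> followed by \<open>G\<close> of its inclusion; naturality of
    \<open>\<sigma>\<close> makes these values compatible.\<close>
  have "\<exists>g\<in>homs (fobj F (discrete A)) (fobj G (discrete A)). \<forall>B. finite B \<and> B \<subseteq> A \<longrightarrow>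
    (\<forall>z\<in>pts (fobj F (discrete B)). g (farr F (discrete B) (discrete A) (\<lambda>x\<in>B. x) z)
      = compose (pts (fobj F (discrete B))) (farr G (discrete B) (discrete A) (\<lambda>x\<in>B. x)) (\<sigma> B) z)" if A: "A \<in> U" for A
  proof (rule extend_from_finite_subsets[OF dir A met_functor_obj[OF G dU[OF A]]])
    fix B assume B: "finite B" "B \<subseteq> A"
    then have "(\<lambda>x\<in>B. x) \<in> homs (discrete B) (discrete A)" by (intro dh) auto
    then show "compose (pts (fobj F (discrete B))) (farr G (discrete B) (discrete A) (\<lambda>x\<in>B. x)) (\<sigma> B)
        \<in> homs (fobj F (discrete B)) (fobj G (discrete A))"
      by (intro hom_space_compose[OF \<sigma>h[OF B(1)]] met_functor_hom[OF G df[OF B(1)] dU[OF A]])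
  next
    fix B B' z assume B: "finite B'" "B \<subseteq> B'" "B' \<subseteq> A" and z: "z \<in> pts (fobj F (discrete B))"
    then have fB: "finite B" by (blast intro: finite_subset)
    have i: "(\<lambda>x\<in>B. x) \<in> B \<rightarrow>\<^sub>E B'" "(\<lambda>x\<in>B'. x) \<in> B' \<rightarrow>\<^sub>E A" using B by auto
    have c: "compose B (\<lambda>x\<in>B'. x) (\<lambda>x\<in>B. x) = (\<lambda>x\<in>B. x)" using B by (auto simp: compose_def fun_eq_iff)
    have "farr G (discrete B') (discrete A) (\<lambda>x\<in>B'. x) (\<sigma> B' (farr F (discrete B) (discrete B') (\<lambda>x\<in>B. x) z))
       = farr G (discrete B') (discrete A) (\<lambda>x\<in>B'. x) (farr G (discrete B) (discrete B') (\<lambda>x\<in>B. x) (\<sigma> B z))"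
      using \<sigma>n[OF fB B(1) i(1) z] by simp
    also have "\<dots> = farr G (discrete B) (discrete A) (\<lambda>x\<in>B. x) (\<sigma> B z)"
      using Gc[OF df[OF fB] df[OF B(1)] dU[OF A] dh[OF i(1)] dh[OF i(2)] hom_in[OF \<sigma>h[OF fB] z]] c by simp
    finally show "compose (pts (fobj F (discrete B'))) (farr G (discrete B') (discrete A) (\<lambda>x\<in>B'. x)) (\<sigma> B')
        (farr F (discrete B) (discrete B') (\<lambda>x\<in>B. x) z)
      = compose (pts (fobj F (discrete B))) (farr G (discrete B) (discrete A) (\<lambda>x\<in>B. x)) (\<sigma> B) z"
      using Fin[OF df[OF fB] df[OF B(1)] dh[OF i(1)] z] z by (simp add: compose_app)
  qed
  then have "\<forall>A\<in>U. \<exists>g\<in>homs (fobj F (discrete A)) (fobj G (discrete A)). \<forall>B. finite B \<and> B \<subseteq> A \<longrightarrow>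
    (\<forall>z\<in>pts (fobj F (discrete B)). g (farr F (discrete B) (discrete A) (\<lambda>x\<in>B. x) z)
      = farr G (discrete B) (discrete A) (\<lambda>x\<in>B. x) (\<sigma> B z))"
    by (simp add: compose_app)
  from bchoice[OF this[unfolded Bex_def]] obtain \<sigma>1 where
    s1: "\<forall>A\<in>U. \<sigma>1 A \<in> homs (fobj F (discrete A)) (fobj G (discrete A)) \<and> (\<forall>B. finite B \<and> B \<subseteq> A \<longrightarrow>
      (\<forall>z\<in>pts (fobj F (discrete B)). \<sigma>1 A (farr F (discrete B) (discrete A) (\<lambda>x\<in>B. x) z)
        = farr G (discrete B) (discrete A) (\<lambda>x\<in>B. x) (\<sigma> B z)))" ..
  have \<sigma>1: "\<sigma>1 A \<in> homs (fobj F (discrete A)) (fobj G (discrete A))" if "A \<in> U" for A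
    using bspec[OF s1 that] ..
  have \<sigma>1_fin: "\<sigma>1 A (farr F (discrete B) (discrete A) (\<lambda>x\<in>B. x) z) = farr G (discrete B) (discrete A) (\<lambda>x\<in>B. x) (\<sigma> B z)"
    if "A \<in> U" "finite B" "B \<subseteq> A" "z \<in> pts (fobj F (discrete B))" for A B z
    using conjunct2[OF bspec[OF s1 that(1)], rule_format, OF conjI[OF that(2,3)] that(4)] .
  have \<sigma>1_nat: "farr G (discrete A) (discrete A') a (\<sigma>1 A z) = \<sigma>1 A' (farr F (discrete A) (discrete A') a z)"
    if A: "A \<in> U" "A' \<in> U" and a: "a \<in> A \<rightarrow>\<^sub>E A'" and z: "z \<in> pts (fobj F (discrete A))" for A A' a z
  proof -
    note V = dU[OF A(1)] dU[OF A(2)]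
    have "compose (pts (fobj F (discrete A))) (farr G (discrete A) (discrete A') a) (\<sigma>1 A)
        = compose (pts (fobj F (discrete A))) (\<sigma>1 A') (farr F (discrete A) (discrete A') a)"
    proof (rule finite_subsets_extension_unique[OF dir A(1) met_functor_obj[OF G V(2)]])
      show "compose (pts (fobj F (discrete A))) (farr G (discrete A) (discrete A') a) (\<sigma>1 A) \<in> homs (fobj F (discrete A)) (fobj G (discrete A'))"
        by (rule hom_space_compose[OF \<sigma>1[OF A(1)] met_functor_hom[OF G V dh[OF a]]])
      show "compose (pts (fobj F (discrete A))) (\<sigma>1 A') (farr F (discrete A) (discrete A') a) \<in> homs (fobj F (discrete A)) (fobj G (discrete A'))"
        by (rule hom_space_compose[OF met_functor_hom[OF F_functor V dh[OF a]] \<sigma>1[OF A(2)]])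
      fix B z assume B: "finite B" "B \<subseteq> A" and z: "z \<in> pts (fobj F (discrete B))"
      \<comment> \<open>The restriction of \<open>a\<close> to \<open>B\<close> factors through its
        finite image, so that naturality of \<open>\<sigma>\<close> applies.\<close>
      let ?B = "a ` B" and ?a = "restrict a B"
      have iB: "(\<lambda>x\<in>B. x) \<in> B \<rightarrow>\<^sub>E A" and ia: "?a \<in> B \<rightarrow>\<^sub>E ?B" and iB': "(\<lambda>x\<in>?B. x) \<in> ?B \<rightarrow>\<^sub>E A'" and fB': "finite ?B" "?B \<subseteq> A'"
        using B a by (auto simp: PiE_iff)
      have c: "compose B a (\<lambda>x\<in>B. x) = compose B (\<lambda>x\<in>?B. x) ?a"
        by (auto simp: compose_def fun_eq_iff)
      note VB = df[OF B(1)] df[OF fB'(1)]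
      have "farr G (discrete A) (discrete A') a (\<sigma>1 A (farr F (discrete B) (discrete A) (\<lambda>x\<in>B. x) z))
         = farr G (discrete A) (discrete A') a (farr G (discrete B) (discrete A) (\<lambda>x\<in>B. x) (\<sigma> B z))"
        using \<sigma>1_fin[OF A(1) B z] by simp
      also have "\<dots> = farr G (discrete ?B) (discrete A') (\<lambda>x\<in>?B. x) (farr G (discrete B) (discrete ?B) ?a (\<sigma> B z))"
        using Gc[OF VB(1) V dh[OF iB] dh[OF a] hom_in[OF \<sigma>h[OF B(1)] z]]
          Gc[OF VB V(2) dh[OF ia] dh[OF iB'] hom_in[OF \<sigma>h[OF B(1)] z]] c by simp
      also have "\<dots> = farr G (discrete ?B) (discrete A') (\<lambda>x\<in>?B. x) (\<sigma> ?B (farr F (discrete B) (discrete ?B) ?a z))"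
        using \<sigma>n[OF B(1) fB'(1) ia z] by simp
      also have "\<dots> = \<sigma>1 A' (farr F (discrete ?B) (discrete A') (\<lambda>x\<in>?B. x) (farr F (discrete B) (discrete ?B) ?a z))"
        by (rule \<sigma>1_fin[symmetric, OF A(2) fB' Fin[OF VB dh[OF ia] z]])
      also have "\<dots> = \<sigma>1 A' (farr F (discrete A) (discrete A') a (farr F (discrete B) (discrete A) (\<lambda>x\<in>B. x) z))"
        using Fc[OF VB(1) V dh[OF iB] dh[OF a] z] Fc[OF VB V(2) dh[OF ia] dh[OF iB'] z] c by simp
      finally show "compose (pts (fobj F (discrete A))) (farr G (discrete A) (discrete A') a) (\<sigma>1 A) (farr F (discrete B) (discrete A) (\<lambda>x\<in>B. x) z)
        = compose (pts (fobj F (discrete A))) (\<sigma>1 A') (farr F (discrete A) (discrete A') a) (farr F (discrete B) (discrete A) (\<lambda>x\<in>B. x) z)"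
        using Fin[OF VB(1) V(1) dh[OF iB] z] by (simp add: compose_app)
    qed
    from fun_cong[OF this, of z] show ?thesis using z by (simp add: compose_app)
  qed
  let ?K = "\<lambda>M. discrete (pts M)" and ?i = "\<lambda>M. \<lambda>x\<in>pts M. x"
  have KV: "?K M \<in> V" "pts M \<in> U" if "M \<in> V" for M :: "'u emet"
    using spacesD(2)[OF that] small_iff_in discrete_in by blast+
  have "\<exists>g\<in>homs (fobj F M) (fobj G M). \<forall>z\<in>pts (fobj F (?K M)).
      g (farr F (?K M) M (?i M) z) = compose (pts (fobj F (?K M))) (farr G (?K M) M (?i M)) (\<sigma>1 (pts M)) z"
    if M: "M \<in> V" for M
  proof (rule extend_along_precongruence[OF pc M met_functor_obj[OF G M]])
    show "compose (pts (fobj F (?K M))) (farr G (?K M) M (?i M)) (\<sigma>1 (pts M)) \<in> homs (fobj F (?K M)) (fobj G M)"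
      by (rule hom_space_compose[OF \<sigma>1[OF KV(2)[OF M]] met_functor_hom[OF G KV(1)[OF M] M incl_in_homs[OF M]]])
    fix S f f' e z assume S: "small U S" and f: "f \<in> S \<rightarrow>\<^sub>E pts M" "f' \<in> S \<rightarrow>\<^sub>E pts M"
      and le: "\<And>s. s \<in> S \<Longrightarrow> ed M (f s) (f' s) \<le> e" and z: "z \<in> pts (fobj F (discrete S))"
    have SU: "S \<in> U" using S small_iff_in by blast
    \<comment> \<open>Naturality of \<open>\<sigma>1\<close> moves the map \<open>f\<close> from
      \<open>F\<close> to \<open>G\<close>; there the distance of \<open>f\<close> and
      \<open>f'\<close> bounds the result because \<open>G\<close> is locally nonexpanding.\<close>
    have *: "compose (pts (fobj F (?K M))) (farr G (?K M) M (?i M)) (\<sigma>1 (pts M)) (farr F (discrete S) (?K M) f z)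
        = farr G (discrete S) M f (\<sigma>1 S z)" if f: "f \<in> S \<rightarrow>\<^sub>E pts M" for f
    proof -
      have c: "compose S (?i M) f = f" using f by (auto simp: compose_def fun_eq_iff PiE_iff extensional_def)
      have "farr G (?K M) M (?i M) (\<sigma>1 (pts M) (farr F (discrete S) (?K M) f z))
        = farr G (?K M) M (?i M) (farr G (discrete S) (?K M) f (\<sigma>1 S z))"
        using \<sigma>1_nat[OF SU KV(2)[OF M] f z] by simp
      also have "\<dots> = farr G (discrete S) M f (\<sigma>1 S z)"
        using Gc[OF dU[OF SU] KV(1)[OF M] M dh[OF f] incl_in_homs[OF M] hom_in[OF \<sigma>1[OF SU] z]] c by simp
      finally show ?thesis using Fin[OF dU[OF SU] KV(1)[OF M] dh[OF f] z] by (simp add: compose_app)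
    qed
    have fM: "f \<in> homs (discrete S) M" "f' \<in> homs (discrete S) M"
      using f by (simp_all add: homs_discrete spacesD(1)[OF M])
    have "ed (fobj G M) (farr G (discrete S) M f (\<sigma>1 S z)) (farr G (discrete S) M f' (\<sigma>1 S z))
      \<le> ed (hom_space (fobj G (discrete S)) (fobj G M)) (farr G (discrete S) M f) (farr G (discrete S) M f')"
      by (rule hom_ed_ge[OF hom_in[OF \<sigma>1[OF SU] z]])
    also have "\<dots> \<le> ed (hom_space (discrete S) M) f f'"
      by (rule met_functor_le[OF G dU[OF SU] M fM])
    also have "\<dots> \<le> e" using le by (simp add: hom_ed_le_iff)
    finally show "ed (fobj G M)
       (compose (pts (fobj F (?K M))) (farr G (?K M) M (?i M)) (\<sigma>1 (pts M)) (farr F (discrete S) (?K M) f z))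
       (compose (pts (fobj F (?K M))) (farr G (?K M) M (?i M)) (\<sigma>1 (pts M)) (farr F (discrete S) (?K M) f' z)) \<le> e"
      by (simp only: *[OF f(1)] *[OF f(2)])
  qed
  then have "\<forall>M\<in>V. \<exists>g\<in>homs (fobj F M) (fobj G M). \<forall>z\<in>pts (fobj F (?K M)).
      g (farr F (?K M) M (?i M) z) = farr G (?K M) M (?i M) (\<sigma>1 (pts M) z)"
    by (simp add: compose_app)
  from bchoice[OF this[unfolded Bex_def]] obtain \<sigma>2 where
    s2: "\<forall>M\<in>V. \<sigma>2 M \<in> homs (fobj F M) (fobj G M) \<and> (\<forall>z\<in>pts (fobj F (?K M)).
      \<sigma>2 M (farr F (?K M) M (?i M) z) = farr G (?K M) M (?i M) (\<sigma>1 (pts M) z))" ..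
  have \<sigma>2: "\<sigma>2 M \<in> homs (fobj F M) (fobj G M)" if "M \<in> V" for M
    using bspec[OF s2 that] ..
  have \<sigma>2_i: "\<sigma>2 M (farr F (?K M) M (?i M) z) = farr G (?K M) M (?i M) (\<sigma>1 (pts M) z)"
    if "M \<in> V" "z \<in> pts (fobj F (?K M))" for M z
    using bspec[OF conjunct2[OF bspec[OF s2 that(1)]] that(2)] .
  have \<sigma>2_nat: "farr G M N h (\<sigma>2 M z) = \<sigma>2 N (farr F M N h z)"
    if M: "M \<in> V" and N: "N \<in> V" and h: "h \<in> homs M N" and z: "z \<in> pts (fobj F M)" for M N h z
  proof -
    have "compose (pts (fobj F M)) (farr G M N h) (\<sigma>2 M) = compose (pts (fobj F M)) (\<sigma>2 N) (farr F M N h)"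
    proof (rule precongruence_extension_unique[OF pc M met_functor_obj[OF G N]])
      show "compose (pts (fobj F M)) (farr G M N h) (\<sigma>2 M) \<in> homs (fobj F M) (fobj G N)"
        by (rule hom_space_compose[OF \<sigma>2[OF M] met_functor_hom[OF G M N h]])
      show "compose (pts (fobj F M)) (\<sigma>2 N) (farr F M N h) \<in> homs (fobj F M) (fobj G N)"
        by (rule hom_space_compose[OF met_functor_hom[OF F_functor M N h] \<sigma>2[OF N]])
      fix z assume z: "z \<in> pts (fobj F (?K M))"
      have h': "h \<in> pts M \<rightarrow>\<^sub>E pts N" using h by (simp add: hom_space_def)
      have c: "compose (pts M) h (?i M) = compose (pts M) (?i N) h"
        using h' by (auto simp: compose_def fun_eq_iff)
      note KM = KV(1)[OF M] and KN = KV(1)[OF N] and iM = incl_in_homs[OF M] and iN = incl_in_homs[OF N]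
      have s: "\<sigma>1 (pts M) z \<in> pts (fobj G (?K M))" by (rule hom_in[OF \<sigma>1[OF KV(2)[OF M]] z])
      have "farr G M N h (\<sigma>2 M (farr F (?K M) M (?i M) z)) = farr G M N h (farr G (?K M) M (?i M) (\<sigma>1 (pts M) z))"
        using \<sigma>2_i[OF M z] by simp
      also have "\<dots> = farr G (?K N) N (?i N) (farr G (?K M) (?K N) h (\<sigma>1 (pts M) z))"
        using Gc[OF KM M N iM h s] Gc[OF KM KN N dh[OF h'] iN s] c by simp
      also have "\<dots> = farr G (?K N) N (?i N) (\<sigma>1 (pts N) (farr F (?K M) (?K N) h z))"
        using \<sigma>1_nat[OF KV(2)[OF M] KV(2)[OF N] h' z] by simp
      also have "\<dots> = \<sigma>2 N (farr F (?K N) N (?i N) (farr F (?K M) (?K N) h z))"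
        by (rule \<sigma>2_i[symmetric, OF N Fin[OF KM KN dh[OF h'] z]])
      also have "\<dots> = \<sigma>2 N (farr F M N h (farr F (?K M) M (?i M) z))"
        using Fc[OF KM M N iM h z] Fc[OF KM KN N dh[OF h'] iN z] c by simp
      finally show "compose (pts (fobj F M)) (farr G M N h) (\<sigma>2 M) (farr F (?K M) M (?i M) z)
          = compose (pts (fobj F M)) (\<sigma>2 N) (farr F M N h) (farr F (?K M) M (?i M) z)"
        using Fin[OF KM M iM z] by (simp add: compose_app)
    qed
    from fun_cong[OF this, of z] show ?thesis using z by (simp add: compose_app)
  qed
  \<comment> \<open>When \<open>M = discrete A\<close> with \<open>A\<close> finite, the comparison
    maps of both stages are identities, so the extension returns \<open>\<sigma>\<close>.\<close>
  have \<sigma>2_fin: "\<sigma>2 (discrete A) = \<sigma> A" if A: "finite A" for A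
  proof (rule hom_eqI[OF \<sigma>2[OF df[OF A]] \<sigma>h[OF A]])
    fix z assume z: "z \<in> pts (fobj F (discrete A))"
    have AU: "A \<in> U" using small_finite[OF A] small_iff_in by blast
    have i: "farr F (discrete A) (discrete A) (\<lambda>x\<in>A. x) z = z"
      using met_functor_id_app[OF F_functor df[OF A] z] by simp
    have j: "farr G (discrete A) (discrete A) (\<lambda>x\<in>A. x) y = y" if "y \<in> pts (fobj G (discrete A))" for y
      using met_functor_id_app[OF G df[OF A] that] by simp
    have "\<sigma>2 (discrete A) z = farr G (discrete A) (discrete A) (\<lambda>x\<in>A. x) (\<sigma>1 A z)"
      using \<sigma>2_i[OF df[OF A], of z] z i by simp
    also have "\<dots> = \<sigma>1 A z" by (rule j[OF hom_in[OF \<sigma>1[OF AU] z]])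
    also have "\<dots> = farr G (discrete A) (discrete A) (\<lambda>x\<in>A. x) (\<sigma> A z)"
      using \<sigma>1_fin[OF AU A order_refl z] i by simp
    also have "\<dots> = \<sigma> A z" by (rule j[OF hom_in[OF \<sigma>h[OF A] z]])
    finally show "\<sigma>2 (discrete A) z = \<sigma> A z" .
  qed
  show "\<exists>!\<sigma>'. \<sigma>' \<in> pts (nat_space (met_cat V) F G) \<and> (\<forall>A\<in>Obj fin_cat. \<sigma>' (fobj K_fun A) = \<sigma> A)"
  proof (intro ex1I[of _ "restrict \<sigma>2 V"] conjI ballI)
    show "restrict \<sigma>2 V \<in> pts (nat_space (met_cat V) F G)"
      using \<sigma>2 \<sigma>2_nat by (simp add: nat_space_iff)
    show "restrict \<sigma>2 V (fobj K_fun A) = \<sigma> A" if "A \<in> Obj fin_cat" for A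
      using that \<sigma>2_fin df by simp
    then show "\<sigma>' = restrict \<sigma>2 V"
      if "\<sigma>' \<in> pts (nat_space (met_cat V) F G) \<and> (\<forall>A\<in>Obj fin_cat. \<sigma>' (fobj K_fun A) = \<sigma> A)" for \<sigma>'
      using that \<open>restrict \<sigma>2 V \<in> _\<close>
      by (intro nat_transformations_agree[OF dir pc G]) simp_all
  qed
qed

end

section \<open>Test functors of large type\<close>

lemma restrict_homs_discrete:
  assumes "\<phi> \<in> homs Y C" "A \<subseteq> pts Y"
  shows "restrict \<phi> A \<in> A \<rightarrow>\<^sub>E pts C"
  using assms hom_in[OF assms(1)] by auto

text \<open>An isomorphic copy of \<open>Z\<close> with values over the type \<open>'b\<close> of
  the codes, as strong finitarity quantifies over endofunctors on spaces over \<open>'u\<close>. The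
  codes are chosen independently for each object, and the action is conjugated by them.\<close>

definition coded_functor :: "('o \<Rightarrow> 'a \<Rightarrow> 'b) \<Rightarrow> ('o, 'm, 'a emet, 'a \<Rightarrow> 'a) efun \<Rightarrow> ('o, 'm, 'b emet, 'b \<Rightarrow> 'b) efun" where
  "coded_functor e Z = \<lparr>fobj = (\<lambda>Y. image_space (e Y) (fobj Z Y)),
     farr = (\<lambda>Y Y' f. \<lambda>p\<in>e Y ` pts (fobj Z Y). e Y' (farr Z Y Y' f (inv_into (pts (fobj Z Y)) (e Y) p)))\<rparr>"

lemma coded_functor_farr:
  "inj_on (e Y) (pts (fobj Z Y)) \<Longrightarrow> z \<in> pts (fobj Z Y) \<Longrightarrow>
    farr (coded_functor e Z) Y Y' f (e Y z) = e Y' (farr Z Y Y' f z)"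
  by (simp add: coded_functor_def inv_into_f_f)

text \<open>Naturality without extensionality in the object argument and relative to any set of
  spaces: over \<open>finite_spaces\<close> it describes transformations between the composites with
  \<open>K_fun\<close>.\<close>

definition natural_family :: "'a emet set \<Rightarrow> ('a emet, 'a \<Rightarrow> 'a, 'b emet, 'b \<Rightarrow> 'b) efun
    \<Rightarrow> ('a emet, 'a \<Rightarrow> 'a, 'c emet, 'c \<Rightarrow> 'c) efun \<Rightarrow> ('a emet \<Rightarrow> 'b \<Rightarrow> 'c) \<Rightarrow> bool" where
  "natural_family V F G \<alpha> \<longleftrightarrow> (\<forall>X\<in>V. \<alpha> X \<in> homs (fobj F X) (fobj G X)) \<and>
     (\<forall>X\<in>V. \<forall>Y\<in>V. \<forall>f\<in>homs X Y. \<forall>z\<in>pts (fobj F X). farr G X Y f (\<alpha> X z) = \<alpha> Y (farr F X Y f z))"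

lemma natural_familyD:
  "natural_family V F G \<alpha> \<Longrightarrow> X \<in> V \<Longrightarrow> \<alpha> X \<in> homs (fobj F X) (fobj G X)"
  "natural_family V F G \<alpha> \<Longrightarrow> X \<in> V \<Longrightarrow> Y \<in> V \<Longrightarrow> f \<in> homs X Y \<Longrightarrow> z \<in> pts (fobj F X) \<Longrightarrow>
    farr G X Y f (\<alpha> X z) = \<alpha> Y (farr F X Y f z)"
  by (auto simp: natural_family_def)

lemma nat_space_met_cat_iff:
  "\<alpha> \<in> pts (nat_space (met_cat V) F G) \<longleftrightarrow> \<alpha> \<in> extensional V \<and> natural_family V F G \<alpha>"
  by (simp add: nat_space_iff natural_family_def)

definition finite_spaces :: "'a emet set" where
  "finite_spaces = discrete ` {A. finite A}"

section \<open>Strong finitarity tested against functors with values over any type\<close>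

context met_endofunctor
begin

lemma finite_spaces_in: "X \<in> finite_spaces \<Longrightarrow> X \<in> V"
  by (auto simp: finite_spaces_def intro: discrete_in small_finite)

lemma enriched_coded_functor:
  assumes Z: "enriched_functor (met_cat V) (met_cat (spaces U b)) Z"
    and e: "\<And>Y. Y \<in> V \<Longrightarrow> inj_on (e Y :: 'b \<Rightarrow> 'u) (pts (fobj Z Y))"
  shows "enriched_functor (met_cat V) (met_cat V) (coded_functor e Z)" (is "enriched_functor _ _ ?G")
proof -
  have pts: "pts (fobj ?G Y) = e Y ` pts (fobj Z Y)" for Y by (simp add: coded_functor_def)
  have ed: "ed (fobj ?G Y) (e Y z) (e Y z') = ed (fobj Z Y) z z'"
    if "Y \<in> V" "z \<in> pts (fobj Z Y)" "z' \<in> pts (fobj Z Y)" for Y z z'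
    using ed_image_space[OF e[OF that(1)] that(2,3)] by (simp add: coded_functor_def)
  have farr: "farr ?G Y Y' f (e Y z) = e Y' (farr Z Y Y' f z)" if "Y \<in> V" "z \<in> pts (fobj Z Y)" for Y Y' f z
    by (rule coded_functor_farr[where e=e and Z=Z and Y=Y, OF e[OF that(1)] that(2)])
  have ext: "farr ?G Y Y' f \<in> extensional (pts (fobj ?G Y))" for Y Y' f by (simp add: coded_functor_def)
  have hom: "farr ?G Y Y' f \<in> homs (fobj ?G Y) (fobj ?G Y')" if Y: "Y \<in> V" "Y' \<in> V" and f: "f \<in> homs Y Y'" for Y Y' f
  proof (rule homI[OF ext])
    note h = met_functor_hom[OF Z Y f]
    fix p assume "p \<in> pts (fobj ?G Y)"
    then obtain z where z: "z \<in> pts (fobj Z Y)" "p = e Y z" by (auto simp: pts)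
    show "farr ?G Y Y' f p \<in> pts (fobj ?G Y')" using hom_in[OF h z(1)] z by (simp add: farr[OF Y(1)] pts)
    fix q assume "q \<in> pts (fobj ?G Y)"
    then obtain y where y: "y \<in> pts (fobj Z Y)" "q = e Y y" by (auto simp: pts)
    show "ed (fobj ?G Y') (farr ?G Y Y' f p) (farr ?G Y Y' f q) \<le> ed (fobj ?G Y) p q"
      unfolding z(2) y(2) farr[OF Y(1) z(1)] farr[OF Y(1) y(1)] ed[OF Y(1) z(1) y(1)]
        ed[OF Y(2) hom_in[OF h z(1)] hom_in[OF h y(1)]]
      by (rule hom_le[OF h z(1) y(1)])
  qed
  have le: "ed (hom_space (fobj ?G Y) (fobj ?G Y')) (farr ?G Y Y' f) (farr ?G Y Y' g) \<le> ed (hom_space Y Y') f g"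
    if Y: "Y \<in> V" "Y' \<in> V" and f: "f \<in> homs Y Y'" "g \<in> homs Y Y'" for Y Y' f g
    unfolding hom_ed_le_iff
  proof
    fix p assume "p \<in> pts (fobj ?G Y)"
    then obtain z where z: "z \<in> pts (fobj Z Y)" "p = e Y z" by (auto simp: pts)
    have "ed (fobj Z Y') (farr Z Y Y' f z) (farr Z Y Y' g z) \<le> ed (hom_space (fobj Z Y) (fobj Z Y')) (farr Z Y Y' f) (farr Z Y Y' g)"
      by (rule hom_ed_ge[OF z(1)])
    also have "\<dots> \<le> ed (hom_space Y Y') f g" by (rule met_functor_le[OF Z Y f])
    finally show "ed (fobj ?G Y') (farr ?G Y Y' f p) (farr ?G Y Y' g p) \<le> ed (hom_space Y Y') f g"
      unfolding z(2) farr[OF Y(1) z(1)]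
        ed[OF Y(2) hom_in[OF met_functor_hom[OF Z Y f(1)] z(1)] hom_in[OF met_functor_hom[OF Z Y f(2)] z(1)]] .
  qed
  have id: "farr ?G Y Y (\<lambda>y\<in>pts Y. y) = (\<lambda>p\<in>pts (fobj ?G Y). p)" if Y: "Y \<in> V" for Y
  proof (rule extensionalityI[OF ext restrict_extensional])
    fix p assume "p \<in> pts (fobj ?G Y)"
    then obtain z where z: "z \<in> pts (fobj Z Y)" "p = e Y z" by (auto simp: pts)
    then show "farr ?G Y Y (\<lambda>y\<in>pts Y. y) p = (\<lambda>p\<in>pts (fobj ?G Y). p) p"
      using met_functor_id_app[OF Z Y z(1)] by (simp add: farr[OF Y] pts)
  qed
  have comp: "farr ?G X Y (compose (pts X) g f) = compose (pts (fobj ?G X)) (farr ?G W Y g) (farr ?G X W f)"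
    if X: "X \<in> V" "W \<in> V" "Y \<in> V" and f: "f \<in> homs X W" and g: "g \<in> homs W Y" for X W Y f g
  proof (rule extensionalityI[OF ext compose_extensional])
    fix p assume p: "p \<in> pts (fobj ?G X)"
    then obtain z where z: "z \<in> pts (fobj Z X)" "p = e X z" by (auto simp: pts)
    show "farr ?G X Y (compose (pts X) g f) p = compose (pts (fobj ?G X)) (farr ?G W Y g) (farr ?G X W f) p"
      unfolding compose_app[OF p] unfolding z(2) farr[OF X(1) z(1)]
        farr[OF X(2) met_functor_in[OF Z X(1,2) f z(1)]] met_functor_comp_app[OF Z X f g z(1)] ..
  qed
  have obj: "fobj ?G Y \<in> V" if "Y \<in> V" for Y
    using image_space_in_spaces[OF e[OF that] met_functor_obj[OF Z that]] by (simp add: coded_functor_def)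
  have cat: "enriched_category (met_cat V)" by (rule enriched_category_met_cat) (rule spacesD)
  show ?thesis
    unfolding enriched_functor_def nonexpanding_def
    using cat obj hom le id comp by (simp add: met_cat_def)
qed

lemma code_ex:
  assumes "enriched_functor (met_cat V) (met_cat (spaces U b)) (Z :: ('u emet, 'u \<Rightarrow> 'u, 'b emet, 'b \<Rightarrow> 'b) efun)"
  shows "\<exists>e :: 'u emet \<Rightarrow> 'b \<Rightarrow> 'u. \<forall>Y\<in>V. inj_on (e Y) (pts (fobj Z Y))"
proof (rule bchoice, rule ballI)
  fix Y :: "'u emet" assume "Y \<in> V"
  then show "\<exists>e :: 'b \<Rightarrow> 'u. inj_on e (pts (fobj Z Y))"
    using small_inj_on[OF spacesD(2)[OF met_functor_obj[OF assms]]] by blast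
qed

lemma natural_family_coded:
  assumes e: "\<And>Y. Y \<in> W \<Longrightarrow> inj_on (e Y) (pts (fobj Z Y))" and \<alpha>: "natural_family W H Z \<alpha>"
    and H: "\<And>X Y f z. X \<in> W \<Longrightarrow> Y \<in> W \<Longrightarrow> f \<in> homs X Y \<Longrightarrow> z \<in> pts (fobj H X) \<Longrightarrow> farr H X Y f z \<in> pts (fobj H Y)"
  shows "natural_family W H (coded_functor e Z) (\<lambda>Y. \<lambda>y\<in>pts (fobj H Y). e Y (\<alpha> Y y))"
  unfolding natural_family_def
proof (intro conjI ballI restrict_homI)
  fix Y y assume Y: "Y \<in> W" and y: "y \<in> pts (fobj H Y)"
  note in_Z = hom_in[OF natural_familyD(1)[OF \<alpha>]]
  show "e Y (\<alpha> Y y) \<in> pts (fobj (coded_functor e Z) Y)"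
    using in_Z[OF Y y] by (simp add: coded_functor_def)
  show "ed (fobj (coded_functor e Z) Y) (e Y (\<alpha> Y y)) (e Y (\<alpha> Y y')) \<le> ed (fobj H Y) y y'"
    if y': "y' \<in> pts (fobj H Y)" for y'
    using hom_le[OF natural_familyD(1)[OF \<alpha> Y] y y'] ed_image_space[OF e[OF Y] in_Z[OF Y y] in_Z[OF Y y']]
    by (simp add: coded_functor_def)
  show "farr (coded_functor e Z) Y Y' f ((\<lambda>y\<in>pts (fobj H Y). e Y (\<alpha> Y y)) y) =
      (\<lambda>y\<in>pts (fobj H Y'). e Y' (\<alpha> Y' y)) (farr H Y Y' f y)" if Y': "Y' \<in> W" and f: "f \<in> homs Y Y'" for Y' f
    using y H[OF Y Y' f y] natural_familyD(2)[OF \<alpha> Y Y' f y]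
    by (simp add: coded_functor_farr[where e=e and Z=Z and Y=Y, OF e[OF Y] in_Z[OF Y y]])
qed

text \<open>Coding turns both families into transformations to an endofunctor over
  \<open>'u\<close>, where the uniqueness clause applies; injectivity of the codes undoes the
  coding.\<close>

lemma strongly_finitary_unique:
  fixes Z :: "('u emet, 'u \<Rightarrow> 'u, 'b emet, 'b \<Rightarrow> 'b) efun"
  assumes sf: "strongly_finitary V F"
    and Z: "enriched_functor (met_cat V) (met_cat (spaces U b)) Z"
    and \<alpha>: "natural_family V F Z \<alpha>" and \<beta>: "natural_family V F Z \<beta>"
    and eq: "\<And>A z. finite A \<Longrightarrow> z \<in> pts (fobj F (discrete A)) \<Longrightarrow> \<alpha> (discrete A) z = \<beta> (discrete A) z"
    and Y: "Y \<in> V" and y: "y \<in> pts (fobj F Y)"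
  shows "\<alpha> Y y = \<beta> Y y"
proof -
  obtain e :: "'u emet \<Rightarrow> 'b \<Rightarrow> 'u" where "\<forall>Y\<in>V. inj_on (e Y) (pts (fobj Z Y))" using code_ex[OF Z] ..
  then have e: "\<And>Y. Y \<in> V \<Longrightarrow> inj_on (e Y) (pts (fobj Z Y))" by blast
  let ?G = "coded_functor e Z"
  define code where "code \<gamma> = (\<lambda>Y\<in>V. \<lambda>y\<in>pts (fobj F Y). e Y (\<gamma> Y y))" for \<gamma> :: "'u emet \<Rightarrow> 'u \<Rightarrow> 'b"
  note G = enriched_coded_functor[OF Z e]
  have N: "code \<gamma> \<in> pts (nat_space (met_cat V) F ?G)" if "natural_family V F Z \<gamma>" for \<gamma>
    using natural_family_coded[OF e that met_functor_in[OF F_functor]]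
    unfolding nat_space_met_cat_iff code_def by (simp add: natural_family_def)
  let ?\<sigma> = "\<lambda>A\<in>{A. finite A}. code \<alpha> (discrete A)"
  have \<sigma>: "?\<sigma> \<in> pts (nat_space fin_cat (comp_fun F K_fun) (comp_fun ?G K_fun))"
    using N[OF \<alpha>] unfolding nat_space_iff
    by (simp add: discrete_in small_finite homs_discrete[OF ext_metric_discrete])
  have "\<exists>!\<sigma>'. \<sigma>' \<in> pts (nat_space (met_cat V) F ?G) \<and> (\<forall>A\<in>Obj fin_cat. \<sigma>' (fobj K_fun A) = ?\<sigma> A)"
    using sf G \<sigma> unfolding strongly_finitary_def by blast
  moreover have "code \<beta> (discrete A) = code \<alpha> (discrete A)" if "finite A" for A
    unfolding code_def using eq[OF that] by (auto simp: fun_eq_iff restrict_def)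
  ultimately have "code \<alpha> = code \<beta>" using N[OF \<alpha>] N[OF \<beta>] by (metis (no_types, lifting) K_fun_simps(1) fin_cat_simps(1) mem_Collect_eq restrict_apply')
  from fun_cong[OF fun_cong[OF this, of Y], of y] have "e Y (\<alpha> Y y) = e Y (\<beta> Y y)"
    using Y y by (simp add: code_def)
  then show ?thesis
    by (rule inj_onD[OF e[OF Y] _ hom_in[OF natural_familyD(1)[OF \<alpha> Y] y] hom_in[OF natural_familyD(1)[OF \<beta> Y] y]])
qed

text \<open>The family is coded, extended by the existence clause, and decoded pointwise; decoding
  is isometric and commutes with the actions, so naturality survives.\<close>

lemma strongly_finitary_extend:
  fixes Z :: "('u emet, 'u \<Rightarrow> 'u, 'b emet, 'b \<Rightarrow> 'b) efun"
  assumes sf: "strongly_finitary V F"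
    and Z: "enriched_functor (met_cat V) (met_cat (spaces U b)) Z"
    and \<sigma>: "natural_family finite_spaces F Z \<sigma>"
  shows "\<exists>\<alpha>. natural_family V F Z \<alpha> \<and> (\<forall>X\<in>finite_spaces. \<alpha> X = \<sigma> X)"
proof -
  obtain e :: "'u emet \<Rightarrow> 'b \<Rightarrow> 'u" where "\<forall>Y\<in>V. inj_on (e Y) (pts (fobj Z Y))" using code_ex[OF Z] ..
  then have e: "\<And>Y. Y \<in> V \<Longrightarrow> inj_on (e Y) (pts (fobj Z Y))" by blast
  let ?G = "coded_functor e Z"
  note G = enriched_coded_functor[OF Z e] and fs = finite_spaces_in
  have c: "natural_family finite_spaces F ?G (\<lambda>Y. \<lambda>y\<in>pts (fobj F Y). e Y (\<sigma> Y y))"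
    by (rule natural_family_coded[OF e[OF fs] \<sigma>], assumption, rule met_functor_in[OF F_functor fs fs])
  let ?\<sigma> = "\<lambda>A\<in>{A. finite A}. \<lambda>y\<in>pts (fobj F (discrete A)). e (discrete A) (\<sigma> (discrete A) y)"
  have "?\<sigma> \<in> pts (nat_space fin_cat (comp_fun F K_fun) (comp_fun ?G K_fun))"
    using c unfolding nat_space_iff natural_family_def finite_spaces_def
    by (simp add: homs_discrete[OF ext_metric_discrete])
  then obtain \<alpha> where \<alpha>: "\<alpha> \<in> pts (nat_space (met_cat V) F ?G)" "\<forall>A\<in>Obj fin_cat. \<alpha> (fobj K_fun A) = ?\<sigma> A"
    using sf G unfolding strongly_finitary_def by blast
  have \<alpha>n: "natural_family V F ?G \<alpha>" using \<alpha>(1) by (simp add: nat_space_met_cat_iff)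
  let ?d = "\<lambda>Y. inv_into (pts (fobj Z Y)) (e Y)"
  let ?\<beta> = "\<lambda>Y. \<lambda>y\<in>pts (fobj F Y). ?d Y (\<alpha> Y y)"
  have d: "?d Y (\<alpha> Y y) \<in> pts (fobj Z Y)" "e Y (?d Y (\<alpha> Y y)) = \<alpha> Y y" if "Y \<in> V" "y \<in> pts (fobj F Y)" for Y y
    using hom_in[OF natural_familyD(1)[OF \<alpha>n that(1)] that(2)]
    by (auto simp: coded_functor_def intro: inv_into_into f_inv_into_f)
  have "natural_family V F Z ?\<beta>"
    unfolding natural_family_def
  proof (intro conjI ballI restrict_homI)
    fix Y y assume Y: "Y \<in> V" and y: "y \<in> pts (fobj F Y)"
    show "?d Y (\<alpha> Y y) \<in> pts (fobj Z Y)" by (rule d[OF Y y])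
    show "ed (fobj Z Y) (?d Y (\<alpha> Y y)) (?d Y (\<alpha> Y y')) \<le> ed (fobj F Y) y y'" if y': "y' \<in> pts (fobj F Y)" for y'
      using hom_le[OF natural_familyD(1)[OF \<alpha>n Y] y y'] ed_image_space[OF e[OF Y] d(1)[OF Y y] d(1)[OF Y y']]
      by (simp add: d(2)[OF Y y] d(2)[OF Y y'] coded_functor_def)
    show "farr Z Y Y' f (?\<beta> Y y) = ?\<beta> Y' (farr F Y Y' f y)" if Y': "Y' \<in> V" and f: "f \<in> homs Y Y'" for Y' f
    proof -
      note y' = met_functor_in[OF F_functor Y Y' f y]
      have "e Y' (farr Z Y Y' f (?d Y (\<alpha> Y y))) = farr ?G Y Y' f (\<alpha> Y y)"
        using coded_functor_farr[where e=e and Z=Z and Y=Y, OF e[OF Y] d(1)[OF Y y]] d(2)[OF Y y] by metis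
      also have "\<dots> = e Y' (?d Y' (\<alpha> Y' (farr F Y Y' f y)))"
        using natural_familyD(2)[OF \<alpha>n Y Y' f y] d(2)[OF Y' y'] by simp
      finally show ?thesis
        using inj_onD[OF e[OF Y'] _ met_functor_in[OF Z Y Y' f d(1)[OF Y y]] d(1)[OF Y' y']] y y' by simp
    qed
  qed
  moreover have "?\<beta> X = \<sigma> X" if X: "X \<in> finite_spaces" for X
  proof (rule extensionalityI[OF restrict_extensional hom_extensional[OF natural_familyD(1)[OF \<sigma> X]]])
    fix y assume y: "y \<in> pts (fobj F X)"
    have "\<alpha> X y = e X (\<sigma> X y)" using \<alpha>(2) X y by (auto simp: finite_spaces_def)
    then show "?\<beta> X y = \<sigma> X y"
      using y inv_into_f_f[OF e[OF fs[OF X]] hom_in[OF natural_familyD(1)[OF \<sigma> X] y]] by simp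
  qed
  ultimately show ?thesis by blast
qed

end

text \<open>
  The test functor sends \<open>Y\<close> to a space of morphisms from \<open>[Y,C]\<close> to \<open>X\<close>, with only as many of
  them as needed: the space of all such morphisms need not be small.
\<close>

definition bidual :: "'a emet \<Rightarrow> 'b emet \<Rightarrow> 'a emet \<Rightarrow> (('a \<Rightarrow> 'a) \<Rightarrow> 'b) emet" where
  "bidual C X Y = hom_space (hom_space Y C) X"

text \<open>The action of Y |-> [[Y,C],X] on \<open>a : Y \<rightarrow> Y'\<close>. It is covariant,
  since the argument is precomposed with \<open>a\<close>.\<close>

definition precompose :: "'a emet \<Rightarrow> 'a emet \<Rightarrow> 'a emet \<Rightarrow> ('a \<Rightarrow> 'a) \<Rightarrow> (('a \<Rightarrow> 'a) \<Rightarrow> 'b) \<Rightarrow> ('a \<Rightarrow> 'a) \<Rightarrow> 'b" where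
  "precompose C Y Y' a \<Phi> = (\<lambda>\<phi>\<in>homs Y' C. \<Phi> (compose (pts Y) \<phi> a))"

definition test_functor :: "bool \<Rightarrow> 'a emet \<Rightarrow> 'b emet \<Rightarrow> ('a emet \<Rightarrow> (('a \<Rightarrow> 'a) \<Rightarrow> 'b) set)
    \<Rightarrow> ('a emet, 'a \<Rightarrow> 'a, (('a \<Rightarrow> 'a) \<Rightarrow> 'b) emet, (('a \<Rightarrow> 'a) \<Rightarrow> 'b) \<Rightarrow> ('a \<Rightarrow> 'a) \<Rightarrow> 'b) efun" where
  "test_functor b C X S = \<lparr>fobj = (\<lambda>Y. subspace (bidual C X Y) (closure_in b (bidual C X Y) (S Y))),
     farr = (\<lambda>Y Y' a. \<lambda>\<Phi>\<in>closure_in b (bidual C X Y) (S Y). precompose C Y Y' a \<Phi>)\<rparr>"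

lemma ext_metric_bidual: "ext_metric C \<Longrightarrow> ext_metric X \<Longrightarrow> ext_metric Y \<Longrightarrow> ext_metric (bidual C X Y)"
  by (simp add: bidual_def ext_metric_hom_space)

lemma precompose_in:
  assumes a: "a \<in> homs Y Y'" and \<Phi>: "\<Phi> \<in> pts (bidual C X Y)"
  shows "precompose C Y Y' a \<Phi> \<in> pts (bidual C X Y')"
  unfolding precompose_def bidual_def
proof (rule restrict_homI)
  note \<Phi> = \<Phi>[unfolded bidual_def] and c = hom_space_compose[OF a]
  fix \<phi> \<phi>' assume \<phi>: "\<phi> \<in> homs Y' C" "\<phi>' \<in> homs Y' C"
  show "\<Phi> (compose (pts Y) \<phi> a) \<in> pts X" by (rule hom_in[OF \<Phi> c[OF \<phi>(1)]])
  show "ed X (\<Phi> (compose (pts Y) \<phi> a)) (\<Phi> (compose (pts Y) \<phi>' a)) \<le> ed (hom_space Y' C) \<phi> \<phi>'"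
    by (rule order_trans[OF hom_le[OF \<Phi> c[OF \<phi>(1)] c[OF \<phi>(2)]] hom_ed_compose_right[OF a]])
qed

lemma precompose_nonexpanding:
  assumes a: "a \<in> homs Y Y'"
  shows "ed (bidual C X Y') (precompose C Y Y' a \<Phi>) (precompose C Y Y' a \<Phi>') \<le> ed (bidual C X Y) \<Phi> \<Phi>'"
  unfolding bidual_def hom_ed_le_iff
proof
  fix \<phi> assume "\<phi> \<in> homs Y' C"
  then show "ed X (precompose C Y Y' a \<Phi> \<phi>) (precompose C Y Y' a \<Phi>' \<phi>) \<le> ed (hom_space (hom_space Y C) X) \<Phi> \<Phi>'"
    using hom_ed_ge[OF hom_space_compose[OF a], of \<phi> C X \<Phi> \<Phi>'] by (simp add: precompose_def)
qed

text \<open>The arguments handed to \<open>\<Phi>\<close> differ by at most the distance of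
  \<open>a\<close> and \<open>a'\<close>, and \<open>\<Phi>\<close> is nonexpanding; this makes the
  test functors enriched.\<close>

lemma precompose_locally_nonexpanding:
  assumes a: "a \<in> homs Y Y'" "a' \<in> homs Y Y'" and \<Phi>: "\<Phi> \<in> pts (bidual C X Y)"
  shows "ed (bidual C X Y') (precompose C Y Y' a \<Phi>) (precompose C Y Y' a' \<Phi>) \<le> ed (hom_space Y Y') a a'"
  unfolding bidual_def hom_ed_le_iff
proof
  fix \<phi> assume \<phi>: "\<phi> \<in> homs Y' C"
  have "ed X (\<Phi> (compose (pts Y) \<phi> a)) (\<Phi> (compose (pts Y) \<phi> a')) \<le> ed (hom_space Y Y') a a'"
    by (rule order_trans[OF hom_le[OF \<Phi>[unfolded bidual_def] hom_space_compose[OF a(1) \<phi>] hom_space_compose[OF a(2) \<phi>]]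
        hom_ed_compose_left[OF a \<phi>]])
  then show "ed X (precompose C Y Y' a \<Phi> \<phi>) (precompose C Y Y' a' \<Phi> \<phi>) \<le> ed (hom_space Y Y') a a'"
    using \<phi> by (simp add: precompose_def)
qed

lemma precompose_id: "\<Phi> \<in> pts (bidual C X Y) \<Longrightarrow> precompose C Y Y (\<lambda>y\<in>pts Y. y) \<Phi> = \<Phi>"
  unfolding bidual_def
  by (rule extensionalityI[OF _ hom_extensional]) (auto simp: precompose_def compose_id_right)

lemma precompose_compose:
  assumes "f \<in> homs Y Y'" "g \<in> homs Y' Y''"
  shows "precompose C Y Y'' (compose (pts Y) g f) \<Phi> = precompose C Y' Y'' g (precompose C Y Y' f \<Phi>)"
  unfolding precompose_def
  by (rule restrict_ext) (simp add: hom_space_compose[OF assms(2)] hom_compose_assoc[OF assms(1)])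

section \<open>Morphisms out of \<open>FC\<close> as families over finite sets\<close>

context met_endofunctor
begin

text \<open>Precomposition is nonexpanding, so stability of \<open>S\<close> under the action passes
  to the closure; the closure is small, and complete when required, as \<open>X\<close> is.\<close>

lemma enriched_test_functor:
  assumes C: "C \<in> V" and X: "X \<in> V"
    and S: "\<And>Y. Y \<in> V \<Longrightarrow> S Y \<subseteq> pts (bidual C X Y)" "\<And>Y. Y \<in> V \<Longrightarrow> small U (S Y)"
    and act: "\<And>Y Y' a \<Phi>. Y \<in> V \<Longrightarrow> Y' \<in> V \<Longrightarrow> a \<in> homs Y Y' \<Longrightarrow> \<Phi> \<in> S Y \<Longrightarrow> precompose C Y Y' a \<Phi> \<in> S Y'"
  shows "enriched_functor (met_cat V) (met_cat (spaces U b)) (test_functor b C X S)" (is "enriched_functor _ _ ?Z")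
proof -
  let ?c = "\<lambda>Y. closure_in b (bidual C X Y) (S Y)"
  have m: "ext_metric (bidual C X Y)" if "Y \<in> V" for Y
    by (intro ext_metric_bidual) (rule spacesD[OF C] spacesD[OF X] spacesD[OF that])+
  have pts: "pts (fobj ?Z Y) = ?c Y" and ed: "ed (fobj ?Z Y) = ed (bidual C X Y)"
    and farr: "farr ?Z Y Y' a = (\<lambda>\<Phi>\<in>?c Y. precompose C Y Y' a \<Phi>)" for Y Y' a
    by (simp_all add: test_functor_def)
  have sub: "\<Phi> \<in> pts (bidual C X Y)" if "Y \<in> V" "\<Phi> \<in> ?c Y" for Y \<Phi>
    using closure_in_subset[OF S(1)[OF that(1)]] that(2) by blast
  have obj: "fobj ?Z Y \<in> spaces U b" if Y: "Y \<in> V" for Y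
  proof -
    have "complete_emet (bidual C X Y)" if b
      unfolding bidual_def by (intro complete_hom_space) (rule spacesD[OF X] that)+
    then show ?thesis
      using subspace_closure_in_spaces[OF m[OF Y] _ S(1)[OF Y] S(2)[OF Y]] by (simp add: test_functor_def)
  qed
  have c: "precompose C Y Y' a \<Phi> \<in> ?c Y'" if Y: "Y \<in> V" "Y' \<in> V" and a: "a \<in> homs Y Y'" and \<Phi>: "\<Phi> \<in> ?c Y" for Y Y' a \<Phi>
    by (rule closure_in_hom[where f = "precompose C Y Y' a", OF act[OF Y a] precompose_in[OF a] precompose_nonexpanding[OF a] S(1)[OF Y(1)] \<Phi>])
  have hom: "farr ?Z Y Y' a \<in> homs (fobj ?Z Y) (fobj ?Z Y')" if "Y \<in> V" "Y' \<in> V" "a \<in> homs Y Y'" for Y Y' a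
    unfolding farr pts[symmetric]
    by (rule restrict_homI) (simp_all add: pts ed c[OF that] precompose_nonexpanding[OF that(3)])
  have le: "ed (hom_space (fobj ?Z Y) (fobj ?Z Y')) (farr ?Z Y Y' a) (farr ?Z Y Y' a') \<le> ed (hom_space Y Y') a a'"
    if "Y \<in> V" "Y' \<in> V" "a \<in> homs Y Y'" "a' \<in> homs Y Y'" for Y Y' a a'
    unfolding hom_ed_le_iff ed pts farr
    using precompose_locally_nonexpanding[OF that(3,4) sub[OF that(1)]] by simp
  have id: "farr ?Z Y Y (\<lambda>y\<in>pts Y. y) = (\<lambda>p\<in>pts (fobj ?Z Y). p)" if Y: "Y \<in> V" for Y
    unfolding pts farr by (rule restrict_ext) (rule precompose_id[OF sub[OF Y]])
  have comp: "farr ?Z Y Y'' (compose (pts Y) g f) = compose (pts (fobj ?Z Y)) (farr ?Z Y' Y'' g) (farr ?Z Y Y' f)"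
    if Y: "Y \<in> V" "Y' \<in> V" "Y'' \<in> V" and f: "f \<in> homs Y Y'" and g: "g \<in> homs Y' Y''" for Y Y' Y'' f g
    unfolding pts farr compose_def[of "?c Y"]
    by (rule restrict_ext) (simp add: c[OF Y(1,2) f] precompose_compose[OF f g])
  have cat: "enriched_category (met_cat V)" by (rule enriched_category_met_cat) (rule spacesD)
  have cat': "enriched_category (met_cat (spaces U b :: (('u \<Rightarrow> 'u) \<Rightarrow> 'u) emet set))"
    by (rule enriched_category_met_cat) (rule spacesD)
  show ?thesis
    unfolding enriched_functor_def nonexpanding_def
    using cat cat' obj hom le id comp by (simp add: met_cat_def)
qed

text \<open>For the transformations that correspond to \<open>t\<close> and \<open>t'\<close>,
  agreement at finite discrete spaces says that \<open>t\<close> and \<open>t'\<close> agree on the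
  images of all maps from finite sets to \<open>C\<close>.\<close>

lemma finite_family_unique:
  assumes sf: "strongly_finitary V F" and C: "C \<in> V" and X: "X \<in> V"
    and t: "t \<in> homs (fobj F C) X" "t' \<in> homs (fobj F C) X"
    and eq: "\<And>A f z. finite A \<Longrightarrow> f \<in> A \<rightarrow>\<^sub>E pts C \<Longrightarrow> z \<in> pts (fobj F (discrete A)) \<Longrightarrow>
      t (farr F (discrete A) C f z) = t' (farr F (discrete A) C f z)"
  shows "t = t'"
proof -
  \<comment> \<open>The transformation that corresponds to \<open>s\<close>; evaluation at the
    identity of \<open>C\<close> recovers \<open>s\<close>.\<close>
  define ev where "ev s Y y = (\<lambda>\<phi>\<in>homs Y C. s (farr F Y C \<phi> y))" for s :: "'u \<Rightarrow> 'u" and Y y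
  have ev_in: "ev s Y y \<in> pts (bidual C X Y)" if s: "s \<in> homs (fobj F C) X" and Y: "Y \<in> V" and y: "y \<in> pts (fobj F Y)" for s Y y
    unfolding ev_def bidual_def
  proof (rule restrict_homI)
    note Fy = met_functor_in[OF F_functor Y C _ y]
    fix \<phi> \<phi>' assume \<phi>: "\<phi> \<in> homs Y C" "\<phi>' \<in> homs Y C"
    show "s (farr F Y C \<phi> y) \<in> pts X" by (rule hom_in[OF s Fy[OF \<phi>(1)]])
    have "ed X (s (farr F Y C \<phi> y)) (s (farr F Y C \<phi>' y)) \<le> ed (fobj F C) (farr F Y C \<phi> y) (farr F Y C \<phi>' y)"
      by (rule hom_le[OF s Fy[OF \<phi>(1)] Fy[OF \<phi>(2)]])
    also have "\<dots> \<le> ed (hom_space (fobj F Y) (fobj F C)) (farr F Y C \<phi>) (farr F Y C \<phi>')" by (rule hom_ed_ge[OF y])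
    also have "\<dots> \<le> ed (hom_space Y C) \<phi> \<phi>'" by (rule met_functor_le[OF F_functor Y C \<phi>])
    finally show "ed X (s (farr F Y C \<phi> y)) (s (farr F Y C \<phi>' y)) \<le> ed (hom_space Y C) \<phi> \<phi>'" .
  qed
  have ev_act: "precompose C Y Y' a (ev s Y y) = ev s Y' (farr F Y Y' a y)"
    if Y: "Y \<in> V" "Y' \<in> V" and a: "a \<in> homs Y Y'" and y: "y \<in> pts (fobj F Y)" for s Y Y' a y
    unfolding precompose_def ev_def
    by (rule restrict_ext) (simp add: hom_space_compose[OF a] met_functor_comp_app[OF F_functor Y C a _ y])
  \<comment> \<open>Just the values of the two transformations: stable under the action by
    naturality, and small as images of small sets.\<close>
  define S where "S Y = (\<lambda>y. ev t Y y) ` pts (fobj F Y) \<union> (\<lambda>y. ev t' Y y) ` pts (fobj F Y)" for Y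
  let ?Z = "test_functor b C X S"
  have S: "S Y \<subseteq> pts (bidual C X Y)" if "Y \<in> V" for Y
    using ev_in[OF t(1) that] ev_in[OF t(2) that] by (auto simp: S_def)
  have Z: "enriched_functor (met_cat V) (met_cat (spaces U b)) ?Z"
  proof (rule enriched_test_functor[OF C X S])
    show "small U (S Y)" if "Y \<in> V" for Y
      unfolding S_def by (intro small_Un small_image spacesD(2)[OF met_functor_obj[OF F_functor that]])
    show "precompose C Y Y' a \<Phi> \<in> S Y'" if "Y \<in> V" "Y' \<in> V" "a \<in> homs Y Y'" "\<Phi> \<in> S Y" for Y Y' a \<Phi>
      using that(4) ev_act[OF that(1-3)] met_functor_in[OF F_functor that(1-3)] by (auto simp: S_def)
  qed
  have m: "ext_metric (bidual C X Y)" if "Y \<in> V" for Y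
    by (intro ext_metric_bidual) (rule spacesD[OF C] spacesD[OF X] spacesD[OF that])+
  have nat: "natural_family V F ?Z (\<lambda>Y. \<lambda>y\<in>pts (fobj F Y). ev s Y y)"
    if s: "s \<in> homs (fobj F C) X" and sS: "\<And>Y y. y \<in> pts (fobj F Y) \<Longrightarrow> ev s Y y \<in> S Y" for s
    unfolding natural_family_def
  proof (intro conjI ballI restrict_homI)
    have sc: "ev s Y y \<in> closure_in b (bidual C X Y) (S Y)" if "Y \<in> V" "y \<in> pts (fobj F Y)" for Y y
      using subset_closure_in[OF m[OF that(1)] S[OF that(1)]] sS[OF that(2)] by blast
    fix Y y assume Y: "Y \<in> V" and y: "y \<in> pts (fobj F Y)"
    show "ev s Y y \<in> pts (fobj ?Z Y)" using sc[OF Y y] by (simp add: test_functor_def)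
    show "ed (fobj ?Z Y) (ev s Y y) (ev s Y y') \<le> ed (fobj F Y) y y'" if y': "y' \<in> pts (fobj F Y)" for y'
    proof -
      have "ed X (s (farr F Y C \<phi> y)) (s (farr F Y C \<phi> y')) \<le> ed (fobj F Y) y y'" if \<phi>: "\<phi> \<in> homs Y C" for \<phi>
      proof -
        note h = met_functor_hom[OF F_functor Y C \<phi>]
        show ?thesis by (rule order_trans[OF hom_le[OF s hom_in[OF h y] hom_in[OF h y']] hom_le[OF h y y']])
      qed
      then show ?thesis unfolding test_functor_def by (simp add: bidual_def hom_ed_le_iff ev_def)
    qed
    show "farr ?Z Y Y' a ((\<lambda>y\<in>pts (fobj F Y). ev s Y y) y) = (\<lambda>y\<in>pts (fobj F Y'). ev s Y' y) (farr F Y Y' a y)"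
      if Y': "Y' \<in> V" and a: "a \<in> homs Y Y'" for Y' a
      using y sc[OF Y y] ev_act[OF Y Y' a y] met_functor_in[OF F_functor Y Y' a y] by (simp add: test_functor_def)
  qed
  show ?thesis
  proof (rule hom_eqI[OF t])
    fix y assume y: "y \<in> pts (fobj F C)"
    have "(\<lambda>y\<in>pts (fobj F C). ev t C y) y = (\<lambda>y\<in>pts (fobj F C). ev t' C y) y"
    proof (rule strongly_finitary_unique[OF sf Z nat[OF t(1)] nat[OF t(2)] _ C y])
      fix A z assume A: "finite A" "z \<in> pts (fobj F (discrete A))"
      have "ev t (discrete A) z = ev t' (discrete A) z"
        unfolding ev_def by (rule restrict_ext) (rule eq[OF A(1) _ A(2)], simp add: homs_discrete spacesD(1)[OF C])
      then show "(\<lambda>y\<in>pts (fobj F (discrete A)). ev t (discrete A) y) z = (\<lambda>y\<in>pts (fobj F (discrete A)). ev t' (discrete A) y) z"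
        using A(2) by simp
    qed (auto simp: S_def)
    then have "ev t C y (\<lambda>x\<in>pts C. x) = ev t' C y (\<lambda>x\<in>pts C. x)" using y by simp
    then show "t y = t' y" by (simp add: ev_def ident_in_hom met_functor_id_app[OF F_functor C y])
  qed
qed

text \<open>The hypotheses describe a transformation on finite discrete spaces into the double dual:
  \<open>le\<close> makes each value nonexpanding on [Y,C], and \<open>dinat\<close> is
  naturality.\<close>

lemma finite_family_extend:
  assumes sf: "strongly_finitary V F" and C: "C \<in> V" and X: "X \<in> V"
    and \<tau>: "\<And>A f. finite A \<Longrightarrow> f \<in> A \<rightarrow>\<^sub>E pts C \<Longrightarrow> \<tau> A f \<in> homs (fobj F (discrete A)) X"
    and dinat: "\<And>A B a f z. finite A \<Longrightarrow> finite B \<Longrightarrow> a \<in> A \<rightarrow>\<^sub>E B \<Longrightarrow> f \<in> B \<rightarrow>\<^sub>E pts C \<Longrightarrow>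
      z \<in> pts (fobj F (discrete A)) \<Longrightarrow> \<tau> A (compose A f a) z = \<tau> B f (farr F (discrete A) (discrete B) a z)"
    and le: "\<And>A f f' z. finite A \<Longrightarrow> f \<in> A \<rightarrow>\<^sub>E pts C \<Longrightarrow> f' \<in> A \<rightarrow>\<^sub>E pts C \<Longrightarrow> z \<in> pts (fobj F (discrete A)) \<Longrightarrow>
      ed X (\<tau> A f z) (\<tau> A f' z) \<le> ed (hom_space (discrete A) C) f f'"
  shows "\<exists>t\<in>homs (fobj F C) X. \<forall>A f z. finite A \<longrightarrow> f \<in> A \<rightarrow>\<^sub>E pts C \<longrightarrow> z \<in> pts (fobj F (discrete A)) \<longrightarrow>
    t (farr F (discrete A) C f z) = \<tau> A f z"
proof -
  define el where "el Y A z = (\<lambda>\<phi>\<in>homs Y C. \<tau> A (restrict \<phi> A) z)" for Y A z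
  \<comment> \<open>Elements that arise from finite subsets of \<open>Y\<close>. A morphism carries
    an element over \<open>A\<close> to one over the finite image of \<open>A\<close>, and a small
    set has few finite subsets, so \<open>S\<close> is stable and small.\<close>
  define S where "S Y = (\<Union>A\<in>{A. finite A \<and> A \<subseteq> pts Y}. (\<lambda>z. el Y A z) ` pts (fobj F (discrete A)))" for Y
  let ?Z = "test_functor b C X S"
  have df: "discrete A \<in> V" if "finite A" for A using that by (blast intro: discrete_in small_finite)
  have dh: "f \<in> homs (discrete A) (discrete B)" if "f \<in> A \<rightarrow>\<^sub>E B" for A B and f :: "'u \<Rightarrow> 'u"
    using that by (simp add: homs_discrete ext_metric_discrete)
  have el_in: "el Y A z \<in> pts (bidual C X Y)" if A: "finite A" "A \<subseteq> pts Y" and z: "z \<in> pts (fobj F (discrete A))" for Y A z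
    unfolding el_def bidual_def
  proof (rule restrict_homI)
    fix \<phi> \<phi>' assume \<phi>: "\<phi> \<in> homs Y C" "\<phi>' \<in> homs Y C"
    note r = restrict_homs_discrete[OF \<phi>(1) A(2)] restrict_homs_discrete[OF \<phi>(2) A(2)]
    show "\<tau> A (restrict \<phi> A) z \<in> pts X" by (rule hom_in[OF \<tau>[OF A(1) r(1)] z])
    have "ed (hom_space (discrete A) C) (restrict \<phi> A) (restrict \<phi>' A) \<le> ed (hom_space Y C) \<phi> \<phi>'"
      unfolding hom_ed_le_iff using hom_ed_ge[of _ Y C \<phi> \<phi>'] A(2) by auto
    then show "ed X (\<tau> A (restrict \<phi> A) z) (\<tau> A (restrict \<phi>' A) z) \<le> ed (hom_space Y C) \<phi> \<phi>'"
      by (rule order_trans[OF le[OF A(1) r z]])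
  qed
  \<comment> \<open>Any finite \<open>B\<close> containing the image of \<open>A\<close> is allowed:
    the image itself gives stability of \<open>S\<close>, and the whole of a finite target gives
    naturality.\<close>
  have el_act: "precompose C Y Y' a (el Y A z) = el Y' B (farr F (discrete A) (discrete B) (restrict a A) z)"
    if Y: "Y' \<in> V" and a: "a \<in> homs Y Y'" and A: "finite A" "A \<subseteq> pts Y" and B: "finite B" "a ` A \<subseteq> B" "B \<subseteq> pts Y'"
      and z: "z \<in> pts (fobj F (discrete A))" for Y Y' a A B z
    unfolding precompose_def el_def
  proof (rule restrict_ext)
    fix \<phi> assume \<phi>: "\<phi> \<in> homs Y' C"
    have "restrict (compose (pts Y) \<phi> a) A = compose A (restrict \<phi> B) (restrict a A)"
      using A B(2) by (auto simp: compose_def fun_eq_iff)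
    moreover have "restrict a A \<in> A \<rightarrow>\<^sub>E B" using B by auto
    ultimately show "(\<lambda>\<phi>\<in>homs Y C. \<tau> A (restrict \<phi> A) z) (compose (pts Y) \<phi> a)
        = \<tau> B (restrict \<phi> B) (farr F (discrete A) (discrete B) (restrict a A) z)"
      using hom_space_compose[OF a \<phi>] dinat[OF A(1) B(1) _ restrict_homs_discrete[OF \<phi> B(3)] z] by simp
  qed
  have S: "S Y \<subseteq> pts (bidual C X Y)" for Y
    using el_in by (auto simp: S_def)
  have Z: "enriched_functor (met_cat V) (met_cat (spaces U b)) ?Z"
  proof (rule enriched_test_functor[OF C X S])
    show "small U (S Y)" if "Y \<in> V" for Y
      unfolding S_def
      by (intro small_UN small_finite_subsets small_image spacesD(2)[OF that] spacesD(2)[OF met_functor_obj[OF F_functor df]]) simp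
    fix Y Y' a \<Phi> assume Y: "Y \<in> V" "Y' \<in> V" and a: "a \<in> homs Y Y'" and "\<Phi> \<in> S Y"
    then obtain A z where A: "finite A" "A \<subseteq> pts Y" and z: "z \<in> pts (fobj F (discrete A))" and \<Phi>: "\<Phi> = el Y A z"
      by (auto simp: S_def)
    have B: "finite (a ` A)" "a ` A \<subseteq> pts Y'" using A hom_in[OF a] by auto
    have "restrict a A \<in> A \<rightarrow>\<^sub>E a ` A" by auto
    then have "farr F (discrete A) (discrete (a ` A)) (restrict a A) z \<in> pts (fobj F (discrete (a ` A)))"
      by (intro met_functor_in[OF F_functor df[OF A(1)] df[OF B(1)] dh z])
    then show "precompose C Y Y' a \<Phi> \<in> S Y'"
      unfolding \<Phi> el_act[OF Y(2) a A B(1) order_refl B(2) z] S_def using B by blast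
  qed
  have m: "ext_metric (bidual C X Y)" if "Y \<in> V" for Y
    by (intro ext_metric_bidual) (rule spacesD[OF C] spacesD[OF X] spacesD[OF that])+
  let ?\<sigma> = "\<lambda>Y. \<lambda>z\<in>pts (fobj F Y). el Y (pts Y) z"
  have nat: "natural_family finite_spaces F ?Z ?\<sigma>"
    unfolding natural_family_def
  proof (intro conjI ballI restrict_homI)
    have sc: "el Y (pts Y) y \<in> closure_in b (bidual C X Y) (S Y)"
      if Y: "Y \<in> finite_spaces" and y: "y \<in> pts (fobj F Y)" for Y y
    proof -
      have "el Y (pts Y) y \<in> S Y" using Y y by (auto simp: S_def finite_spaces_def)
      then show ?thesis using subset_closure_in[OF m[OF finite_spaces_in[OF Y]] S] by blast
    qed
    fix Y y assume Y: "Y \<in> finite_spaces" and y: "y \<in> pts (fobj F Y)"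
    then obtain A where A: "finite A" "Y = discrete A" by (auto simp: finite_spaces_def)
    show "el Y (pts Y) y \<in> pts (fobj ?Z Y)" using sc[OF Y y] by (simp add: test_functor_def)
    show "ed (fobj ?Z Y) (el Y (pts Y) y) (el Y (pts Y) y') \<le> ed (fobj F Y) y y'" if y': "y' \<in> pts (fobj F Y)" for y'
    proof -
      have "ed X (\<tau> A (restrict \<phi> A) y) (\<tau> A (restrict \<phi> A) y') \<le> ed (fobj F Y) y y'" if \<phi>: "\<phi> \<in> homs Y C" for \<phi>
        unfolding A(2)
        by (rule hom_le[OF \<tau>[OF A(1) restrict_homs_discrete[OF \<phi>]] y[unfolded A(2)] y'[unfolded A(2)]]) (simp add: A(2))
      then show ?thesis unfolding test_functor_def by (simp add: bidual_def hom_ed_le_iff el_def A(2))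
    qed
    fix Y' :: "'u emet" and a assume Y': "Y' \<in> finite_spaces" and a: "a \<in> homs Y Y'"
    from Y' obtain B where B: "finite B" "Y' = discrete B" by (auto simp: finite_spaces_def)
    have "a ` A \<subseteq> B" "restrict a A = a" using a unfolding A(2) B(2) by (auto simp: homs_discrete ext_metric_discrete)
    then have "precompose C Y Y' a (el Y A y) = el Y' B (farr F Y Y' a y)"
      using el_act[OF finite_spaces_in[OF Y'] a A(1) _ B(1), of y] y by (simp add: A(2) B(2))
    then show "farr ?Z Y Y' a (?\<sigma> Y y) = ?\<sigma> Y' (farr F Y Y' a y)"
      using y sc[OF Y y] met_functor_in[OF F_functor finite_spaces_in[OF Y] finite_spaces_in[OF Y'] a y]
      by (simp add: test_functor_def A(2) B(2))
  qed
  obtain \<alpha> where \<alpha>: "natural_family V F ?Z \<alpha>" "\<forall>Y\<in>finite_spaces. \<alpha> Y = ?\<sigma> Y"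
    using strongly_finitary_extend[OF sf Z nat] by blast
  have sub: "pts (fobj ?Z Y) \<subseteq> homs (hom_space Y C) X" for Y
    using closure_in_subset[OF S, of b Y] by (simp add: test_functor_def bidual_def)
  let ?i = "\<lambda>x\<in>pts C. x"
  \<comment> \<open>Evaluation at the identity of \<open>C\<close> turns the extended transformation
    into a morphism on \<open>FC\<close>.\<close>
  let ?t = "\<lambda>y\<in>pts (fobj F C). \<alpha> C y ?i"
  note i = ident_in_hom[of C]
  have "?t \<in> homs (fobj F C) X"
  proof (rule restrict_homI)
    note \<alpha>C = natural_familyD(1)[OF \<alpha>(1) C]
    fix y y' assume y: "y \<in> pts (fobj F C)" "y' \<in> pts (fobj F C)"
    have "\<alpha> C y \<in> homs (hom_space C C) X" using hom_in[OF \<alpha>C y(1)] sub by blast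
    then show "\<alpha> C y ?i \<in> pts X" by (rule hom_in[OF _ i])
    have "ed X (\<alpha> C y ?i) (\<alpha> C y' ?i) \<le> ed (fobj ?Z C) (\<alpha> C y) (\<alpha> C y')"
      unfolding test_functor_def using hom_ed_ge[OF i] by (simp add: bidual_def)
    also have "\<dots> \<le> ed (fobj F C) y y'" by (rule hom_le[OF \<alpha>C y])
    finally show "ed X (\<alpha> C y ?i) (\<alpha> C y' ?i) \<le> ed (fobj F C) y y'" .
  qed
  moreover have "?t (farr F (discrete A) C f z) = \<tau> A f z"
    if A: "finite A" and f: "f \<in> A \<rightarrow>\<^sub>E pts C" and z: "z \<in> pts (fobj F (discrete A))" for A f z
  proof -
    have fh: "f \<in> homs (discrete A) C" using f by (simp add: homs_discrete spacesD(1)[OF C])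
    have fs: "discrete A \<in> finite_spaces" using A by (auto simp: finite_spaces_def)
    have "\<alpha> C (farr F (discrete A) C f z) = farr ?Z (discrete A) C f (\<alpha> (discrete A) z)"
      using natural_familyD(2)[OF \<alpha>(1) df[OF A] C fh z] by simp
    also have "\<dots> = precompose C (discrete A) C f (el (discrete A) A z)"
      using hom_in[OF natural_familyD(1)[OF nat fs] z] \<alpha>(2) fs z by (simp add: test_functor_def)
    finally have "\<alpha> C (farr F (discrete A) C f z) ?i = el (discrete A) A z (compose A ?i f)"
      using i by (simp add: precompose_def)
    also have "compose A ?i f = f" using compose_id_left[OF fh] by simp
    also have "el (discrete A) A z f = \<tau> A f z" using fh f by (simp add: el_def PiE_iff extensional_restrict)
    finally show ?thesis unfolding restrict_apply'[OF met_functor_in[OF F_functor df[OF A] C fh z]] .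
  qed
  ultimately show ?thesis by blast
qed

end

section \<open>Strong finitarity implies preservation\<close>

context met_endofunctor
begin

text \<open>The given colimit object \<open>c\<close> is only isomorphic to \<open>M\<close>. Its
  unit at \<open>Base\<close> is shown to be a morphism on \<open>M\<close>, inverse to the morphism
  \<open>j\<close> induced by the identity of the points; \<open>j\<close> then translates maps into
  \<open>c\<close> to maps into \<open>M\<close>.\<close>

lemma strongly_finitary_preserves_precongruences:
  assumes sf: "strongly_finitary V F"
  shows "preserves_precongruence_colimits pr V F"
  unfolding preserves_precongruence_colimits_def
proof (intro ballI allI impI)
  fix M c \<psi> assume M: "M \<in> V" and wc: "wcolimit V pc_cat (precongruence pr M) pc_weight c \<psi>"
  let ?D = "precongruence pr M" and ?K = "discrete (pts M)"
  let ?\<nu> = "wcolimit_unit c \<psi>"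
  let ?n = "?\<nu> Base Zero"
  note D = functor_precongruence[OF M] and cc = wcolimit_imp_colimit_cocone[OF wc] and K = discrete_in[OF spacesD(2)[OF M]]
  have c: "c \<in> V" and \<nu>: "?\<nu> \<in> cocones pc_cat ?D pc_weight c" using cc by (simp_all add: colimit_cocone_def)
  have nK: "?n \<in> homs ?K c" using pc_coconesD(1)[OF \<nu>] by simp
  have rel: "pr (x, y) \<in> pts (fobj ?D (Level e))" "farr ?D (Level e) Base Lam (pr (x, y)) = x" "farr ?D (Level e) Base Rho (pr (x, y)) = y"
    if "x \<in> pts M" "y \<in> pts M" "ed M x y \<le> ennreal (real_of_rat e)" for x y e
    using that inj_pr by auto
  \<comment> \<open>The unit is given as a morphism on the discrete space only; the cocone
    conditions at all rational levels above a distance in \<open>M\<close> bound the distance in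
    \<open>c\<close>.\<close>
  have n: "?n \<in> homs M c"
  proof (rule homI)
    fix x y assume xy: "x \<in> pts M" "y \<in> pts M"
    show "ed c (?n x) (?n y) \<le> ed M x y"
    proof (rule le_if_rat_le)
      fix e :: rat assume e: "0 < e" "ed M x y \<le> ennreal (real_of_rat e)"
      show "ed c (?n x) (?n y) \<le> ennreal (real_of_rat e)"
        using pc_coconesD(4)[OF \<nu> e(1) rel(1)[OF xy e(2)]] by (simp only: rel[OF xy e(2)])
    qed
  qed (use hom_in[OF nK] hom_extensional[OF nK] in auto)
  have "\<exists>j\<in>homs c M. \<forall>z\<in>pts (fobj ?D Base). j (?n z) = (\<lambda>x\<in>pts M. x) z"
  proof (rule pc_colimit_factor[where u = "\<lambda>x\<in>pts M. x", OF cc D M spacesD(1)[OF M]])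
    fix e z assume "z \<in> pts (fobj ?D (Level e))"
    then obtain x y where xy: "x \<in> pts M" "y \<in> pts M" "ed M x y \<le> ennreal (real_of_rat e)" and z: "z = pr (x, y)"
      by auto
    then show "ed M ((\<lambda>x\<in>pts M. x) (farr ?D (Level e) Base Lam z)) ((\<lambda>x\<in>pts M. x) (farr ?D (Level e) Base Rho z)) \<le> ennreal (real_of_rat e)"
      unfolding z rel(2,3)[OF xy] by simp
  qed (simp only: precongruence_simps incl_in_homs[OF M])
  then obtain j where j: "j \<in> homs c M" and jn: "\<And>x. x \<in> pts M \<Longrightarrow> j (?n x) = x" by auto
  have "compose (pts c) ?n j = (\<lambda>y\<in>pts c. y)"
    by (rule pc_colimit_unique[OF cc D c hom_space_compose[OF j n] ident_in_hom])
      (simp add: compose_app hom_in[OF nK] jn)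
  then have nj: "?n (j y) = y" if "y \<in> pts c" for y
    using that by (metis compose_app restrict_apply')
  have jf: "compose A j f \<in> A \<rightarrow>\<^sub>E pts M" if "f \<in> A \<rightarrow>\<^sub>E pts c" for A and f :: "'u \<Rightarrow> 'u"
    using that hom_in[OF j] by (auto simp: compose_def)
  have dh: "f \<in> homs (discrete A) Y" if "f \<in> A \<rightarrow>\<^sub>E pts Y" "Y \<in> V" for A and f :: "'u \<Rightarrow> 'u" and Y :: "'u emet"
    using that by (simp add: homs_discrete spacesD(1))
  have dK: "f \<in> homs (discrete A) ?K" if "f \<in> A \<rightarrow>\<^sub>E pts M" for A and f :: "'u \<Rightarrow> 'u"
    using dh[OF _ K] that by simp
  have df: "discrete A \<in> V" if "finite A" for A using that by (blast intro: discrete_in small_finite)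
  let ?FD = "comp_fun F ?D"
  note FD = enriched_functor_comp_fun[OF F_functor D]
  have base: "image_cocone F pc_cat ?D pc_weight c ?\<nu> Base Zero = farr F ?K c ?n"
    by (simp add: image_cocone_def pc_cat_def pc_weight_def)
  have "colimit_cocone V pc_cat ?FD pc_weight (fobj F c) (image_cocone F pc_cat ?D pc_weight c ?\<nu>)"
  proof (rule pc_colimit_coconeI[OF FD met_functor_obj[OF F_functor c] image_cocone_in_cocones[OF F_functor D weight_pc c \<nu>], unfolded base])
    fix X u assume X: "X \<in> V" and u0: "u \<in> homs (fobj ?FD Base) X"
      and le: "\<And>e z. 0 < e \<Longrightarrow> z \<in> pts (fobj ?FD (Level e)) \<Longrightarrow>
        ed X (u (farr ?FD (Level e) Base Lam z)) (u (farr ?FD (Level e) Base Rho z)) \<le> ennreal (real_of_rat e)"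
    have u: "u \<in> homs (fobj F ?K) X" using u0 by simp
    \<comment> \<open>A map \<open>f : A \<rightarrow> c\<close> is moved by \<open>j\<close> to the
      points of \<open>M\<close>, where \<open>u\<close> lives; \<open>j\<close> is nonexpanding, so
      close maps stay close.\<close>
    let ?\<tau> = "\<lambda>A f. compose (pts (fobj F (discrete A))) u (farr F (discrete A) ?K (compose A j f))"
    have "\<exists>t\<in>homs (fobj F c) X. \<forall>A f z. finite A \<longrightarrow> f \<in> A \<rightarrow>\<^sub>E pts c \<longrightarrow> z \<in> pts (fobj F (discrete A)) \<longrightarrow>
      t (farr F (discrete A) c f z) = ?\<tau> A f z"
    proof (rule finite_family_extend[OF sf c X])
      show "?\<tau> A f \<in> homs (fobj F (discrete A)) X" if "finite A" "f \<in> A \<rightarrow>\<^sub>E pts c" for A f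
        by (rule hom_space_compose[OF met_functor_hom[OF F_functor df[OF that(1)] K dK[OF jf[OF that(2)]]] u])
    next
      fix A B :: "'u set" and a f z assume A: "finite A" "finite B" and a: "a \<in> A \<rightarrow>\<^sub>E B" and f: "f \<in> B \<rightarrow>\<^sub>E pts c"
        and z: "z \<in> pts (fobj F (discrete A))"
      have ah: "a \<in> homs (discrete A) (discrete B)" using dh[OF _ df[OF A(2)]] a by simp
      have "compose A j (compose A f a) = compose A (compose B j f) a"
        using a by (auto simp: compose_def fun_eq_iff)
      then show "?\<tau> A (compose A f a) z = ?\<tau> B f (farr F (discrete A) (discrete B) a z)"
        using z met_functor_in[OF F_functor df[OF A(1)] df[OF A(2)] ah z]
          met_functor_comp_app[OF F_functor df[OF A(1)] df[OF A(2)] K ah dK[OF jf[OF f]] z]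
        by (simp add: compose_app)
    next
      fix A f f' z assume A: "finite A" and f: "f \<in> A \<rightarrow>\<^sub>E pts c" "f' \<in> A \<rightarrow>\<^sub>E pts c" and z: "z \<in> pts (fobj F (discrete A))"
      show "ed X (?\<tau> A f z) (?\<tau> A f' z) \<le> ed (hom_space (discrete A) c) f f'"
      proof (rule le_if_rat_le)
        fix e :: rat assume e: "0 < e" "ed (hom_space (discrete A) c) f f' \<le> ennreal (real_of_rat e)"
        let ?L = "fobj ?D (Level e)"
        let ?p = "\<lambda>s\<in>A. pr (j (f s), j (f' s))"
        have m: "j (f s) \<in> pts M" "j (f' s) \<in> pts M" "ed M (j (f s)) (j (f' s)) \<le> ennreal (real_of_rat e)"
          if s: "s \<in> A" for s
        proof -
          have fs: "f s \<in> pts c" "f' s \<in> pts c" using f s by auto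
          show "j (f s) \<in> pts M" "j (f' s) \<in> pts M" using hom_in[OF j] fs by auto
          have "ed c (f s) (f' s) \<le> ennreal (real_of_rat e)" using e(2) s by (simp add: hom_ed_le_iff)
          then show "ed M (j (f s)) (j (f' s)) \<le> ennreal (real_of_rat e)"
            by (rule order_trans[OF hom_le[OF j fs]])
        qed
        have LV: "?L \<in> V" by (rule functor_obj[OF D pc_obj_in(2)[OF e(1)]])
        have p: "?p \<in> homs (discrete A) ?L"
          by (rule dh[OF _ LV]) (use rel(1)[OF m] in simp)
        note lam = functor_hom[OF D pc_obj_in(2)[OF e(1)] pc_obj_in(1) pc_obj_in(3)[OF e(1)]]
          and rho = functor_hom[OF D pc_obj_in(2)[OF e(1)] pc_obj_in(1) pc_obj_in(4)[OF e(1)]]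
        have KB: "fobj ?D Base = ?K" by simp
        have "compose A (farr ?D (Level e) Base Lam) ?p = compose A j f"
          "compose A (farr ?D (Level e) Base Rho) ?p = compose A j f'"
          unfolding compose_def by (rule restrict_ext, simp only: restrict_apply' rel[OF m])+
        then have "farr F (discrete A) ?K (compose A j f) z = farr ?FD (Level e) Base Lam (farr F (discrete A) ?L ?p z)"
          "farr F (discrete A) ?K (compose A j f') z = farr ?FD (Level e) Base Rho (farr F (discrete A) ?L ?p z)"
          using met_functor_comp_app[OF F_functor df[OF A] LV K p lam[unfolded KB] z]
            met_functor_comp_app[OF F_functor df[OF A] LV K p rho[unfolded KB] z]
          by (simp_all only: comp_fun_simps KB pts_discrete)
        then show "ed X (?\<tau> A f z) (?\<tau> A f' z) \<le> ennreal (real_of_rat e)"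
          using le[OF e(1), of "farr F (discrete A) ?L ?p z"] met_functor_in[OF F_functor df[OF A] LV p z] z
          by (simp only: compose_app comp_fun_simps)
      qed
    qed
    then obtain t where t: "t \<in> homs (fobj F c) X" and tf: "\<And>A f z. finite A \<Longrightarrow> f \<in> A \<rightarrow>\<^sub>E pts c \<Longrightarrow>
      z \<in> pts (fobj F (discrete A)) \<Longrightarrow> t (farr F (discrete A) c f z) = ?\<tau> A f z" by blast
    \<comment> \<open>\<open>t\<close> is known only on maps from finite sets, so the equation is
      obtained from uniqueness at the discrete space \<open>?K\<close> in place of
      \<open>c\<close>.\<close>
    have "compose (pts (fobj F ?K)) t (farr F ?K c ?n) = u"
    proof (rule finite_family_unique[OF sf K X hom_space_compose[OF met_functor_hom[OF F_functor K c nK] t] u])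
      fix A f z assume A: "finite A" and f0: "f \<in> A \<rightarrow>\<^sub>E pts ?K" and z: "z \<in> pts (fobj F (discrete A))"
      have f: "f \<in> A \<rightarrow>\<^sub>E pts M" using f0 by simp
      have "compose A ?n f \<in> A \<rightarrow>\<^sub>E pts c" using f hom_in[OF n] by (auto simp: compose_def)
      from tf[OF A this z] have "t (farr F (discrete A) c (compose A ?n f) z) = u (farr F (discrete A) ?K (compose A j (compose A ?n f)) z)"
        using z by (simp add: compose_app)
      also have "compose A j (compose A ?n f) = f"
        by (rule extensionalityI[of _ A]) (use f jn in \<open>auto simp: compose_app PiE_iff\<close>)
      finally show "compose (pts (fobj F ?K)) t (farr F ?K c ?n) (farr F (discrete A) ?K f z) = u (farr F (discrete A) ?K f z)"
        using met_functor_in[OF F_functor df[OF A] K dK[OF f] z] met_functor_comp_app[OF F_functor df[OF A] K c dK[OF f] nK z]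
        by (simp add: compose_app)
    qed
    then have "t (farr F ?K c ?n z) = u z" if "z \<in> pts (fobj F ?K)" for z
      using that by (metis compose_app)
    then show "\<exists>f\<in>homs (fobj F c) X. \<forall>z\<in>pts (fobj ?FD Base). f (farr F ?K c ?n z) = u z" using t by auto
  next
    fix X f g assume X: "X \<in> V" and f: "f \<in> homs (fobj F c) X" "g \<in> homs (fobj F c) X"
      and eq0: "\<And>z. z \<in> pts (fobj ?FD Base) \<Longrightarrow> f (farr F ?K c ?n z) = g (farr F ?K c ?n z)"
    have eq: "f (farr F ?K c ?n z) = g (farr F ?K c ?n z)" if "z \<in> pts (fobj F ?K)" for z
      using eq0 that by simp
    show "f = g"
    proof (rule finite_family_unique[OF sf c X f])
      fix A h z assume A: "finite A" and h: "h \<in> A \<rightarrow>\<^sub>E pts c" and z: "z \<in> pts (fobj F (discrete A))"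
      have "compose A ?n (compose A j h) = h"
        by (rule extensionalityI[of _ A]) (use h nj in \<open>auto simp: compose_app PiE_iff\<close>)
      then have "farr F (discrete A) c h z = farr F ?K c ?n (farr F (discrete A) ?K (compose A j h) z)"
        using met_functor_comp_app[OF F_functor df[OF A] K c dK[OF jf[OF h]] nK z] by simp
      then show "f (farr F (discrete A) c h z) = g (farr F (discrete A) c h z)"
        using eq[OF met_functor_in[OF F_functor df[OF A] K dK[OF jf[OF h]] z]] by simp
    qed
  qed
  then show "preserves_wcolimit V F pc_cat ?D pc_weight c \<psi>"
    unfolding preserves_wcolimit_iff[OF F_functor D weight_pc] .
qed

end

text \<open>Metric half of the extension to a closure: limit values inherit \<open>le\<close>. The
  case \<open>p = p'\<close> gives uniqueness of the limit value.\<close>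

lemma closure_relation_nonexpanding:
  assumes M: "ext_metric M" and X: "ext_metric X"
    and a: "\<And>i. i \<in> I \<Longrightarrow> a i \<in> pts M" and h: "\<And>i. i \<in> I \<Longrightarrow> h i \<in> pts X"
    and le: "\<And>i j. i \<in> I \<Longrightarrow> j \<in> I \<Longrightarrow> ed X (h i) (h j) \<le> ed M (a i) (a j)"
    and p: "p \<in> pts M" "p' \<in> pts M" and q: "q \<in> pts X" "q' \<in> pts X"
    and pq: "\<And>e. 0 < e \<Longrightarrow> \<exists>i\<in>I. ed M p (a i) < e \<and> ed X q (h i) < e"
    and pq': "\<And>e. 0 < e \<Longrightarrow> \<exists>i\<in>I. ed M p' (a i) < e \<and> ed X q' (h i) < e"
  shows "ed X q q' \<le> ed M p p'"
proof (rule ennreal_le_all_pos)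
  fix e :: ennreal assume "0 < e"
  then obtain d' where d': "0 < d'" "d' + d' \<le> e" using ennreal_half by blast
  \<comment> \<open>Two halvings, for four errors of size \<open>d\<close>: two in \<open>M\<close>
    and two in \<open>X\<close>.\<close>
  then obtain d where d: "0 < d" "d + d \<le> d'" using ennreal_half by blast
  obtain i where i: "i \<in> I" "ed M p (a i) < d" "ed X q (h i) < d" using pq[OF d(1)] by blast
  obtain j where j: "j \<in> I" "ed M p' (a j) < d" "ed X q' (h j) < d" using pq'[OF d(1)] by blast
  have "ed X q q' \<le> ed X q (h i) + ed X (h i) q'" by (rule ext_metric_tri[OF X q(1) h[OF i(1)] q(2)])
  also have "ed X (h i) q' \<le> ed X (h i) (h j) + ed X (h j) q'" by (rule ext_metric_tri[OF X h[OF i(1)] h[OF j(1)] q(2)])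
  also have "ed X (h i) (h j) \<le> ed M (a i) (a j)" by (rule le[OF i(1) j(1)])
  also have "ed M (a i) (a j) \<le> ed M (a i) p + ed M p (a j)" by (rule ext_metric_tri[OF M a[OF i(1)] p(1) a[OF j(1)]])
  also have "ed M p (a j) \<le> ed M p p' + ed M p' (a j)" by (rule ext_metric_tri[OF M p a[OF j(1)]])
  also have "ed M (a i) p \<le> d" using i(2) ext_metric_sym[OF M a[OF i(1)] p(1)] by simp
  also have "ed M p' (a j) \<le> d" using j(2) by simp
  also have "ed X q (h i) \<le> d" using i(3) by simp
  also have "ed X (h j) q' \<le> d" using j(3) ext_metric_sym[OF X h[OF j(1)] q(2)] by simp
  finally have "ed X q q' \<le> ed M p p' + ((d + d) + (d + d))" by (simp add: ac_simps add_mono)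
  also have "\<dots> \<le> ed M p p' + (d' + d')" by (intro add_mono d order_refl)
  also have "\<dots> \<le> ed M p p' + e" by (intro add_mono d' order_refl)
  finally show "ed X q q' \<le> ed M p p' + e" .
qed

text \<open>The distance |x - y|, with \<infinity> infinitely far from every finite point. The
  infimum avoids the truncated subtraction of \<open>ennreal\<close>.\<close>

definition ennreal_space :: "ennreal emet" where
  "ennreal_space = \<lparr>pts = UNIV, ed = (\<lambda>x y. INF e\<in>{e. x \<le> y + e \<and> y \<le> x + e}. e)\<rparr>"

text \<open>The infimum defining the distance is attained, since inequalities that hold with every
  positive surplus hold without it.\<close>

lemma ennreal_space_le_iff: "ed ennreal_space x y \<le> d \<longleftrightarrow> x \<le> y + d \<and> y \<le> x + d"
proof
  assume "x \<le> y + d \<and> y \<le> x + d"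
  then show "ed ennreal_space x y \<le> d" unfolding ennreal_space_def emet.simps by (intro INF_lower) simp
next
  assume le: "ed ennreal_space x y \<le> d"
  have "x \<le> y + d + e \<and> y \<le> x + d + e" if "0 < e" for e
  proof (cases "d = top")
    case False
    then have "d < d + e" using ennreal_add_left_cancel_less[of d 0 e] that by simp
    with le have "ed ennreal_space x y < d + e" by (rule order.strict_trans1)
    then obtain e' where "x \<le> y + e'" "y \<le> x + e'" "e' < d + e"
      by (auto simp: ennreal_space_def Inf_less_iff)
    moreover from this have "y + e' \<le> y + d + e" "x + e' \<le> x + d + e" by (simp_all add: add.assoc add_mono)
    ultimately show ?thesis by (meson order_trans)
  qed simp
  then show "x \<le> y + d \<and> y \<le> x + d" by (blast intro: ennreal_le_all_pos)
qed

lemma pts_ennreal_space [simp]: "pts ennreal_space = UNIV"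
  by (simp add: ennreal_space_def)

lemma ext_metric_ennreal_space: "ext_metric ennreal_space"
  unfolding ext_metric_def
proof (intro conjI ballI)
  fix x y z :: ennreal
  show "ed ennreal_space x y = 0 \<longleftrightarrow> x = y"
    using ennreal_space_le_iff[of x y 0] by auto
  show "ed ennreal_space x y = ed ennreal_space y x"
    by (simp add: ennreal_space_def conj_commute)
  have xy: "x \<le> y + ed ennreal_space x y" "y \<le> x + ed ennreal_space x y" using ennreal_space_le_iff by blast+
  have yz: "y \<le> z + ed ennreal_space y z" "z \<le> y + ed ennreal_space y z" using ennreal_space_le_iff by blast+
  have "x \<le> (z + ed ennreal_space y z) + ed ennreal_space x y"
    by (rule order_trans[OF xy(1)]) (intro add_mono yz order_refl)
  moreover have "z \<le> (x + ed ennreal_space x y) + ed ennreal_space y z"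
    by (rule order_trans[OF yz(2)]) (intro add_mono xy order_refl)
  ultimately show "ed ennreal_space x z \<le> ed ennreal_space x y + ed ennreal_space y z"
    unfolding ennreal_space_le_iff by (simp add: ac_simps)
qed

lemma complete_ennreal_space: "complete_emet ennreal_space"
  unfolding complete_emet_def
proof (intro allI impI, elim conjE)
  fix s :: "nat \<Rightarrow> ennreal"
  assume C: "\<forall>e>0. \<exists>N. \<forall>m\<ge>N. \<forall>n\<ge>N. ed ennreal_space (s m) (s n) < e"
  \<comment> \<open>The limit inferior exists for every sequence in a complete lattice, and the
    Cauchy bound keeps late terms within \<open>d\<close> of it.\<close>
  define L where "L = (SUP n. INF m\<in>{n..}. s m)"
  have "\<exists>N. \<forall>n\<ge>N. ed ennreal_space (s n) L < e" if "0 < e" for e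
  proof -
    obtain d where d: "0 < d" "d < e" using dense[OF \<open>0 < e\<close>] by blast
    have dt: "d \<noteq> top" using d(2) by auto
    obtain N where N: "\<And>m n. m \<ge> N \<Longrightarrow> n \<ge> N \<Longrightarrow> s m \<le> s n + d"
      using C d(1) ennreal_space_le_iff by (meson less_imp_le)
    have "ed ennreal_space (s n) L \<le> d" if n: "n \<ge> N" for n
      unfolding ennreal_space_le_iff
    proof
      have "s n - d \<le> (INF m\<in>{N..}. s m)"
      proof (rule INF_greatest)
        fix m assume "m \<in> {N..}"
        then show "s n - d \<le> s m" using N[OF n, of m] dt by (simp add: ennreal_minus_le_iff add.commute)
      qed
      also have "\<dots> \<le> L" unfolding L_def by (rule SUP_upper) simp
      finally show "s n \<le> L + d" using dt by (simp add: ennreal_minus_le_iff add.commute)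
      show "L \<le> s n + d"
        unfolding L_def
      proof (rule SUP_least)
        fix k
        have "(INF m\<in>{k..}. s m) \<le> s (max k N)" by (rule INF_lower) simp
        also have "\<dots> \<le> s n + d" by (rule N[OF _ n]) simp
        finally show "(INF m\<in>{k..}. s m) \<le> s n + d" .
      qed
    qed
    then show ?thesis using d(2) by (meson le_less_trans)
  qed
  then show "\<exists>x\<in>pts ennreal_space. \<forall>e>0. \<exists>N. \<forall>n\<ge>N. ed ennreal_space (s n) x < e" by auto
qed

lemma (in small_sets) ennreal_space_in_spaces: "ennreal_space \<in> spaces U b"
  by (simp add: spaces_def ext_metric_ennreal_space complete_ennreal_space small_ennreal)

section \<open>Directed colimits: density of the stages and eventual distances\<close>

locale directed_colimit = small_sets U pr for U :: "'u set set" and pr :: "'u \<times> 'u \<Rightarrow> 'u" +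
  fixes b :: bool and P :: "'u set" and r and D :: "('u, unit, 'u emet, 'u \<Rightarrow> 'u) efun" and c \<nu>
  assumes P: "P \<in> U" and dir: "directed_poset P r"
    and D: "enriched_functor (poset_cat P r) (met_cat (spaces U b)) D"
    and colimit: "colimit_cocone (spaces U b) (poset_cat P r) D conical_weight c \<nu>"
begin

abbreviation V where "V \<equiv> spaces U b :: 'u emet set"

definition n where "n p = \<nu> p ()"

lemma c_in: "c \<in> V"
  using colimit by (simp add: colimit_cocone_def)

lemma D_in: "p \<in> P \<Longrightarrow> fobj D p \<in> V"
  using functor_obj[OF D] by (simp add: poset_cat_def)

lemma r_refl: "p \<in> P \<Longrightarrow> (p, p) \<in> r"
  using dir by (auto simp: directed_poset_def order_on_defs refl_on_def)

lemma r_trans: "(p, q) \<in> r \<Longrightarrow> (q, t) \<in> r \<Longrightarrow> (p, t) \<in> r"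
  using dir unfolding directed_poset_def order_on_defs by (blast dest: transD)

lemma upper_bound: "finite K \<Longrightarrow> K \<subseteq> P \<Longrightarrow> \<exists>q\<in>P. \<forall>p\<in>K. (p, q) \<in> r"
proof (induction K rule: finite_induct)
  case empty
  then show ?case using dir by (auto simp: directed_poset_def)
next
  case (insert p K)
  then obtain q where q: "q \<in> P" "\<forall>p\<in>K. (p, q) \<in> r" by auto
  obtain t where t: "t \<in> P" "(p, t) \<in> r" "(q, t) \<in> r"
    using dir q(1) insert.prems unfolding directed_poset_def by blast
  then show ?case using q(2) r_trans by blast
qed

lemma step_hom: "p \<in> P \<Longrightarrow> q \<in> P \<Longrightarrow> (p, q) \<in> r \<Longrightarrow> farr D p q () \<in> homs (fobj D p) (fobj D q)"
  by (rule functor_hom[OF D]) (simp_all add: poset_cat_def)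

lemma step_comp:
  assumes "p \<in> P" "q \<in> P" "t \<in> P" "(p, q) \<in> r" "(q, t) \<in> r"
  shows "compose (pts (fobj D p)) (farr D q t ()) (farr D p q ()) = farr D p t ()"
  using functor_comp[OF D, of p q t "()" "()"] assms by (simp add: poset_cat_def)

lemma step_comp_app:
  assumes "p \<in> P" "q \<in> P" "t \<in> P" "(p, q) \<in> r" "(q, t) \<in> r" "z \<in> pts (fobj D p)"
  shows "farr D q t () (farr D p q () z) = farr D p t () z"
  using fun_cong[OF step_comp[OF assms(1-5)], of z] assms(6) by (simp add: compose_app)

lemma \<nu>_in: "\<nu> \<in> cocones (poset_cat P r) D conical_weight c"
  using colimit by (simp add: colimit_cocone_def)

lemma n_hom: "p \<in> P \<Longrightarrow> n p \<in> homs (fobj D p) c"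
  unfolding n_def by (rule coconesD(3)[OF \<nu>_in]) (simp_all add: poset_cat_def conical_weight_def)

lemma n_step_compose:
  assumes "p \<in> P" "q \<in> P" "(p, q) \<in> r"
  shows "compose (pts (fobj D p)) (n q) (farr D p q ()) = n p"
  using coconesD(5)[OF \<nu>_in, of q p "()" "()"] assms by (simp add: poset_cat_def conical_weight_def n_def)

lemma n_step:
  assumes "p \<in> P" "q \<in> P" "(p, q) \<in> r" "z \<in> pts (fobj D p)"
  shows "n q (farr D p q () z) = n p z"
  using fun_cong[OF n_step_compose[OF assms(1-3)], of z] assms(4) by (simp add: compose_app)

lemma factor:
  assumes X: "X \<in> V" and v: "\<And>p. p \<in> P \<Longrightarrow> v p \<in> homs (fobj D p) X"
    and eq: "\<And>p q z. p \<in> P \<Longrightarrow> q \<in> P \<Longrightarrow> (p, q) \<in> r \<Longrightarrow> z \<in> pts (fobj D p) \<Longrightarrow> v q (farr D p q () z) = v p z"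
  shows "\<exists>f\<in>homs c X. \<forall>p\<in>P. \<forall>z\<in>pts (fobj D p). f (n p z) = v p z"
proof -
  have "(\<lambda>p\<in>P. \<lambda>u. v p) \<in> cocones (poset_cat P r) D conical_weight X"
    by (rule conical_coconesI[OF spacesD(1)[OF X]]) (simp_all add: v step_hom eq)
  from colimit_cocone_factor[OF colimit X this] show ?thesis
    by (auto simp: poset_cat_def conical_weight_def n_def)
qed

lemma unique:
  assumes "X \<in> V" "f \<in> homs c X" "g \<in> homs c X"
    and "\<And>p z. p \<in> P \<Longrightarrow> z \<in> pts (fobj D p) \<Longrightarrow> f (n p z) = g (n p z)"
  shows "f = g"
  by (rule colimit_cocone_unique[OF colimit D weight_conical assms(1-3)])
    (use assms(4) in \<open>simp add: poset_cat_def n_def\<close>)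

text \<open>The closure of the images is a subspace through which the colimit cocone factors.\<close>

lemma images_dense: "closure_in b c (\<Union>p\<in>P. n p ` pts (fobj D p)) = pts c"
proof -
  let ?T = "\<Union>p\<in>P. n p ` pts (fobj D p)"
  let ?S = "subspace c (closure_in b c ?T)"
  have T: "?T \<subseteq> pts c" using hom_in[OF n_hom] by auto
  have S: "?S \<in> V"
  proof (rule subspace_closure_in_spaces[OF spacesD(1)[OF c_in] spacesD(3)[OF c_in] T])
    show "small U ?T" using P by (intro small_UN small_image spacesD(2)[OF D_in]) (simp_all add: small_iff_in)
  qed
  have nS: "n p \<in> homs (fobj D p) ?S" if p: "p \<in> P" for p
    using subset_closure_in[OF spacesD(1)[OF c_in] T, of b] p
    by (intro homI) (auto intro: hom_le[OF n_hom[OF p]] hom_extensional[OF n_hom[OF p]])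
  obtain g where g: "g \<in> homs c ?S" "\<forall>p\<in>P. \<forall>z\<in>pts (fobj D p). g (n p z) = n p z"
    using factor[OF S, of n] nS n_step by blast
  have gc: "g \<in> homs c c"
  proof (rule homI[OF hom_extensional[OF g(1)]])
    show "g x \<in> pts c" if "x \<in> pts c" for x
      using hom_in[OF g(1) that] closure_in_subset[OF T, of b] by auto
    show "ed c (g x) (g x') \<le> ed c x x'" if "x \<in> pts c" "x' \<in> pts c" for x x'
      using hom_le[OF g(1) that] by simp
  qed
  have "g = (\<lambda>x\<in>pts c. x)"
    by (rule unique[OF c_in gc ident_in_hom]) (use g(2) hom_in[OF n_hom] in auto)
  then have "pts c \<subseteq> closure_in b c ?T" using hom_in[OF g(1)] by auto
  then show ?thesis using closure_in_subset[OF T, of b] by blast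
qed

text \<open>
  The eventual distance to \<open>x\<close>, an infimum over the later stages, defines a cocone to \<open>[0,\<infinity>]\<close>.
\<close>

lemma eventually_close:
  assumes p: "p \<in> P" and x: "x \<in> pts (fobj D p)" and y: "y \<in> pts (fobj D p)"
    and less: "ed c (n p x) (n p y) < \<delta>"
  shows "\<exists>q\<in>P. (p, q) \<in> r \<and> ed (fobj D q) (farr D p q () x) (farr D p q () y) < \<delta>"
proof -
  obtain e :: "ennreal \<Rightarrow> 'u" where e: "inj e" using small_inj_on[OF small_ennreal] by blast
  let ?X = "image_space e ennreal_space"
  have X: "?X \<in> V" using e by (intro image_space_in_spaces ennreal_space_in_spaces) simp
  have edX: "ed ?X (e s) (e t) = ed ennreal_space s t" for s t
    using e by (intro ed_image_space) simp_all
  define dist where "dist m z q = ed (fobj D q) (farr D p q () x) (farr D m q () z)" for m z q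
  \<comment> \<open>Transition maps do not increase distances, so the infimum is the eventual
    distance; at stages above both \<open>p\<close> and \<open>m\<close>, both points are
    available.\<close>
  define v where "v m z = (INF q\<in>{q \<in> P. (p, q) \<in> r \<and> (m, q) \<in> r}. dist m z q)" for m z
  have v_le: "v m z \<le> v m z' + ed (fobj D m) z z'" if m: "m \<in> P" and z: "z \<in> pts (fobj D m)" "z' \<in> pts (fobj D m)" for m z z'
  proof -
    have "v m z \<le> v m z' + ed (fobj D m) z z' + d" if d: "0 < d" for d
    proof (cases "v m z' = top")
      case False
      then have "v m z' < v m z' + d" using ennreal_add_left_cancel_less[of "v m z'" 0 d] d by simp
      then obtain q where q: "q \<in> P" "(p, q) \<in> r" "(m, q) \<in> r" "dist m z' q < v m z' + d"
        by (subst (asm) v_def) (auto simp: INF_less_iff)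
      have "v m z \<le> dist m z q" unfolding v_def by (rule INF_lower) (use q in simp)
      also have "\<dots> \<le> dist m z' q + ed (fobj D q) (farr D m q () z') (farr D m q () z)"
        unfolding dist_def
        by (rule ext_metric_tri[OF spacesD(1)[OF D_in[OF q(1)]]])
          (rule hom_in[OF step_hom[OF p q(1,2)] x] hom_in[OF step_hom[OF m q(1,3)]] z)+
      also have "ed (fobj D q) (farr D m q () z') (farr D m q () z) \<le> ed (fobj D m) z' z"
        by (rule hom_le[OF step_hom[OF m q(1,3)] z(2,1)])
      also have "ed (fobj D m) z' z = ed (fobj D m) z z'" by (rule ext_metric_sym[OF spacesD(1)[OF D_in[OF m]] z(2,1)])
      also have "dist m z' q \<le> v m z' + d" using q(4) by simp
      finally show ?thesis by (simp add: ac_simps add_mono)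
    qed simp
    then show ?thesis by (rule ennreal_le_all_pos)
  qed
  have "\<exists>w\<in>homs c ?X. \<forall>m\<in>P. \<forall>z\<in>pts (fobj D m). w (n m z) = (\<lambda>z\<in>pts (fobj D m). e (v m z)) z"
  proof (rule factor[OF X])
    fix m assume m: "m \<in> P"
    show "(\<lambda>z\<in>pts (fobj D m). e (v m z)) \<in> homs (fobj D m) ?X"
    proof (rule restrict_homI)
      fix z z' assume z: "z \<in> pts (fobj D m)" "z' \<in> pts (fobj D m)"
      show "ed ?X (e (v m z)) (e (v m z')) \<le> ed (fobj D m) z z'"
        unfolding edX ennreal_space_le_iff
        using v_le[OF m z] v_le[OF m z(2,1)] ext_metric_sym[OF spacesD(1)[OF D_in[OF m]] z] by simp
    qed simp
  next
    fix m m' z assume m: "m \<in> P" "m' \<in> P" "(m, m') \<in> r" and z: "z \<in> pts (fobj D m)"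
    let ?z = "farr D m m' () z"
    have dist_eq: "dist m' ?z q = dist m z q" if "q \<in> P" "(m', q) \<in> r" for q
      unfolding dist_def step_comp_app[OF m(1,2) that(1) m(3) that(2) z] ..
    have "v m z \<le> v m' ?z"
      unfolding v_def
    proof (rule INF_greatest)
      fix q assume q: "q \<in> {q \<in> P. (p, q) \<in> r \<and> (m', q) \<in> r}"
      then show "(INF q\<in>{q \<in> P. (p, q) \<in> r \<and> (m, q) \<in> r}. dist m z q) \<le> dist m' ?z q"
        using dist_eq[of q] r_trans[OF m(3), of q] by (intro INF_lower2[of q]) auto
    qed
    moreover have "v m' ?z \<le> v m z"
      unfolding v_def
    proof (rule INF_greatest)
      fix q assume "q \<in> {q \<in> P. (p, q) \<in> r \<and> (m, q) \<in> r}"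
      then have q: "q \<in> P" "(p, q) \<in> r" "(m, q) \<in> r" by simp_all
      \<comment> \<open>A stage above \<open>m\<close> need not lie above \<open>m'\<close>; moving
        on to a common upper bound only decreases the distance.\<close>
      obtain q' where q': "q' \<in> P" "(q, q') \<in> r" "(m', q') \<in> r"
        using upper_bound[of "{q, m'}"] q(1) m(2) by auto
      have "dist m' ?z q' = dist m z q'" using dist_eq q' by blast
      also have "\<dots> = ed (fobj D q') (farr D q q' () (farr D p q () x)) (farr D q q' () (farr D m q () z))"
        unfolding dist_def step_comp_app[OF p q(1) q'(1) q(2) q'(2) x] step_comp_app[OF m(1) q(1) q'(1) q(3) q'(2) z] ..
      also have "\<dots> \<le> dist m z q"
        unfolding dist_def
        by (rule hom_le[OF step_hom[OF q(1) q'(1,2)] hom_in[OF step_hom[OF p q(1,2)] x] hom_in[OF step_hom[OF m(1) q(1,3)] z]])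
      finally show "(INF q\<in>{q \<in> P. (p, q) \<in> r \<and> (m', q) \<in> r}. dist m' ?z q) \<le> dist m z q"
        using q' r_trans[OF q(2) q'(2)] by (intro INF_lower2[of q']) auto
    qed
    ultimately have "v m' ?z = v m z" by (rule order_antisym[rotated])
    then show "(\<lambda>z\<in>pts (fobj D m'). e (v m' z)) ?z = (\<lambda>z\<in>pts (fobj D m). e (v m z)) z"
      using z hom_in[OF step_hom[OF m] z] by simp
  qed
  then obtain w where w: "w \<in> homs c ?X" "\<And>m z. m \<in> P \<Longrightarrow> z \<in> pts (fobj D m) \<Longrightarrow> w (n m z) = e (v m z)"
    by auto
  \<comment> \<open>The induced map takes the value 0 at \<open>n p x\<close>, so its nonexpansion
    bounds the eventual distance of \<open>x\<close> and \<open>y\<close> by their distance in the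
    colimit.\<close>
  have "v p x \<le> dist p x p" unfolding v_def by (rule INF_lower) (simp add: p r_refl)
  also have "dist p x p = 0"
    unfolding dist_def
    by (rule ext_metric_refl[OF spacesD(1)[OF D_in[OF p]] hom_in[OF step_hom[OF p p r_refl[OF p]] x]])
  finally have "v p x = 0" by simp
  moreover have "ed ?X (w (n p x)) (w (n p y)) \<le> ed c (n p x) (n p y)"
    by (rule hom_le[OF w(1) hom_in[OF n_hom[OF p] x] hom_in[OF n_hom[OF p] y]])
  then have "v p y \<le> v p x + ed c (n p x) (n p y)"
    unfolding w(2)[OF p x] w(2)[OF p y] edX ennreal_space_le_iff by simp
  ultimately have "v p y < \<delta>" using less by simp
  then show ?thesis unfolding v_def dist_def INF_less_iff by blast
qed

end

lemma colimit_coconeI: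
  assumes c: "c \<in> V" and \<nu>: "\<nu> \<in> cocones C D W c"
    and ex: "\<And>X \<tau>. X \<in> V \<Longrightarrow> \<tau> \<in> cocones C D W X \<Longrightarrow>
      \<exists>f\<in>homs c X. \<forall>d\<in>Obj C. \<forall>w\<in>pts (fobj W d). \<forall>z\<in>pts (fobj D d). f (\<nu> d w z) = \<tau> d w z"
    and un: "\<And>X f g. X \<in> V \<Longrightarrow> f \<in> homs c X \<Longrightarrow> g \<in> homs c X \<Longrightarrow>
      (\<And>d w z. d \<in> Obj C \<Longrightarrow> w \<in> pts (fobj W d) \<Longrightarrow> z \<in> pts (fobj D d) \<Longrightarrow> f (\<nu> d w z) = g (\<nu> d w z)) \<Longrightarrow> f = g"
  shows "colimit_cocone V C D W c \<nu>"
  unfolding colimit_cocone_def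
proof (intro conjI ballI c \<nu>)
  fix X \<tau> assume X: "X \<in> V" and \<tau>: "\<tau> \<in> cocones C D W X"
  obtain f where f: "f \<in> homs c X"
    "\<forall>d\<in>Obj C. \<forall>w\<in>pts (fobj W d). \<forall>z\<in>pts (fobj D d). f (\<nu> d w z) = \<tau> d w z"
    using ex[OF X \<tau>] by blast
  show "\<exists>!f. f \<in> homs c X \<and> (\<forall>d\<in>Obj C. \<forall>w\<in>pts (fobj W d). compose (pts (fobj D d)) f (\<nu> d w) = \<tau> d w)"
  proof (intro ex1I[of _ f] conjI ballI f(1))
    fix d w assume d: "d \<in> Obj C" "w \<in> pts (fobj W d)"
    show "compose (pts (fobj D d)) f (\<nu> d w) = \<tau> d w"
      by (rule extensionalityI[OF compose_extensional hom_extensional[OF coconesD(3)[OF \<tau> d]]])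
        (use f(2) d in \<open>simp add: compose_app\<close>)
  next
    fix g assume g: "g \<in> homs c X \<and> (\<forall>d\<in>Obj C. \<forall>w\<in>pts (fobj W d). compose (pts (fobj D d)) g (\<nu> d w) = \<tau> d w)"
    show "g = f"
    proof (rule un[OF X conjunct1[OF g] f(1)])
      fix d w z assume d: "d \<in> Obj C" "w \<in> pts (fobj W d)" "z \<in> pts (fobj D d)"
      have "compose (pts (fobj D d)) g (\<nu> d w) = \<tau> d w" using g d by blast
      from fun_cong[OF this, of z] show "g (\<nu> d w z) = f (\<nu> d w z)" using f(2) d by (simp add: compose_app)
    qed
  qed
qed

context directed_colimit
begin

text \<open>\<open>R s\<close> speaks about a point of the colimit, so it survives transition maps,
  and finitely many lifts can be pushed to one later stage.\<close>

lemma lift_finite: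
  assumes A: "finite A" and R: "\<And>s. s \<in> A \<Longrightarrow> \<exists>k\<in>P. \<exists>z\<in>pts (fobj D k). R s (n k z)"
  shows "\<exists>k\<in>P. \<exists>g\<in>A \<rightarrow>\<^sub>E pts (fobj D k). \<forall>s\<in>A. R s (n k (g s))"
proof -
  have "\<forall>s\<in>A. \<exists>kz. fst kz \<in> P \<and> snd kz \<in> pts (fobj D (fst kz)) \<and> R s (n (fst kz) (snd kz))"
    using R by fastforce
  from bchoice[OF this] obtain kz where
    kz: "\<And>s. s \<in> A \<Longrightarrow> fst (kz s) \<in> P" "\<And>s. s \<in> A \<Longrightarrow> snd (kz s) \<in> pts (fobj D (fst (kz s)))"
      "\<And>s. s \<in> A \<Longrightarrow> R s (n (fst (kz s)) (snd (kz s)))" by blast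
  obtain q where q: "q \<in> P" "\<And>s. s \<in> A \<Longrightarrow> (fst (kz s), q) \<in> r"
    using upper_bound[of "(\<lambda>s. fst (kz s)) ` A"] A kz(1) by auto
  let ?g = "\<lambda>s\<in>A. farr D (fst (kz s)) q () (snd (kz s))"
  have "?g \<in> A \<rightarrow>\<^sub>E pts (fobj D q)" using hom_in[OF step_hom[OF kz(1) q(1) q(2)] kz(2)] by auto
  moreover have "R s (n q (?g s))" if s: "s \<in> A" for s
    using kz(3)[OF s] n_step[OF kz(1)[OF s] q(1) q(2)[OF s] kz(2)[OF s]] s by simp
  ultimately show ?thesis using q(1) by blast
qed

lemma compose_n_in_homs:
  "k \<in> P \<Longrightarrow> g \<in> A \<rightarrow>\<^sub>E pts (fobj D k) \<Longrightarrow> compose A (n k) g \<in> A \<rightarrow>\<^sub>E pts c"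
  using hom_in[OF n_hom] by (auto simp: compose_def)

text \<open>Density of the images of the stages at each point of \<open>A\<close>, collected at one
  stage. The supremum over \<open>A\<close> weakens the pointwise bounds, hence the smaller
  \<open>d\<close> in the complete case.\<close>

lemma finite_maps_dense:
  assumes A: "finite A" and f: "f \<in> A \<rightarrow>\<^sub>E pts c"
  shows "f \<in> closure_in b (hom_space (discrete A) c)
    ((\<lambda>(k, g). compose A (n k) g) ` {(k, g). k \<in> P \<and> g \<in> A \<rightarrow>\<^sub>E pts (fobj D k)})" (is "f \<in> closure_in b ?H ?T")
proof (cases b)
  case False
  have "\<exists>k\<in>P. \<exists>g\<in>A \<rightarrow>\<^sub>E pts (fobj D k). \<forall>s\<in>A. f s = n k (g s)"
  proof (rule lift_finite[OF A])
    fix s assume "s \<in> A"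
    then have "f s \<in> closure_in b c (\<Union>p\<in>P. n p ` pts (fobj D p))" using f images_dense by auto
    then show "\<exists>k\<in>P. \<exists>z\<in>pts (fobj D k). f s = n k z" using False by (auto simp: closure_in_def)
  qed
  then obtain k g where kg: "k \<in> P" "g \<in> A \<rightarrow>\<^sub>E pts (fobj D k)" "\<forall>s\<in>A. f s = n k (g s)" by blast
  have "f = compose A (n k) g"
    by (rule extensionalityI[of _ A]) (use f kg(3) in \<open>auto simp: compose_app PiE_iff\<close>)
  then have "f \<in> ?T" using kg by (auto intro!: image_eqI[of _ _ "(k, g)"])
  then show ?thesis using False by (simp add: closure_in_def)
next
  case True
  have "\<exists>h\<in>?T. ed ?H f h < e" if "0 < e" for e
  proof -
    obtain d where d: "0 < d" "d < e" using dense[OF \<open>0 < e\<close>] by blast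
    have "\<exists>k\<in>P. \<exists>g\<in>A \<rightarrow>\<^sub>E pts (fobj D k). \<forall>s\<in>A. ed c (f s) (n k (g s)) < d"
    proof (rule lift_finite[OF A])
      fix s assume "s \<in> A"
      then have "f s \<in> closure_in b c (\<Union>p\<in>P. n p ` pts (fobj D p))" using f images_dense by auto
      then show "\<exists>k\<in>P. \<exists>z\<in>pts (fobj D k). ed c (f s) (n k z) < d" using True d(1) by (fastforce simp: closure_in_def)
    qed
    then obtain k g where kg: "k \<in> P" "g \<in> A \<rightarrow>\<^sub>E pts (fobj D k)" "\<forall>s\<in>A. ed c (f s) (n k (g s)) < d" by blast
    have "ed ?H f (compose A (n k) g) \<le> d"
      unfolding hom_ed_le_iff using kg(3) by (auto simp: compose_app less_imp_le)
    then have "ed ?H f (compose A (n k) g) < e" using d(2) by (rule order.strict_trans1)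
    moreover have "compose A (n k) g \<in> ?T" using kg by (auto intro!: image_eqI[of _ _ "(k, g)"])
    ultimately show ?thesis by blast
  qed
  moreover have "f \<in> pts ?H" using f by (simp add: homs_discrete spacesD(1)[OF c_in])
  ultimately show ?thesis using True by (simp add: closure_in_def)
qed

text \<open>Each point of \<open>A\<close> has its own stage of closeness; a common later stage
  serves all of them because transition maps are nonexpanding.\<close>

lemma finite_maps_eventually_close:
  assumes A: "finite A" and k: "k \<in> P" "k' \<in> P" and g: "g \<in> A \<rightarrow>\<^sub>E pts (fobj D k)" "g' \<in> A \<rightarrow>\<^sub>E pts (fobj D k')"
    and less: "ed (hom_space (discrete A) c) (compose A (n k) g) (compose A (n k') g') < \<delta>"
  shows "\<exists>q\<in>P. (k, q) \<in> r \<and> (k', q) \<in> r \<and>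
    ed (hom_space (discrete A) (fobj D q)) (compose A (farr D k q ()) g) (compose A (farr D k' q ()) g') \<le> \<delta>"
proof -
  obtain l where l: "l \<in> P" "(k, l) \<in> r" "(k', l) \<in> r" using upper_bound[of "{k, k'}"] k by auto
  let ?x = "\<lambda>s. farr D k l () (g s)" and ?y = "\<lambda>s. farr D k' l () (g' s)"
  have gs: "g s \<in> pts (fobj D k)" "g' s \<in> pts (fobj D k')" if "s \<in> A" for s using g that by auto
  have xy: "?x s \<in> pts (fobj D l)" "?y s \<in> pts (fobj D l)" if "s \<in> A" for s
    using hom_in[OF step_hom[OF k(1) l(1,2)]] hom_in[OF step_hom[OF k(2) l(1,3)]] gs that by auto
  have "\<forall>s\<in>A. \<exists>q. q \<in> P \<and> (l, q) \<in> r \<and> ed (fobj D q) (farr D l q () (?x s)) (farr D l q () (?y s)) < \<delta>"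
  proof
    fix s assume s: "s \<in> A"
    have "ed c (n l (?x s)) (n l (?y s)) = ed c (compose A (n k) g s) (compose A (n k') g' s)"
      using n_step[OF k(1) l(1,2) gs(1)[OF s]] n_step[OF k(2) l(1,3) gs(2)[OF s]] s by (simp add: compose_app)
    also have "\<dots> \<le> ed (hom_space (discrete A) c) (compose A (n k) g) (compose A (n k') g')"
      using s by (intro hom_ed_ge) simp
    finally have "ed c (n l (?x s)) (n l (?y s)) < \<delta>" using less by (rule order.strict_trans1)
    from eventually_close[OF l(1) xy[OF s] this]
    show "\<exists>q. q \<in> P \<and> (l, q) \<in> r \<and> ed (fobj D q) (farr D l q () (?x s)) (farr D l q () (?y s)) < \<delta>" by blast
  qed
  from bchoice[OF this] obtain m where m: "\<And>s. s \<in> A \<Longrightarrow> m s \<in> P" "\<And>s. s \<in> A \<Longrightarrow> (l, m s) \<in> r"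
    "\<And>s. s \<in> A \<Longrightarrow> ed (fobj D (m s)) (farr D l (m s) () (?x s)) (farr D l (m s) () (?y s)) < \<delta>" by blast
  have "\<exists>q\<in>P. \<forall>p\<in>insert l (m ` A). (p, q) \<in> r" using A l(1) m(1) by (intro upper_bound) auto
  then obtain q where q: "q \<in> P" "(l, q) \<in> r" "\<And>s. s \<in> A \<Longrightarrow> (m s, q) \<in> r" by auto
  have kq: "(k, q) \<in> r" "(k', q) \<in> r" using r_trans l q(2) by blast+
  have "ed (fobj D q) (farr D k q () (g s)) (farr D k' q () (g' s)) \<le> \<delta>" if s: "s \<in> A" for s
  proof -
    have 1: "farr D k q () (g s) = farr D (m s) q () (farr D l (m s) () (?x s))"
      using step_comp_app[OF k(1) l(1) q(1) l(2) q(2) gs(1)[OF s]]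
        step_comp_app[OF l(1) m(1)[OF s] q(1) m(2)[OF s] q(3)[OF s] xy(1)[OF s]] by simp
    have 2: "farr D k' q () (g' s) = farr D (m s) q () (farr D l (m s) () (?y s))"
      using step_comp_app[OF k(2) l(1) q(1) l(3) q(2) gs(2)[OF s]]
        step_comp_app[OF l(1) m(1)[OF s] q(1) m(2)[OF s] q(3)[OF s] xy(2)[OF s]] by simp
    note h = hom_in[OF step_hom[OF l(1) m(1)[OF s] m(2)[OF s]]]
    have "ed (fobj D q) (farr D k q () (g s)) (farr D k' q () (g' s))
      \<le> ed (fobj D (m s)) (farr D l (m s) () (?x s)) (farr D l (m s) () (?y s))"
      unfolding 1 2
      by (rule hom_le[OF step_hom[OF m(1)[OF s] q(1) q(3)[OF s]] h[OF xy(1)[OF s]] h[OF xy(2)[OF s]]])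
    then show ?thesis using m(3)[OF s] by simp
  qed
  then show ?thesis using q(1) kq unfolding hom_ed_le_iff by (auto simp: compose_app intro!: bexI[of _ q])
qed

end

section \<open>Strong finitarity and directed colimits\<close>

context met_endofunctor
begin

lemma strongly_finitary_preserves_directed:
  assumes sf: "strongly_finitary V F"
  shows "preserves_directed_colimits U V F"
  unfolding preserves_directed_colimits_def
proof (intro allI impI)
  fix P r and D :: "('u, unit, 'u emet, 'u \<Rightarrow> 'u) efun" and c \<psi>
  assume P: "P \<in> U" and dir: "directed_poset P r" and D: "enriched_functor (poset_cat P r) (met_cat V) D"
    and wc: "wcolimit V (poset_cat P r) D conical_weight c \<psi>"
  interpret dc: directed_colimit U pr b P r D c "wcolimit_unit c \<psi>"
    by unfold_locales (rule P dir D wcolimit_imp_colimit_cocone[OF wc])+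
  note c = dc.c_in and Dp = dc.D_in
  let ?FD = "comp_fun F D"
  note FD = enriched_functor_comp_fun[OF F_functor D]
  have df: "discrete A \<in> V" if "finite A" for A using that by (blast intro: discrete_in small_finite)
  have dh: "f \<in> homs (discrete A) Y" if "f \<in> A \<rightarrow>\<^sub>E pts Y" "Y \<in> V" for A and f :: "'u \<Rightarrow> 'u" and Y :: "'u emet"
    using that by (simp add: homs_discrete spacesD(1))
  have \<nu>: "image_cocone F (poset_cat P r) D conical_weight c (wcolimit_unit c \<psi>) p w = farr F (fobj D p) c (dc.n p)"
    if "p \<in> P" for p w
    using that by (simp add: image_cocone_def poset_cat_def conical_weight_def dc.n_def)
  have Fn: "farr F (discrete A) c (compose A (dc.n k) g) z = farr F (fobj D k) c (dc.n k) (farr F (discrete A) (fobj D k) g z)"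
    if "finite A" "k \<in> P" "g \<in> A \<rightarrow>\<^sub>E pts (fobj D k)" "z \<in> pts (fobj F (discrete A))" for A k g z
    using met_functor_comp_app[OF F_functor df[OF that(1)] Dp[OF that(2)] c dh[OF that(3) Dp[OF that(2)]] dc.n_hom[OF that(2)] that(4)]
    by simp
  \<comment> \<open>A map from a finite set to the colimit is only a limit of stage maps, so the two
    values at it are compared with their common value at a nearby stage map.\<close>
  have uniq: "t = t'" if X: "X \<in> V" and t: "t \<in> homs (fobj F c) X" "t' \<in> homs (fobj F c) X"
    and eq: "\<And>p z. p \<in> P \<Longrightarrow> z \<in> pts (fobj F (fobj D p)) \<Longrightarrow> t (farr F (fobj D p) c (dc.n p) z) = t' (farr F (fobj D p) c (dc.n p) z)"
    for X t t'
  proof (rule finite_family_unique[OF sf c X t])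
    fix A f z assume A: "finite A" and f: "f \<in> A \<rightarrow>\<^sub>E pts c" and z: "z \<in> pts (fobj F (discrete A))"
    note fh = dh[OF f c]
    have Fz: "farr F (discrete A) c h z \<in> pts (fobj F c)" if "h \<in> homs (discrete A) c" for h
      by (rule met_functor_in[OF F_functor df[OF A] c that z])
    show "t (farr F (discrete A) c f z) = t' (farr F (discrete A) c f z)"
    proof (rule ext_metric_eqI[OF spacesD(1)[OF X] hom_in[OF t(1) Fz[OF fh]] hom_in[OF t(2) Fz[OF fh]]])
      fix e :: ennreal assume e: "0 < e"
      have T: "(\<lambda>(k, g). compose A (dc.n k) g) ` {(k, g). k \<in> P \<and> g \<in> A \<rightarrow>\<^sub>E pts (fobj D k)} \<subseteq> homs (discrete A) c"
        using dh[OF dc.compose_n_in_homs c] by auto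
      obtain k g where k: "k \<in> P" and g: "g \<in> A \<rightarrow>\<^sub>E pts (fobj D k)" and
        close: "ed (hom_space (discrete A) c) f (compose A (dc.n k) g) < e"
        using closure_in_approx[OF ext_metric_hom_space[OF ext_metric_discrete spacesD(1)[OF c]] T dc.finite_maps_dense[OF A f] e] by auto
      let ?h = "compose A (dc.n k) g"
      note h = dh[OF dc.compose_n_in_homs[OF k g] c]
      have le: "ed X (s (farr F (discrete A) c f z)) (s (farr F (discrete A) c ?h z)) \<le> e"
        if s: "s \<in> homs (fobj F c) X" for s
      proof -
        have "ed X (s (farr F (discrete A) c f z)) (s (farr F (discrete A) c ?h z))
          \<le> ed (fobj F c) (farr F (discrete A) c f z) (farr F (discrete A) c ?h z)"
          by (rule hom_le[OF s Fz[OF fh] Fz[OF h]])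
        also have "\<dots> \<le> ed (hom_space (fobj F (discrete A)) (fobj F c)) (farr F (discrete A) c f) (farr F (discrete A) c ?h)"
          by (rule hom_ed_ge[OF z])
        also have "\<dots> \<le> ed (hom_space (discrete A) c) f ?h" by (rule met_functor_le[OF F_functor df[OF A] c fh h])
        finally show ?thesis using close by simp
      qed
      have "t (farr F (discrete A) c ?h z) = t' (farr F (discrete A) c ?h z)"
        unfolding Fn[OF A k g z] by (rule eq[OF k met_functor_in[OF F_functor df[OF A] Dp[OF k] dh[OF g Dp[OF k]] z]])
      then show "\<exists>y\<in>pts X. ed X (t (farr F (discrete A) c f z)) y \<le> e \<and> ed X (t' (farr F (discrete A) c f z)) y \<le> e"
        using le[OF t(1)] le[OF t(2)] hom_in[OF t(1) Fz[OF h]] by (intro bexI[of _ "t (farr F (discrete A) c ?h z)"]) simp_all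
    qed
  qed
  have ex: "\<exists>t\<in>homs (fobj F c) X. \<forall>p\<in>P. \<forall>z\<in>pts (fobj F (fobj D p)). t (farr F (fobj D p) c (dc.n p) z) = u p z"
    if X: "X \<in> V" and u: "\<And>p. p \<in> P \<Longrightarrow> u p \<in> homs (fobj F (fobj D p)) X"
      and u_step: "\<And>p q z. p \<in> P \<Longrightarrow> q \<in> P \<Longrightarrow> (p, q) \<in> r \<Longrightarrow> z \<in> pts (fobj F (fobj D p)) \<Longrightarrow>
        u q (farr F (fobj D p) (fobj D q) (farr D p q ()) z) = u p z" for X u
  proof -
    \<comment> \<open>An index is a map \<open>g\<close> from \<open>A\<close> to a stage
      \<open>k\<close>. It stands for the map \<open>?a\<close> into the colimit and for the
      morphism \<open>?h\<close> that \<open>u\<close> attaches to it; one map into the colimit may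
      have many indices.\<close>
    let ?I = "\<lambda>A :: 'u set. {(k, g). k \<in> P \<and> g \<in> A \<rightarrow>\<^sub>E pts (fobj D k)}"
    let ?a = "\<lambda>(A :: 'u set) (k, g). compose A (dc.n k) g"
    let ?h = "\<lambda>(A :: 'u set) (k, g). compose (pts (fobj F (discrete A))) (u k) (farr F (discrete A) (fobj D k) g)"
    let ?M = "\<lambda>A :: 'u set. hom_space (discrete A) c" and ?X = "\<lambda>A :: 'u set. hom_space (fobj F (discrete A)) X"
    have M: "ext_metric (?M A)" for A by (rule ext_metric_hom_space[OF ext_metric_discrete spacesD(1)[OF c]])
    have FX: "ext_metric (?X A)" if "finite A" for A
      by (rule ext_metric_hom_space[OF spacesD(1)[OF met_functor_obj[OF F_functor df[OF that]]] spacesD(1)[OF X]])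
    have FXc: "complete_emet (?X A)" if b for A
      by (rule complete_hom_space[OF spacesD(3)[OF X that] spacesD(1)[OF X]])
    have a: "?a A i \<in> pts (?M A)" if "i \<in> ?I A" for A i
      using that dh[OF dc.compose_n_in_homs c] by auto
    have h: "?h A i \<in> pts (?X A)" if "finite A" "i \<in> ?I A" for A i
      using that(2) hom_space_compose[OF met_functor_hom[OF F_functor df[OF that(1)] Dp dh[OF _ Dp]] u] by auto
    \<comment> \<open>Any bound strictly above the distance in the colimit is met at a common later
      stage \<open>q\<close>, where \<open>F\<close> is locally nonexpanding and \<open>u q\<close>
      nonexpanding; letting the bound decrease gives the claim.\<close>
    have le: "ed (?X A) (?h A i) (?h A j) \<le> ed (?M A) (?a A i) (?a A j)"
      if A: "finite A" and i: "i \<in> ?I A" and j: "j \<in> ?I A" for A i j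
    proof (rule dense_ge)
      fix \<delta> assume less: "ed (?M A) (?a A i) (?a A j) < \<delta>"
      obtain k g where k: "i = (k, g)" "k \<in> P" "g \<in> A \<rightarrow>\<^sub>E pts (fobj D k)" using i by auto
      obtain k' g' where k': "j = (k', g')" "k' \<in> P" "g' \<in> A \<rightarrow>\<^sub>E pts (fobj D k')" using j by auto
      obtain q where q: "q \<in> P" "(k, q) \<in> r" "(k', q) \<in> r" and
        close: "ed (hom_space (discrete A) (fobj D q)) (compose A (farr D k q ()) g) (compose A (farr D k' q ()) g') \<le> \<delta>"
        using dc.finite_maps_eventually_close[OF A k(2) k'(2) k(3) k'(3)] less k(1) k'(1) by auto
      have h_eq: "?h A (k, g) z = u q (farr F (discrete A) (fobj D q) (compose A (farr D k q ()) g) z)"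
        if k: "k \<in> P" "(k, q) \<in> r" and g: "g \<in> A \<rightarrow>\<^sub>E pts (fobj D k)" and z: "z \<in> pts (fobj F (discrete A))" for k g z
        using u_step[OF k(1) q(1) k(2) met_functor_in[OF F_functor df[OF A] Dp[OF k(1)] dh[OF g Dp[OF k(1)]] z]] z
          met_functor_comp_app[OF F_functor df[OF A] Dp[OF k(1)] Dp[OF q(1)] dh[OF g Dp[OF k(1)]] dc.step_hom[OF k(1) q(1) k(2)] z]
        by (simp add: compose_app)
      have st: "compose A (farr D k q ()) g \<in> homs (discrete A) (fobj D q)"
        if "k \<in> P" "(k, q) \<in> r" "g \<in> A \<rightarrow>\<^sub>E pts (fobj D k)" for k g
        using hom_space_compose[OF dh[OF that(3) Dp[OF that(1)]] dc.step_hom[OF that(1) q(1) that(2)]] by simp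
      note s = st[OF k(2) q(2) k(3)] st[OF k'(2) q(3) k'(3)]
      show "ed (?X A) (?h A i) (?h A j) \<le> \<delta>"
        unfolding hom_ed_le_iff
      proof
        fix z assume z: "z \<in> pts (fobj F (discrete A))"
        note Fs = met_functor_in[OF F_functor df[OF A] Dp[OF q(1)] s(1) z] met_functor_in[OF F_functor df[OF A] Dp[OF q(1)] s(2) z]
        have "ed X (?h A i z) (?h A j z) \<le> ed (fobj F (fobj D q))
            (farr F (discrete A) (fobj D q) (compose A (farr D k q ()) g) z) (farr F (discrete A) (fobj D q) (compose A (farr D k' q ()) g') z)"
          unfolding k(1) k'(1) h_eq[OF k(2) q(2) k(3) z] h_eq[OF k'(2) q(3) k'(3) z] by (rule hom_le[OF u[OF q(1)] Fs])
        also have "\<dots> \<le> ed (hom_space (fobj F (discrete A)) (fobj F (fobj D q)))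
            (farr F (discrete A) (fobj D q) (compose A (farr D k q ()) g)) (farr F (discrete A) (fobj D q) (compose A (farr D k' q ()) g'))"
          by (rule hom_ed_ge[OF z])
        also have "\<dots> \<le> ed (hom_space (discrete A) (fobj D q)) (compose A (farr D k q ()) g) (compose A (farr D k' q ()) g')"
          by (rule met_functor_le[OF F_functor df[OF A] Dp[OF q(1)] s])
        finally show "ed X (?h A i z) (?h A j z) \<le> \<delta>" using close by simp
      qed
    qed
    \<comment> \<open>The closure of the relation between \<open>?a A i\<close> and
      \<open>?h A i\<close>: \<open>t\<close> is a limit value at \<open>f\<close>. Existence,
      uniqueness and distances of limit values come from the extension lemmas for closures.\<close>
    define Q where "Q A f t \<longleftrightarrow> t \<in> pts (?X A) \<and> (\<forall>e>0. \<exists>i\<in>?I A. ed (?M A) f (?a A i) < e \<and> ed (?X A) t (?h A i) < e)" for A f t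
    have Q_le: "ed (?X A) t t' \<le> ed (?M A) f f'"
      if A: "finite A" and f: "f \<in> A \<rightarrow>\<^sub>E pts c" "f' \<in> A \<rightarrow>\<^sub>E pts c" and Q: "Q A f t" "Q A f' t'" for A f f' t t'
      by (rule closure_relation_nonexpanding[where I = "?I A" and a = "?a A" and h = "?h A", OF M FX[OF A] a h[OF A] le[OF A] dh[OF f(1) c] dh[OF f(2) c]])
        (use Q in \<open>simp_all only: Q_def\<close>)
    have Q_unique: "t = t'" if A: "finite A" and f: "f \<in> A \<rightarrow>\<^sub>E pts c" and Q: "Q A f t" "Q A f t'" for A f t t'
    proof (rule ext_metric_eqD[OF FX[OF A]])
      have "ed (?M A) f f = 0" by (rule ext_metric_refl[OF M dh[OF f c]])
      then show "ed (?X A) t t' = 0" using Q_le[OF A f f Q] by simp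
    qed (use Q in \<open>simp_all only: Q_def\<close>)
    have "\<exists>t. Q A f t" if A: "finite A" and f: "f \<in> A \<rightarrow>\<^sub>E pts c" for A f
      using extend_to_closure[where I = "?I A" and a = "?a A" and h = "?h A", OF M FX[OF A] FXc a h[OF A] le[OF A] dc.finite_maps_dense[OF A f]]
      unfolding Q_def by blast
    then obtain \<tau> where \<tau>: "\<And>A f. finite A \<Longrightarrow> f \<in> A \<rightarrow>\<^sub>E pts c \<Longrightarrow> Q A f (\<tau> A f)" by metis
    have \<tau>_hom: "\<tau> A f \<in> homs (fobj F (discrete A)) X" if "finite A" "f \<in> A \<rightarrow>\<^sub>E pts c" for A f
      using \<tau>[OF that] by (simp only: Q_def)
    have "\<exists>t\<in>homs (fobj F c) X. \<forall>A f z. finite A \<longrightarrow> f \<in> A \<rightarrow>\<^sub>E pts c \<longrightarrow> z \<in> pts (fobj F (discrete A)) \<longrightarrow>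
      t (farr F (discrete A) c f z) = \<tau> A f z"
    proof (rule finite_family_extend[OF sf c X \<tau>_hom])
      fix A f f' z assume A: "finite A" and f: "f \<in> A \<rightarrow>\<^sub>E pts c" "f' \<in> A \<rightarrow>\<^sub>E pts c" and z: "z \<in> pts (fobj F (discrete A))"
      show "ed X (\<tau> A f z) (\<tau> A f' z) \<le> ed (?M A) f f'"
        by (rule order_trans[OF hom_ed_ge[OF z] Q_le[OF A f \<tau>[OF A f(1)] \<tau>[OF A f(2)]]])
    next
      fix A B :: "'u set" and s f z assume A: "finite A" "finite B" and s: "s \<in> A \<rightarrow>\<^sub>E B" and f: "f \<in> B \<rightarrow>\<^sub>E pts c"
        and z: "z \<in> pts (fobj F (discrete A))"
      have sh: "s \<in> homs (discrete A) (discrete B)" using dh[OF _ df[OF A(2)]] s by simp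
      note Fs = met_functor_hom[OF F_functor df[OF A(1)] df[OF A(2)] sh]
      have fs: "compose A f s \<in> A \<rightarrow>\<^sub>E pts c" using f s by (auto simp: compose_def)
      let ?t = "compose (pts (fobj F (discrete A))) (\<tau> B f) (farr F (discrete A) (discrete B) s)"
      \<comment> \<open>Precomposing approximants of \<open>f\<close> with \<open>s\<close> makes
        \<open>?t\<close> a limit value at \<open>compose A f s\<close>, so uniqueness of limit
        values yields compatibility.\<close>
      have "Q A (compose A f s) ?t"
        unfolding Q_def
      proof (intro conjI allI impI)
        show "?t \<in> pts (?X A)" by (rule hom_space_compose[OF Fs \<tau>_hom[OF A(2) f]])
        fix e :: ennreal assume "0 < e"
        then obtain i where i: "i \<in> ?I B" "ed (?M B) f (?a B i) < e" "ed (?X B) (\<tau> B f) (?h B i) < e"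
          using \<tau>[OF A(2) f] unfolding Q_def by blast
        obtain k g where k: "i = (k, g)" "k \<in> P" "g \<in> B \<rightarrow>\<^sub>E pts (fobj D k)" using i(1) by auto
        have gs: "compose A g s \<in> A \<rightarrow>\<^sub>E pts (fobj D k)" using k(3) s by (auto simp: compose_def)
        have "?a A (k, compose A g s) = compose A (?a B i) s"
          using s by (auto simp: k(1) compose_def fun_eq_iff)
        then have 1: "ed (?M A) (compose A f s) (?a A (k, compose A g s)) < e"
          using order.strict_trans1[OF hom_ed_compose_right[OF sh, of c f "?a B i"] i(2)] by simp
        have "?h A (k, compose A g s) = compose (pts (fobj F (discrete A))) (?h B i) (farr F (discrete A) (discrete B) s)"
          using met_functor_comp[OF F_functor df[OF A(1)] df[OF A(2)] Dp[OF k(2)] sh dh[OF k(3) Dp[OF k(2)]]]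
            hom_compose_assoc[OF Fs] by (simp add: k(1))
        then have 2: "ed (?X A) ?t (?h A (k, compose A g s)) < e"
          using order.strict_trans1[OF hom_ed_compose_right[OF Fs, of X "\<tau> B f" "?h B i"] i(3)] by simp
        show "\<exists>i\<in>?I A. ed (?M A) (compose A f s) (?a A i) < e \<and> ed (?X A) ?t (?h A i) < e"
          using 1 2 gs k(2) by (intro bexI[of _ "(k, compose A g s)"] conjI) simp_all
      qed
      then have "\<tau> A (compose A f s) = ?t" by (rule Q_unique[OF A(1) fs \<tau>[OF A(1) fs]])
      then show "\<tau> A (compose A f s) z = \<tau> B f (farr F (discrete A) (discrete B) s z)"
        using z by (simp add: compose_app)
    qed
    then obtain t where t: "t \<in> homs (fobj F c) X" and tf: "\<And>A f z. finite A \<Longrightarrow> f \<in> A \<rightarrow>\<^sub>E pts c \<Longrightarrow>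
      z \<in> pts (fobj F (discrete A)) \<Longrightarrow> t (farr F (discrete A) c f z) = \<tau> A f z" by blast
    have "t (farr F (fobj D p) c (dc.n p) z) = u p z" if p: "p \<in> P" and z: "z \<in> pts (fobj F (fobj D p))" for p z
    proof -
      note Fnp = met_functor_hom[OF F_functor Dp[OF p] c dc.n_hom[OF p]]
      \<comment> \<open>Uniqueness is used at the stage \<open>p\<close> in place of
        \<open>c\<close>: a map factoring through a stage approximates itself, so
        \<open>\<tau>\<close> takes there the value prescribed by \<open>u p\<close>.\<close>
      have "compose (pts (fobj F (fobj D p))) t (farr F (fobj D p) c (dc.n p)) = u p"
      proof (rule finite_family_unique[OF sf Dp[OF p] X hom_space_compose[OF Fnp t] u[OF p]])
        fix A g z assume A: "finite A" and g: "g \<in> A \<rightarrow>\<^sub>E pts (fobj D p)" and z: "z \<in> pts (fobj F (discrete A))"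
        note ng = dc.compose_n_in_homs[OF p g]
        have i: "(p, g) \<in> ?I A" using p g by simp
        have "Q A (compose A (dc.n p) g) (?h A (p, g))"
          unfolding Q_def using h[OF A i] i ext_metric_refl[OF M a[OF i]] ext_metric_refl[OF FX[OF A] h[OF A i]]
          by (intro conjI allI impI bexI[of _ "(p, g)"]) simp_all
        then have "\<tau> A (compose A (dc.n p) g) = ?h A (p, g)" by (rule Q_unique[OF A ng \<tau>[OF A ng]])
        then have "t (farr F (discrete A) c (compose A (dc.n p) g) z) = u p (farr F (discrete A) (fobj D p) g z)"
          using tf[OF A ng z] z by (simp add: compose_app)
        then show "compose (pts (fobj F (fobj D p))) t (farr F (fobj D p) c (dc.n p)) (farr F (discrete A) (fobj D p) g z)
            = u p (farr F (discrete A) (fobj D p) g z)"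
          using met_functor_in[OF F_functor df[OF A] Dp[OF p] dh[OF g Dp[OF p]] z] by (simp add: compose_app Fn[OF A p g z])
      qed
      from fun_cong[OF this, of z] show ?thesis using z by (simp add: compose_app)
    qed
    then show ?thesis using t by blast
  qed
  have obj: "Obj (poset_cat P r) = P" and w: "pts (fobj conical_weight d) = UNIV" for d
    by (simp_all add: poset_cat_def conical_weight_def)
  have "colimit_cocone V (poset_cat P r) ?FD conical_weight (fobj F c)
      (image_cocone F (poset_cat P r) D conical_weight c (wcolimit_unit c \<psi>))" (is "colimit_cocone _ _ _ _ _ ?\<nu>")
  proof (rule colimit_coconeI[OF met_functor_obj[OF F_functor c] image_cocone_in_cocones[OF F_functor D weight_conical c dc.\<nu>_in]])
    fix X \<tau> assume X: "X \<in> V" and \<tau>: "\<tau> \<in> cocones (poset_cat P r) ?FD conical_weight X"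
    have u: "\<tau> p () \<in> homs (fobj F (fobj D p)) X" if "p \<in> P" for p
      using coconesD(3)[OF \<tau>, of p "()"] that by (simp add: poset_cat_def conical_weight_def)
    have u_step: "\<tau> q () (farr F (fobj D p) (fobj D q) (farr D p q ()) z) = \<tau> p () z"
      if "p \<in> P" "q \<in> P" "(p, q) \<in> r" "z \<in> pts (fobj F (fobj D p))" for p q z
    proof -
      have "compose (pts (fobj ?FD p)) (\<tau> q ()) (farr ?FD p q ()) = \<tau> p (farr conical_weight q p () ())"
        using that by (intro coconesD(5)[OF \<tau>]) (simp_all add: poset_cat_def conical_weight_def)
      from fun_cong[OF this, of z] show ?thesis using that(4) by (simp add: compose_app)
    qed
    show "\<exists>f\<in>homs (fobj F c) X. \<forall>d\<in>Obj (poset_cat P r). \<forall>w\<in>pts (fobj conical_weight d). \<forall>z\<in>pts (fobj ?FD d).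
      f (?\<nu> d w z) = \<tau> d w z"
      using ex[of X "\<lambda>p. \<tau> p ()", OF X u u_step] by (simp add: obj \<nu> w)
  next
    fix X t t' assume X: "X \<in> V" and t: "t \<in> homs (fobj F c) X" "t' \<in> homs (fobj F c) X"
      and eq: "\<And>d w z. d \<in> Obj (poset_cat P r) \<Longrightarrow> w \<in> pts (fobj conical_weight d) \<Longrightarrow> z \<in> pts (fobj ?FD d) \<Longrightarrow>
        t (?\<nu> d w z) = t' (?\<nu> d w z)"
    show "t = t'"
    proof (rule uniq[OF X t])
      fix p z assume "p \<in> P" "z \<in> pts (fobj F (fobj D p))"
      then show "t (farr F (fobj D p) c (dc.n p) z) = t' (farr F (fobj D p) c (dc.n p) z)"
        using eq[of p "()" z] by (simp add: obj \<nu> w)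
    qed
  qed
  then show "preserves_wcolimit V F (poset_cat P r) D conical_weight c \<psi>"
    unfolding preserves_wcolimit_iff[OF F_functor D weight_conical] .
qed

end


theorem corollary2p32:
  fixes U :: "'u set set" and pr :: "'u \<times> 'u \<Rightarrow> 'u"
    and V :: "'u emet set"
    and F :: "('u emet, 'u \<Rightarrow> 'u, 'u emet, 'u \<Rightarrow> 'u) efun"
  assumes "universe U pr"
    and "V = Met U \<or> V = CMet U"
    and "enriched_functor (met_cat V) (met_cat V) F"
  shows "strongly_finitary V F \<longleftrightarrow>
           preserves_directed_colimits U V F \<and> preserves_precongruence_colimits pr V F"
proof -
  interpret small_sets U pr by unfold_locales (rule assms)
  have "Met U = spaces U False" "CMet U = spaces U True"
    by (auto simp: Met_def CMet_def spaces_def small_iff_in)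
  then obtain b where V: "V = spaces U b" using assms(2) by metis
  interpret met_endofunctor U pr b F
    by unfold_locales (use assms(3) V in simp)
  show ?thesis
    unfolding V
    using strongly_finitary_if_preserves strongly_finitary_preserves_directed strongly_finitary_preserves_precongruences by blast
qed

end
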